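(* In the setting of the context (problem, standing assumptions, algorithm run with horizon $T$, and parameters $\rho,\beta>0$), let $$\Lambda=306\,\tau_{\mathrm{mix}}(1+\log_2T),\quad \sigma_{\mathrm M}^2=2\Lambda G_\sigma^2,\quad L_{\mathrm M}^2=2\Lambda L^2,\quad T_0=\big\lceil(128\,\tau_{\mathrm{mix}})^{3/4}\big\rceil ,$$ and let $s_t=g_t-\nabla f(x_t)$. If $T\ge T_0$, then $\mathbb E_{-1}\|s_0\|^2\le\Lambda G_\sigma^2$ almost surely, and for every $1\le t\le T$, $$\mathbb E_{t-1}\|s_t\|^2\le(1-\alpha_t)\|s_{t-1}\|^2+2\alpha_t^2\,\sigma_{\mathrm M}^2+8L_{\mathrm M}^2\,\|x_t-x_{t-1}\|^2 .$$
   Context: $\|\cdot\|$ is the Euclidean norm. Problem: minimize $F(x)=f(x)+h(x)$ over $x\in\mathcal X\subset\mathbb R^n$, where $f(x)=\mathbb E_{z\sim\pi}[f(x;z)]$. Standing assumptions. (1) $\mathcal X$ is compact and convex with diameter $D$; $h:\mathbb R^n\to\mathbb R\cup\{+\infty\}$ is proper, closed, convex, finite and $G$-Lipschitz on $\mathcal X$; $x_0\in\mathcal X\cap\operatorname{dom}h$; $F^\ast=\inf_{\mathcal X}F$ is finite and attained. (2) For every $z\in\mathcal Z$, $f(\cdot;z)$ is differentiable on $\mathcal X$ with $\|\nabla f(x;z)-\nabla f(y;z)\|\le L\|x-y\|$ for $x,y\in\mathcal X$, and $\mathbb E_\pi[\nabla f(x;z)]=\nabla f(x)$ for $x\in\mathcal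 X$. (3) $\|\nabla f(x)\|\le G$ on $\mathcal X$, and a constant $\widehat G\ge G$ is known. (4) $G_\sigma<\infty$ satisfies $\sup_{x\in\mathcal X,z\in\mathcal Z}\|\nabla f(x;z)-\nabla f(x)\|\le G_\sigma$. (5) Samples are successive states of a single time-homogeneous ergodic Markov chain on $\mathcal Z$ with kernel $P$ and stationary distribution $\pi$; $d_{\mathrm{mix}}(k)=\sup_z d_{\mathrm{TV}}(P^k(z,\cdot),\pi)$ and $\tau_{\mathrm{mix}}=\min\{k\ge1:d_{\mathrm{mix}}(k)\le1/4\}<\infty$ ($d_{\mathrm{TV}}$ is total variation distance, with values in $[0,1]$). The initial state may be deterministic or random with any law. Oracle. $\mathrm{LMO}(g)=\operatorname{argmin}_{v\in\mathcal X}\langle v,g\rangle+h(v)$. Algorithm. Inputs: horizon $T$, $\rho>0$, $\beta>0$, $\widehat G\ge G$, $x_0$, chain state $z_0$. Set $x_{-1}=x_0$, $g_{-1}=0$, $\alpha_0=1$, $j_{\max}=\lfloor\log_2T\rfloor$. For $t=0,\dots,T$: (S1) If $t=0$, $\hat\alpha_0=\alpha_0=1$; otherwise, with $u_i=\beta+L_i^2\|x_{i+1}-x_i\|^2$, $\hat\alpha_t=\big(\frac{1+\max_{i<t}u_i}{1+\sum_{i<t}u_i}\big)^{2/3}$ and $\alpha_t=\min_{0\le k\le t}\hat\alpha_k$. Set $L_t=\rho\big(1+\sum_{i<t}L_i^2\|x_{i+1}-x_i\|^2\big)^{1/2}\alpha_t^{-1/4}$. (S2) Draw $J_t$ with $\Pr[J_t=j]=2^{-j}$,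 $j\ge1$, independently of the past and of the subsequent transition randomness; let $N_t=2^{J_t}$ if $J_t\le j_{\max}$ and $N_t=1$ otherwise; advance the chain $N_t$ steps from its current state, obtaining consecutive states $z_t^{(1)},\dots,z_t^{(N_t)}$. With $\hat\mu^j[\varphi]=2^{-j}\sum_{i=1}^{2^j}\varphi(z_t^{(i)})$, let $\hat\mu_t^{\mathrm{MLMC}}[\varphi]=\hat\mu^0[\varphi]+2^{J_t}(\hat\mu^{J_t}[\varphi]-\hat\mu^{J_t-1}[\varphi])\mathbf 1\{J_t\le j_{\max}\}$. For $y\in\{x_t,x_{t-1}\}$ set $\hat g_t(y)=\hat\mu_t^{\mathrm{MLMC}}[\nabla f(y;\cdot)]$ (same samples and same $J_t$ for both $y$). (S3) $g_t^{\mathrm{pre}}=(1-\alpha_t)(g_{t-1}-\hat g_t(x_{t-1}))+\hat g_t(x_t)$, and $g_t$ is the Euclidean projection of $g_t^{\mathrm{pre}}$ onto $\{g:\|g\|\le\widehat G\}$. (S4) $v_t\in\mathrm{LMO}(g_t)$; $\bar\eta_t=0$ if $v_t=x_t$, otherwise $\bar\eta_t=\min\big(\frac{h(x_t)-h(v_t)-\langle g_t,v_t-x_t\rangle}{L_t\|v_t-x_t\|^2},1\big)$; $x_{t+1}=x_t+\bar\eta_t(v_t-x_t)$. Filtration. $\mathcal F_{t-1}$ collects everything generated before the $t$-th burst (all iterates, previous bursts, $J_s$ for $s<t$, and the current chain state); $\mathcal F_{-1}$ contains $x_0$ and the initial chain state. $\mathbb E_{t-1}[\cdot]=\mathbb E[\cdot\mid\mathcal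 F_{t-1}]$. *)

theory Defs
  imports "HOL-Probability.Probability"
begin

definition tv_dist :: "'z measure \<Rightarrow> 'z measure \<Rightarrow> real" where
  "tv_dist \<mu> \<nu> = (SUP A\<in>sets \<mu>. \<bar>measure \<mu> A - measure \<nu> A\<bar>)"

primrec kernel_pow :: "'z measure \<Rightarrow> ('z \<Rightarrow> 'z measure) \<Rightarrow> nat \<Rightarrow> 'z \<Rightarrow> 'z measure" where
  "kernel_pow Z P 0 z = return Z z"
| "kernel_pow Z P (Suc k) z = kernel_pow Z P k z \<bind> P"

definition d_mix :: "'z measure \<Rightarrow> ('z \<Rightarrow> 'z measure) \<Rightarrow> 'z measure \<Rightarrow> nat \<Rightarrow> real" where
  "d_mix Z P \<pi> k = (SUP z\<in>space Z. tv_dist (kernel_pow Z P k z) \<pi>)"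

text \<open>Meaningful only if some \<open>k \<ge> 1\<close> qualifies, which \<open>ergodic_chain\<close> below requires.\<close>

definition tau_mix :: "'z measure \<Rightarrow> ('z \<Rightarrow> 'z measure) \<Rightarrow> 'z measure \<Rightarrow> nat" where
  "tau_mix Z P \<pi> = (LEAST k. 1 \<le> k \<and> d_mix Z P \<pi> k \<le> 1 / 4)"

locale ergodic_chain =
  fixes Z :: "'z measure" and P :: "'z \<Rightarrow> 'z measure" and \<pi> :: "'z measure"
  assumes kernel: "P \<in> Z \<rightarrow>\<^sub>M prob_algebra Z"
    and pi_prob: "\<pi> \<in> space (prob_algebra Z)"
    and stationary: "\<pi> \<bind> P = \<pi>"
    and ergodic: "\<And>z. z \<in> space Z \<Longrightarrow> (\<lambda>k. tv_dist (kernel_pow Z P k z) \<pi>) \<longlonglongrightarrow> 0"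
    and mixing_time_finite: "\<exists>k\<ge>1. d_mix Z P \<pi> k \<le> 1 / 4"

definition epi :: "('a \<Rightarrow> ereal) \<Rightarrow> ('a \<times> real) set" where
  "epi h = {(x, r). h x \<le> ereal r}"

definition expected_loss :: "'z measure \<Rightarrow> ('a \<Rightarrow> 'z \<Rightarrow> real) \<Rightarrow> 'a \<Rightarrow> real" where
  "expected_loss \<pi> fz x = (LINT z|\<pi>. fz x z)"

definition objective ::
    "'z measure \<Rightarrow> ('a \<Rightarrow> 'z \<Rightarrow> real) \<Rightarrow> ('a \<Rightarrow> ereal) \<Rightarrow> 'a \<Rightarrow> ereal" where
  "objective \<pi> fz h x = ereal (expected_loss \<pi> fz x) + h x"

text \<open>\<open>fz x z\<close>, \<open>gz x z\<close> and \<open>gf x\<close> stand for $f(x;z)$, $\nabla f(x;z)$ and $\nabla f(x)$.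
  Since the feasible set \<open>X\<close> may have empty interior, derivatives are taken within \<open>X\<close>; they
  then need not determine the gradients, so \<open>gz\<close> and \<open>gf\<close> are parameters.\<close>

locale composite_problem =
  fixes X :: "'a::euclidean_space set" and h :: "'a \<Rightarrow> ereal"
    and Z :: "'z measure" and \<pi> :: "'z measure"
    and fz :: "'a \<Rightarrow> 'z \<Rightarrow> real" and gz :: "'a \<Rightarrow> 'z \<Rightarrow> 'a" and gf :: "'a \<Rightarrow> 'a"
    and G L G\<^sub>\<sigma> :: real
  assumes X: "compact X" "convex X"
    and h_proper: "\<And>x. h x \<noteq> -\<infinity>" "\<exists>x. h x \<noteq> \<infinity>"
    and h_closed: "closed (epi h)"
    and h_convex: "convex (epi h)"
    and h_finite: "\<And>x. x \<in> X \<Longrightarrow> h x \<noteq> \<infinity>"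
    and h_lipschitz: "G-lipschitz_on X (\<lambda>x. real_of_ereal (h x))"
    and optimum_finite: "\<bar>INF x\<in>X. objective \<pi> fz h x\<bar> \<noteq> \<infinity>"
    and optimum_attained: "\<exists>x\<in>X. objective \<pi> fz h x = (INF y\<in>X. objective \<pi> fz h y)"
    and loss_integrable: "\<And>x. x \<in> X \<Longrightarrow> integrable \<pi> (fz x)"
    and sample_gradient: "\<And>x z. x \<in> X \<Longrightarrow> z \<in> space Z \<Longrightarrow>
      ((\<lambda>y. fz y z) has_derivative (\<lambda>d. gz x z \<bullet> d)) (at x within X)"
    and gradient: "\<And>x. x \<in> X \<Longrightarrow>
      (expected_loss \<pi> fz has_derivative (\<lambda>d. gf x \<bullet> d)) (at x within X)"
    and gradient_lipschitz: "\<And>z. z \<in> space Z \<Longrightarrow> L-lipschitz_on X (\<lambda>x. gz x z)"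
    and gradient_integrable: "\<And>x. x \<in> X \<Longrightarrow> integrable \<pi> (gz x)"
    and gradient_unbiased: "\<And>x. x \<in> X \<Longrightarrow> (LINT z|\<pi>. gz x z) = gf x"
    and gradient_bound: "\<And>x. x \<in> X \<Longrightarrow> norm (gf x) \<le> G"
    and noise_bound: "\<And>x z. x \<in> X \<Longrightarrow> z \<in> space Z \<Longrightarrow> norm (gz x z - gf x) \<le> G\<^sub>\<sigma>"

definition LMO :: "'a::euclidean_space set \<Rightarrow> ('a \<Rightarrow> ereal) \<Rightarrow> 'a \<Rightarrow> 'a set" where
  "LMO X h g = {v. is_arg_min (\<lambda>w. ereal (w \<bullet> g) + h w) (\<lambda>w. w \<in> X) v}"

definition j_max :: "nat \<Rightarrow> nat" where
  "j_max T = nat \<lfloor>log 2 (real T)\<rfloor>"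

definition burst_len :: "nat \<Rightarrow> nat \<Rightarrow> nat" where
  "burst_len T j = (if j \<le> j_max T then 2 ^ j else 1)"

text \<open>Number of chain steps made before burst \<open>t\<close>: that burst starts from the chain state with
  this index and consists of the next \<open>burst_len T (J t)\<close> states.\<close>

definition burst_start :: "nat \<Rightarrow> (nat \<Rightarrow> nat) \<Rightarrow> nat \<Rightarrow> nat" where
  "burst_start T J t = (\<Sum>s<t. burst_len T (J s))"

text \<open>In \<open>emp_mean\<close> and \<open>mlmc\<close>, \<open>z i\<close> is the \<open>i\<close>-th state of the burst, \<open>i \<ge> 1\<close>;
  \<open>z 0\<close>, the state before the burst, is not used.\<close>

definition emp_mean :: "(nat \<Rightarrow> 'z) \<Rightarrow> nat \<Rightarrow> ('z \<Rightarrow> 'a::real_vector) \<Rightarrow> 'a" where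
  "emp_mean z j \<phi> = (1 / 2 ^ j) *\<^sub>R (\<Sum>i=1..2 ^ j. \<phi> (z i))"

definition mlmc :: "nat \<Rightarrow> nat \<Rightarrow> (nat \<Rightarrow> 'z) \<Rightarrow> ('z \<Rightarrow> 'a::real_vector) \<Rightarrow> 'a" where
  "mlmc T j z \<phi> = emp_mean z 0 \<phi> +
     (if j \<le> j_max T then 2 ^ j *\<^sub>R (emp_mean z j \<phi> - emp_mean z (j - 1) \<phi>) else 0)"

text \<open>\<open>l i\<close> is the adaptive constant $L_i$ of the algorithm, not the smoothness constant \<open>L\<close>.\<close>

definition weighted_step :: "(nat \<Rightarrow> real) \<Rightarrow> (nat \<Rightarrow> 'a::real_normed_vector) \<Rightarrow> nat \<Rightarrow> real" where
  "weighted_step l x i = (l i)\<^sup>2 * (norm (x (Suc i) - x i))\<^sup>2"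

definition alpha_hat ::
    "real \<Rightarrow> (nat \<Rightarrow> real) \<Rightarrow> (nat \<Rightarrow> 'a::real_normed_vector) \<Rightarrow> nat \<Rightarrow> real" where
  "alpha_hat \<beta> l x t = (if t = 0 then 1 else
     ((1 + Max ((\<lambda>i. \<beta> + weighted_step l x i) ` {..<t})) /
      (1 + (\<Sum>i<t. \<beta> + weighted_step l x i))) powr (2 / 3))"

definition alpha ::
    "real \<Rightarrow> (nat \<Rightarrow> real) \<Rightarrow> (nat \<Rightarrow> 'a::real_normed_vector) \<Rightarrow> nat \<Rightarrow> real" where
  "alpha \<beta> l x t = Min (alpha_hat \<beta> l x ` {..t})"

text \<open>\<open>y\<close> is the path of the Markov chain. The conventions $x_{-1} = x_0$ and $g_{-1} = 0$
  are realised by truncated subtraction in \<open>x (t - 1)\<close> and by the case distinction for the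
  previous \<open>g\<close>.\<close>

definition mlmc_fw_run ::
    "'a::euclidean_space set \<Rightarrow> ('a \<Rightarrow> ereal) \<Rightarrow> ('a \<Rightarrow> 'z \<Rightarrow> 'a) \<Rightarrow> nat \<Rightarrow> real \<Rightarrow> real \<Rightarrow> real \<Rightarrow>
     (nat \<Rightarrow> 'z) \<Rightarrow> (nat \<Rightarrow> nat) \<Rightarrow> (nat \<Rightarrow> 'a) \<Rightarrow> (nat \<Rightarrow> 'a) \<Rightarrow> (nat \<Rightarrow> 'a) \<Rightarrow> (nat \<Rightarrow> real) \<Rightarrow> bool"
  where
  "mlmc_fw_run X h gz T \<rho> \<beta> G' y J x g v l \<longleftrightarrow>
     x 0 \<in> X \<and> h (x 0) \<noteq> \<infinity> \<and>
     (\<forall>t\<le>T.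
       (let \<alpha> = alpha \<beta> l x t;
            z = (\<lambda>i. y (burst_start T J t + i));
            g_hat = (\<lambda>w. mlmc T (J t) z (gz w));
            g_prev = (if t = 0 then 0 else g (t - 1));
            g_pre = (1 - \<alpha>) *\<^sub>R (g_prev - g_hat (x (t - 1))) + g_hat (x t);
            \<eta> = (if v t = x t then 0 else
                   min ((real_of_ereal (h (x t)) - real_of_ereal (h (v t)) - g t \<bullet> (v t - x t)) /
                        (l t * (norm (v t - x t))\<^sup>2)) 1)
        in l t = \<rho> * sqrt (1 + (\<Sum>i<t. weighted_step l x i)) * \<alpha> powr (- 1 / 4) \<and>
           g t = closest_point (cball 0 G') g_pre \<and>
           v t \<in> LMO X h (g t) \<and>
           x (Suc t) = x t + \<eta> *\<^sub>R (v t - x t)))"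

text \<open>\<open>history \<dots> t\<close> is $\mathcal F_{t-1}$. The chain is recorded up to the (random) start of
  burst \<open>t\<close> through the stopped path.\<close>

definition history ::
    "'w measure \<Rightarrow> 'z measure \<Rightarrow> nat \<Rightarrow> (nat \<Rightarrow> 'w \<Rightarrow> 'z) \<Rightarrow> (nat \<Rightarrow> 'w \<Rightarrow> nat) \<Rightarrow>
     (nat \<Rightarrow> 'w \<Rightarrow> 'a::euclidean_space) \<Rightarrow> (nat \<Rightarrow> 'w \<Rightarrow> 'a) \<Rightarrow> (nat \<Rightarrow> 'w \<Rightarrow> 'a) \<Rightarrow> nat \<Rightarrow> 'w measure"
  where
  "history M Z T Y J x g v t = sigma (space M)
     ((\<Union>s\<le>t. sets (vimage_algebra (space M) (x s) borel)) \<union>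
      (\<Union>s<t. sets (vimage_algebra (space M) (g s) borel)) \<union>
      (\<Union>s<t. sets (vimage_algebra (space M) (v s) borel)) \<union>
      (\<Union>s<t. sets (vimage_algebra (space M) (J s) (count_space UNIV))) \<union>
      (\<Union>k. sets (vimage_algebra (space M)
                    (\<lambda>\<omega>. Y (min k (burst_start T (\<lambda>s. J s \<omega>) t)) \<omega>) Z)))"

text \<open>Everything known after \<open>i\<close> steps of burst \<open>t\<close>: additionally \<open>J t\<close> and the first \<open>i\<close>
  states of the burst.\<close>

definition burst_history ::
    "'w measure \<Rightarrow> 'z measure \<Rightarrow> nat \<Rightarrow> (nat \<Rightarrow> 'w \<Rightarrow> 'z) \<Rightarrow> (nat \<Rightarrow> 'w \<Rightarrow> nat) \<Rightarrow>
     (nat \<Rightarrow> 'w \<Rightarrow> 'a::euclidean_space) \<Rightarrow> (nat \<Rightarrow> 'w \<Rightarrow> 'a) \<Rightarrow> (nat \<Rightarrow> 'w \<Rightarrow> 'a) \<Rightarrow>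
     nat \<Rightarrow> nat \<Rightarrow> 'w measure"
  where
  "burst_history M Z T Y J x g v t i = sigma (space M)
     (sets (history M Z T Y J x g v t) \<union>
      sets (vimage_algebra (space M) (J t) (count_space UNIV)) \<union>
      (\<Union>k\<in>{1..i}. sets (vimage_algebra (space M)
                    (\<lambda>\<omega>. Y (burst_start T (\<lambda>s. J s \<omega>) t + k) \<omega>) Z)))"

text \<open>\<open>Y\<close> is the single Markov chain, \<open>Y 0\<close> its initial state (of arbitrary law). In
  \<open>chain_step\<close>, the next state has law \<open>P\<close> of the current state given everything generated so
  far, including \<open>J t\<close>; this is at once the Markov property and the independence of \<open>J t\<close> from
  the subsequent transition randomness. Ties in the oracle may be broken arbitrarily, even at
  random, as long as \<open>v t\<close> does not anticipate later draws: this is ensured because \<open>v t\<close>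
  belongs to the history of all later bursts.\<close>

locale mlmc_fw =
  ergodic_chain Z P \<pi> + composite_problem X h Z \<pi> fz gz gf G L G\<^sub>\<sigma> + prob_space M
  for Z :: "'z measure" and P :: "'z \<Rightarrow> 'z measure" and \<pi> :: "'z measure"
    and X :: "'a::euclidean_space set" and h :: "'a \<Rightarrow> ereal"
    and fz :: "'a \<Rightarrow> 'z \<Rightarrow> real" and gz :: "'a \<Rightarrow> 'z \<Rightarrow> 'a" and gf :: "'a \<Rightarrow> 'a"
    and G L G\<^sub>\<sigma> :: real
    and M :: "'w measure" +
  fixes T :: nat and \<rho> \<beta> G' :: real
    and Y :: "nat \<Rightarrow> 'w \<Rightarrow> 'z" and J :: "nat \<Rightarrow> 'w \<Rightarrow> nat"
    and x g v :: "nat \<Rightarrow> 'w \<Rightarrow> 'a" and l :: "nat \<Rightarrow> 'w \<Rightarrow> real"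
  assumes params: "\<rho> > 0" "\<beta> > 0" "G' \<ge> G"
    and run: "\<And>\<omega>. \<omega> \<in> space M \<Longrightarrow> mlmc_fw_run X h gz T \<rho> \<beta> G'
      (\<lambda>k. Y k \<omega>) (\<lambda>t. J t \<omega>) (\<lambda>t. x t \<omega>) (\<lambda>t. g t \<omega>) (\<lambda>t. v t \<omega>) (\<lambda>t. l t \<omega>)"
    and x0_measurable: "x 0 \<in> borel_measurable M"
    and v_measurable: "\<And>t. t \<le> T \<Longrightarrow> v t \<in> borel_measurable M"
    and Y_measurable: "\<And>k. Y k \<in> M \<rightarrow>\<^sub>M Z"
    and J_measurable: "\<And>t. t \<le> T \<Longrightarrow> J t \<in> M \<rightarrow>\<^sub>M count_space UNIV"
    and J_law: "\<And>t j. t \<le> T \<Longrightarrow> 1 \<le> j \<Longrightarrow> prob {\<omega> \<in> space M. J t \<omega> = j} = (1 / 2) ^ j"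
    and J_indep: "\<And>t. t \<le> T \<Longrightarrow> indep_set (sets (history M Z T Y J x g v t))
      (sets (vimage_algebra (space M) (J t) (count_space UNIV)))"
    and chain_step: "\<And>t i B. t \<le> T \<Longrightarrow> B \<in> sets Z \<Longrightarrow>
      AE \<omega> in M. i < burst_len T (J t \<omega>) \<longrightarrow>
        real_cond_exp M (burst_history M Z T Y J x g v t i)
          (\<lambda>\<omega>'. indicat_real B (Y (burst_start T (\<lambda>s. J s \<omega>') t + Suc i) \<omega>')) \<omega>
        = measure (P (Y (burst_start T (\<lambda>s. J s \<omega>) t + i) \<omega>)) B"

end

theory Submission
  imports Defs
begin

text \<open>
  Write $\xi$ for the multilevel estimate, on burst \<open>t\<close>, of the field
  $\psi(z) = \nabla f(x_t;z) - \nabla f(x_t) - (1-\alpha_t)(\nabla f(x_{t-1};z) - \nabla f(x_{t-1}))$.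
  Since the estimator is linear and reproduces constants, the error before projection is
  $(1-\alpha_t)s_{t-1} + \xi$, and projecting onto a ball that contains $\nabla f(x_t)$ does not
  increase it (\<open>error_le\<close>). The field has mean zero under \<open>\<pi>\<close> and is bounded by
  $C = \alpha_t G_\sigma + 2L\|x_t - x_{t-1}\|$ (\<open>norm_noise_le\<close>); field and bound are known before the
  burst. It remains to bound, conditionally on the past, the bias and the second moment of $\xi$,
  and to expand the square.

  Mixing. The \<open>\<tau>\<close>-step kernel halves the oscillation of bounded functions, whence
  $|P^m f| \le 2 \|f\|_\infty 2^{-\lfloor m/\tau\rfloor}$ if $\pi f = 0$ (\<open>Q_mixing\<close>). These rates sum to at most
  $2\tau$, so the correlations along a burst give a second moment of at most $8 \tau n C^2$ for the sum
  of \<open>n\<close> states (\<open>second_moment_sum_le\<close>), that is, $8 \tau C^2 / 2^j$ for the mean at level \<open>j\<close>. Level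
  \<open>j\<close> has probability $2^{-j}$ and its correction is scaled by $2^j$, so each level contributes
  $O(\tau C^2)$ and the second moment of $\xi$ is at most $(2 + 96 \tau j_{\max}) C^2$
  (\<open>estimate_second_moment\<close>). In expectation the corrections telescope to the mean over
  $2^{j_{\max}} \ge T/2$ states, so the bias is at most $4 \tau C / 2^{j_{\max}} \le 8 \tau C / T$
  (\<open>estimate_bias\<close>).

  Conclusion. By Young's inequality the cross term $2 (1-\alpha_t) \|s_{t-1}\| \cdot 8 \tau C / T$ is at most
  $(1-\alpha_t) \alpha_t \|s_{t-1}\|^2$ plus $64 \tau^2 C^2 / (T^2 \alpha_t)$. Since
  $\alpha_t \ge T^{-2/3}$ and $T^{4/3} \ge 128 \tau$, the latter is at most $\tau C^2 / 2$
  (\<open>bias_sq_le\<close>), and the total is at most $(1-\alpha_t)\|s_{t-1}\|^2 + \Lambda C^2$.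

  Conditional expectations are handled through integrals against weights that are measurable with
  respect to the past. The Markov property enters as an identity for integrals of functions of the
  past and the next state (\<open>integral_later_state\<close>), and an inequality between integrals over all
  events of the past yields the almost sure one (\<open>real_cond_exp_le_of_set_integrals\<close>).
\<close>

section \<open>Total variation and geometric mixing\<close>

lemma abs_measure_diff_le_tv_dist:
  assumes "prob_space \<mu>" "prob_space \<nu>" "A \<in> sets \<mu>"
  shows "\<bar>measure \<mu> A - measure \<nu> A\<bar> \<le> tv_dist \<mu> \<nu>"
proof -
  interpret \<mu>: prob_space \<mu> by fact
  interpret \<nu>: prob_space \<nu> by fact
  have "bdd_above ((\<lambda>A. \<bar>measure \<mu> A - measure \<nu> A\<bar>) ` sets \<mu>)"
    by (rule bdd_aboveI2[where M=1])
       (smt (verit, ccfv_SIG) \<mu>.prob_le_1 \<nu>.prob_le_1 measure_nonneg)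
  then show ?thesis
    unfolding tv_dist_def using assms(3) by (intro cSUP_upper)
qed

lemma tv_dist_le_1:
  assumes "prob_space \<mu>" "prob_space \<nu>"
  shows "tv_dist \<mu> \<nu> \<le> 1"
proof -
  interpret \<mu>: prob_space \<mu> by fact
  interpret \<nu>: prob_space \<nu> by fact
  show ?thesis
    unfolding tv_dist_def
    by (rule cSUP_least)
       (use sets.top in blast, smt (verit, ccfv_SIG) \<mu>.prob_le_1 \<nu>.prob_le_1 measure_nonneg)
qed

lemma threshold_average_bounds:
  fixes y :: real
  assumes "0 \<le> y" "y \<le> 1" "0 < n"
  defines "S \<equiv> (\<Sum>i=1..n. if real i / real n \<le> y then 1 else 0) / real n"
  shows "S \<le> y" "y \<le> S + 1 / real n"
proof -
  have "(\<Sum>i=1..n. if real i / real n \<le> y then 1 else 0) = real (card {i\<in>{1..n}. real i / real n \<le> y})"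
    by (simp add: sum.If_cases Int_def)
  moreover have "{i\<in>{1..n}. real i / real n \<le> y} = {1..nat \<lfloor>real n * y\<rfloor>}"
  proof -
    have "nat \<lfloor>real n * y\<rfloor> \<le> n"
      using assms by (smt (verit) floor_le_iff mult_left_le nat_le_iff of_int_of_nat_eq of_nat_0_le_iff)
    moreover have iff: "real i / real n \<le> y \<longleftrightarrow> i \<le> nat \<lfloor>real n * y\<rfloor>" for i
    proof -
      have "real i / real n \<le> y \<longleftrightarrow> real i \<le> real n * y"
        using assms(3) by (simp add: pos_divide_le_eq mult.commute)
      also have "\<dots> \<longleftrightarrow> i \<le> nat \<lfloor>real n * y\<rfloor>"
        using assms(1) by (simp add: le_nat_iff le_floor_iff)
      finally show ?thesis .
    qed
    ultimately show ?thesis unfolding iff by (intro set_eqI iffI) simp_all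
  qed
  ultimately have "(\<Sum>i=1..n. if real i / real n \<le> y then 1 else 0) = real (nat \<lfloor>real n * y\<rfloor>)"
    by (simp only: card_atLeastAtMost diff_Suc_1)
  then have S: "S = real (nat \<lfloor>real n * y\<rfloor>) / real n"
    by (simp only: S_def)
  have "0 \<le> real n * y" using assms(1) by simp
  then have "real (nat \<lfloor>real n * y\<rfloor>) \<le> real n * y" "real n * y \<le> real (nat \<lfloor>real n * y\<rfloor>) + 1"
    by linarith+
  then show "S \<le> y" "y \<le> S + 1 / real n"
    using assms(3) unfolding S by (simp_all add: field_simps)
qed

text \<open>Testing total variation against functions with values in \<open>[0, 1]\<close>: round \<open>f\<close> down to
  multiples of \<open>1 / n\<close>; the rounded function is an average of \<open>n\<close> indicator functions.\<close>

lemma abs_integral_diff_le_tv_dist: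
  assumes \<mu>: "prob_space \<mu>" and \<nu>: "prob_space \<nu>" and sets_eq: "sets \<mu> = sets \<nu>"
    and f: "f \<in> borel_measurable \<mu>" and f01: "\<And>z. z \<in> space \<mu> \<Longrightarrow> 0 \<le> f z \<and> f z \<le> (1::real)"
  shows "\<bar>(LINT z|\<mu>. f z) - (LINT z|\<nu>. f z)\<bar> \<le> tv_dist \<mu> \<nu>"
proof -
  have space_eq: "space \<mu> = space \<nu>" using sets_eq by (rule sets_eq_imp_space_eq)
  define E where "E n i = {z \<in> space \<mu>. real i / real n \<le> f z}" for n i :: nat
  have E: "E n i \<in> sets \<mu>" for n i unfolding E_def using f by measurable
  have approx: "(\<Sum>i=1..n. measure \<kappa> (E n i)) / real n \<le> (LINT z|\<kappa>. f z) \<and>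
      (LINT z|\<kappa>. f z) \<le> (\<Sum>i=1..n. measure \<kappa> (E n i)) / real n + 1 / real n"
    if \<kappa>: "prob_space \<kappa>" "sets \<kappa> = sets \<mu>" and n: "0 < n" for \<kappa> n
  proof -
    interpret prob_space \<kappa> by fact
    have sp: "space \<kappa> = space \<mu>" using \<kappa>(2) by (rule sets_eq_imp_space_eq)
    have E': "E n i \<in> sets \<kappa>" for i using E \<kappa>(2) by simp
    have f_int: "integrable \<kappa> f"
      using f \<kappa>(2) f01 by (intro integrable_const_bound[where B=1])
        (auto simp: sp cong: measurable_cong_sets)
    have S_int: "integrable \<kappa> (\<lambda>z. (\<Sum>i=1..n. indicat_real (E n i) z) / real n)"
      using E' by (auto intro!: integrable_real_indicator simp: emeasure_eq_measure)
    have int_S: "(LINT z|\<kappa>. (\<Sum>i=1..n. indicat_real (E n i) z) / real n)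
        = (\<Sum>i=1..n. measure \<kappa> (E n i)) / real n"
      using E' by (subst integral_divide_zero, subst Bochner_Integration.integral_sum)
        (auto intro!: integrable_real_indicator simp: emeasure_eq_measure)
    have bounds: "(\<Sum>i=1..n. indicat_real (E n i) z) / real n \<le> f z \<and>
        f z \<le> (\<Sum>i=1..n. indicat_real (E n i) z) / real n + 1 / real n" if "z \<in> space \<kappa>" for z
    proof -
      have "(\<Sum>i=1..n. indicat_real (E n i) z) = (\<Sum>i=1..n. if real i / real n \<le> f z then 1 else 0)"
        using that by (intro sum.cong) (auto simp: E_def sp)
      then show ?thesis
        using threshold_average_bounds[of "f z" n] f01[of z] that n by (simp only: sp)
    qed
    have "(LINT z|\<kappa>. (\<Sum>i=1..n. indicat_real (E n i) z) / real n) \<le> (LINT z|\<kappa>. f z)"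
      using bounds by (intro integral_mono S_int f_int) blast
    moreover have "(LINT z|\<kappa>. f z) \<le> (LINT z|\<kappa>. (\<Sum>i=1..n. indicat_real (E n i) z) / real n + 1 / real n)"
      using bounds by (intro integral_mono Bochner_Integration.integrable_add S_int f_int integrable_const) blast
    moreover have "(LINT z|\<kappa>. (\<Sum>i=1..n. indicat_real (E n i) z) / real n + 1 / real n)
        = (LINT z|\<kappa>. (\<Sum>i=1..n. indicat_real (E n i) z) / real n) + 1 / real n"
      using S_int by (subst Bochner_Integration.integral_add) (auto simp: prob_space)
    ultimately show ?thesis unfolding int_S by simp
  qed
  have "\<bar>(LINT z|\<mu>. f z) - (LINT z|\<nu>. f z)\<bar> \<le> tv_dist \<mu> \<nu> + 1 / real (Suc n)" for n
  proof -
    let ?n = "Suc n"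
    have "\<bar>(\<Sum>i=1..?n. measure \<mu> (E ?n i)) - (\<Sum>i=1..?n. measure \<nu> (E ?n i))\<bar>
        \<le> (\<Sum>i=1..?n. \<bar>measure \<mu> (E ?n i) - measure \<nu> (E ?n i)\<bar>)"
      unfolding sum_subtractf[symmetric] by (rule sum_abs)
    also have "\<dots> \<le> real ?n * tv_dist \<mu> \<nu>"
      using sum_bounded_above[of "{1..?n}" "\<lambda>i. \<bar>measure \<mu> (E ?n i) - measure \<nu> (E ?n i)\<bar>" "tv_dist \<mu> \<nu>"]
        abs_measure_diff_le_tv_dist[OF \<mu> \<nu> E] by simp
    finally have "\<bar>(\<Sum>i=1..?n. measure \<mu> (E ?n i)) / real ?n - (\<Sum>i=1..?n. measure \<nu> (E ?n i)) / real ?n\<bar>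
        \<le> tv_dist \<mu> \<nu>"
      unfolding diff_divide_distrib[symmetric] abs_divide by (simp add: field_simps del: of_nat_Suc)
    then show ?thesis
      using approx[OF \<mu> refl, of ?n] approx[OF \<nu> sets_eq[symmetric], of ?n] by linarith
  qed
  then have "\<bar>(LINT z|\<mu>. f z) - (LINT z|\<nu>. f z)\<bar> - tv_dist \<mu> \<nu> \<le> 1 / real (Suc n)" for n
    by (simp add: algebra_simps)
  then have "\<bar>(LINT z|\<mu>. f z) - (LINT z|\<nu>. f z)\<bar> - tv_dist \<mu> \<nu> \<le> 0"
    by (intro LIMSEQ_le_const[OF LIMSEQ_inverse_real_of_nat]) (auto simp: inverse_eq_divide)
  then show ?thesis by simp
qed

lemma abs_integral_diff_le_osc:
  assumes \<mu>: "prob_space \<mu>" and \<nu>: "prob_space \<nu>" and sets_eq: "sets \<mu> = sets \<nu>"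
    and f: "f \<in> borel_measurable \<mu>"
    and osc: "\<And>z z'. z \<in> space \<mu> \<Longrightarrow> z' \<in> space \<mu> \<Longrightarrow> f z - f z' \<le> (c::real)"
  shows "\<bar>(LINT z|\<mu>. f z) - (LINT z|\<nu>. f z)\<bar> \<le> c * tv_dist \<mu> \<nu>"
proof -
  interpret \<mu>: prob_space \<mu> by fact
  interpret \<nu>: prob_space \<nu> by fact
  have space_eq: "space \<mu> = space \<nu>" using sets_eq by (rule sets_eq_imp_space_eq)
  obtain z0 where z0: "z0 \<in> space \<mu>" using \<mu>.not_empty by blast
  have f\<nu>: "f \<in> borel_measurable \<nu>" using f sets_eq by (simp cong: measurable_cong_sets)
  have bnd: "\<bar>f z\<bar> \<le> \<bar>f z0\<bar> + c" if "z \<in> space \<mu>" for z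
    using osc[OF that z0] osc[OF z0 that] by linarith
  have int: "integrable \<mu> f" "integrable \<nu> f"
    using f f\<nu> bnd by (auto intro!: \<mu>.integrable_const_bound[where B="\<bar>f z0\<bar> + c"]
        \<nu>.integrable_const_bound[where B="\<bar>f z0\<bar> + c"] simp: space_eq)
  show ?thesis
  proof (cases "c = 0")
    case True
    then have "f z = f z0" if "z \<in> space \<mu>" for z
      using osc[OF that z0] osc[OF z0 that] by simp
    then have "(LINT z|\<mu>. f z) = (LINT z|\<mu>. f z0)" "(LINT z|\<nu>. f z) = (LINT z|\<nu>. f z0)"
      by (intro Bochner_Integration.integral_cong refl, simp add: space_eq)+
    then have "(LINT z|\<mu>. f z) = f z0" "(LINT z|\<nu>. f z) = f z0"
      using \<mu>.prob_space \<nu>.prob_space by (simp_all)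
    then show ?thesis using True by simp
  next
    case False
    then have c: "c > 0" using osc[OF z0 z0] by simp
    define a where "a = (INF z\<in>space \<mu>. f z)"
    have "bdd_below (f ` space \<mu>)"
      using bnd by (intro bdd_belowI2[where m="- (\<bar>f z0\<bar> + c)"]) fastforce
    then have lower: "a \<le> f z" if "z \<in> space \<mu>" for z
      unfolding a_def using that by (rule cINF_lower)
    have upper: "f z \<le> a + c" if "z \<in> space \<mu>" for z
    proof -
      have "f z - c \<le> a"
        unfolding a_def using z0 osc[OF that] by (intro cINF_greatest) (auto simp: algebra_simps)
      then show ?thesis by simp
    qed
    have "\<bar>(LINT z|\<mu>. (f z - a) / c) - (LINT z|\<nu>. (f z - a) / c)\<bar> \<le> tv_dist \<mu> \<nu>"
      using f lower upper c
      by (intro abs_integral_diff_le_tv_dist[OF \<mu> \<nu> sets_eq]) (auto simp: field_simps)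
    moreover have "(LINT z|\<mu>. (f z - a) / c) = ((LINT z|\<mu>. f z) - a) / c"
      "(LINT z|\<nu>. (f z - a) / c) = ((LINT z|\<nu>. f z) - a) / c"
      using int by (simp_all add: \<mu>.prob_space \<nu>.prob_space)
    moreover have "((LINT z|\<mu>. f z) - a) / c - ((LINT z|\<nu>. f z) - a) / c
        = ((LINT z|\<mu>. f z) - (LINT z|\<nu>. f z)) / c"
      by (simp add: diff_divide_distrib)
    ultimately show ?thesis
      using c by (simp add: abs_divide field_simps)
  qed
qed

context ergodic_chain
begin

abbreviation "\<tau> \<equiv> tau_mix Z P \<pi>"

lemma pi_prob_space: "prob_space \<pi>" and sets_pi[simp, measurable_cong]: "sets \<pi> = sets Z"
  and space_pi[simp]: "space \<pi> = space Z"
  using pi_prob by (auto simp: space_prob_algebra dest: sets_eq_imp_space_eq)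

lemma kernel_pow_measurable[measurable]: "kernel_pow Z P k \<in> Z \<rightarrow>\<^sub>M prob_algebra Z"
proof (induction k)
  case 0
  have "kernel_pow Z P 0 = return Z" by (rule ext) simp
  then show ?case by simp
next
  case (Suc k)
  have "kernel_pow Z P (Suc k) = (\<lambda>z. kernel_pow Z P k z \<bind> P)" by (rule ext) simp
  then show ?case using measurable_bind_prob_space[OF Suc kernel] by simp
qed

lemma kernel_pow_subprob[measurable]: "kernel_pow Z P k \<in> Z \<rightarrow>\<^sub>M subprob_algebra Z"
  by (rule measurable_prob_algebraD) (rule kernel_pow_measurable)

lemma
  assumes "z \<in> space Z"
  shows prob_space_kernel_pow: "prob_space (kernel_pow Z P k z)"
    and sets_kernel_pow: "sets (kernel_pow Z P k z) = sets Z"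
    and space_kernel_pow: "space (kernel_pow Z P k z) = space Z"
  using measurable_space[OF kernel_pow_measurable assms, of k]
  by (auto simp: space_prob_algebra dest: sets_eq_imp_space_eq)

lemma kernel_pow_add:
  assumes z: "z \<in> space Z"
  shows "kernel_pow Z P (m + n) z = kernel_pow Z P m z \<bind> kernel_pow Z P n"
proof (induction n)
  case 0
  have "kernel_pow Z P 0 = return Z" by (rule ext) simp
  moreover have "return Z = return (kernel_pow Z P m z)"
    by (rule ext, rule return_cong) (simp add: sets_kernel_pow[OF z])
  ultimately show ?case by (simp add: bind_return')
next
  case (Suc n)
  have M: "kernel_pow Z P k \<in> kernel_pow Z P m z \<rightarrow>\<^sub>M subprob_algebra Z" for k
    using kernel_pow_subprob[of k] by (simp add: sets_kernel_pow[OF z] cong: measurable_cong_sets)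
  have "kernel_pow Z P (m + Suc n) z = (kernel_pow Z P m z \<bind> kernel_pow Z P n) \<bind> P"
    using Suc by simp
  also have "\<dots> = kernel_pow Z P m z \<bind> (\<lambda>y. kernel_pow Z P n y \<bind> P)"
    by (rule bind_assoc[OF M measurable_prob_algebraD[OF kernel]])
  also have "(\<lambda>y. kernel_pow Z P n y \<bind> P) = kernel_pow Z P (Suc n)" by (rule ext) simp
  finally show ?case .
qed

lemma pi_bind_kernel_pow: "\<pi> \<bind> kernel_pow Z P k = \<pi>"
proof (induction k)
  case 0
  have "kernel_pow Z P 0 = return Z" by (rule ext) simp
  moreover have "return Z = return \<pi>" by (rule ext, rule return_cong) simp
  ultimately show ?case by (simp add: bind_return')
next
  case (Suc n)
  have M: "kernel_pow Z P k \<in> \<pi> \<rightarrow>\<^sub>M subprob_algebra Z" for k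
    using kernel_pow_subprob[of k] by (simp cong: measurable_cong_sets)
  have "(\<lambda>y. kernel_pow Z P n y \<bind> P) = kernel_pow Z P (Suc n)" by (rule ext) simp
  then have "\<pi> \<bind> kernel_pow Z P (Suc n) = (\<pi> \<bind> kernel_pow Z P n) \<bind> P"
    using bind_assoc[OF M[of n] measurable_prob_algebraD[OF kernel]] by metis
  then show ?case by (simp only: Suc stationary)
qed

text \<open>The action of the \<open>k\<close>-step kernel on functions, $P^k f$.\<close>

definition Q :: "nat \<Rightarrow> ('z \<Rightarrow> real) \<Rightarrow> 'z \<Rightarrow> real" where
  "Q k f z = (LINT z'|kernel_pow Z P k z. f z')"

lemma Q_measurable[measurable]: "f \<in> borel_measurable Z \<Longrightarrow> Q k f \<in> borel_measurable Z"
  unfolding Q_def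
  using measurable_compose[OF kernel_pow_subprob integral_measurable_subprob_algebra] by blast

lemma Q_integral_bind:
  assumes f: "f \<in> borel_measurable Z" and B: "\<And>z. z \<in> space Z \<Longrightarrow> \<bar>f z\<bar> \<le> B"
    and \<mu>: "prob_space \<mu>" "sets \<mu> = sets Z"
  shows "(LINT z|(\<mu> \<bind> kernel_pow Z P k). f z) = (LINT z|\<mu>. Q k f z)"
  unfolding Q_def
proof (rule integral_bind[OF f B])
  have sp: "space \<mu> = space Z" using \<mu>(2) by (rule sets_eq_imp_space_eq)
  show "kernel_pow Z P k \<in> \<mu> \<rightarrow>\<^sub>M subprob_algebra Z"
    using kernel_pow_subprob[of k] \<mu>(2) by (simp cong: measurable_cong_sets)
  show "finite_measure \<mu>" using \<mu>(1) by (simp add: prob_space_def)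
  show "AE x in \<mu>. emeasure (kernel_pow Z P k x) (space (kernel_pow Z P k x)) \<le> ennreal 1"
    using prob_space.emeasure_space_1[OF prob_space_kernel_pow] by (auto intro!: AE_I2 simp: sp)
qed

lemma Q_add:
  assumes "f \<in> borel_measurable Z" "\<And>z. z \<in> space Z \<Longrightarrow> \<bar>f z\<bar> \<le> B" "z \<in> space Z"
  shows "Q (m + n) f z = Q m (Q n f) z"
  unfolding Q_def[of "m + n"] Q_def[of m] kernel_pow_add[OF assms(3)]
  using assms by (intro Q_integral_bind) (auto simp: prob_space_kernel_pow sets_kernel_pow)

lemma Q_abs_le:
  assumes "f \<in> borel_measurable Z" "\<And>z. z \<in> space Z \<Longrightarrow> \<bar>f z\<bar> \<le> B" "z \<in> space Z"
  shows "\<bar>Q k f z\<bar> \<le> B"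
proof -
  interpret K: prob_space "kernel_pow Z P k z" by (rule prob_space_kernel_pow) fact
  have int: "integrable (kernel_pow Z P k z) f"
    using assms by (intro K.integrable_const_bound[where B=B])
      (auto simp: space_kernel_pow sets_kernel_pow cong: measurable_cong_sets)
  have "\<bar>Q k f z\<bar> \<le> (LINT z'|kernel_pow Z P k z. \<bar>f z'\<bar>)"
    unfolding Q_def by (rule integral_abs_bound)
  also have "\<dots> \<le> B"
    using int assms by (intro K.integral_le_const AE_I2 integrable_abs) (auto simp: space_kernel_pow)
  finally show ?thesis .
qed

lemma Q_osc_le:
  assumes f: "f \<in> borel_measurable Z"
    and osc: "\<And>z z'. z \<in> space Z \<Longrightarrow> z' \<in> space Z \<Longrightarrow> f z - f z' \<le> c"
    and z: "z \<in> space Z" "z' \<in> space Z"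
  shows "Q k f z - Q k f z' \<le> c"
proof -
  have "\<bar>Q k f z - Q k f z'\<bar> \<le> c * tv_dist (kernel_pow Z P k z) (kernel_pow Z P k z')"
    unfolding Q_def using z f osc
    by (intro abs_integral_diff_le_osc)
      (auto simp: prob_space_kernel_pow sets_kernel_pow space_kernel_pow cong: measurable_cong_sets)
  also have "\<dots> \<le> c * 1"
    using osc[OF z(1) z(1)] z by (intro mult_left_mono tv_dist_le_1) (auto simp: prob_space_kernel_pow)
  finally show ?thesis by simp
qed

lemma tau_mix_ge_1: "1 \<le> \<tau>" and d_mix_tau_mix: "d_mix Z P \<pi> \<tau> \<le> 1 / 4"
  using LeastI_ex[of "\<lambda>k. 1 \<le> k \<and> d_mix Z P \<pi> k \<le> 1 / 4"] mixing_time_finite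
  by (auto simp: tau_mix_def)

lemma tv_dist_tau_mix:
  assumes "z \<in> space Z"
  shows "tv_dist (kernel_pow Z P \<tau> z) \<pi> \<le> 1 / 4"
proof -
  have "bdd_above ((\<lambda>z. tv_dist (kernel_pow Z P \<tau> z) \<pi>) ` space Z)"
    by (rule bdd_aboveI2[where M=1]) (auto intro!: tv_dist_le_1 prob_space_kernel_pow pi_prob_space)
  then have "tv_dist (kernel_pow Z P \<tau> z) \<pi> \<le> d_mix Z P \<pi> \<tau>"
    unfolding d_mix_def using assms by (rule cSUP_upper[rotated])
  then show ?thesis using d_mix_tau_mix by simp
qed

text \<open>After \<open>\<tau>\<close> steps any two starting points give laws within \<open>1 / 4\<close> of \<open>\<pi>\<close>, hence the factor
  \<open>1 / 2\<close>.\<close>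

lemma Q_tau_osc_le:
  assumes f: "f \<in> borel_measurable Z"
    and osc: "\<And>z z'. z \<in> space Z \<Longrightarrow> z' \<in> space Z \<Longrightarrow> f z - f z' \<le> c"
    and z: "z \<in> space Z" "z' \<in> space Z"
  shows "Q \<tau> f z - Q \<tau> f z' \<le> c / 2"
proof -
  have "\<bar>Q \<tau> f y - (LINT z|\<pi>. f z)\<bar> \<le> c / 4" if y: "y \<in> space Z" for y
  proof -
    have "\<bar>Q \<tau> f y - (LINT z|\<pi>. f z)\<bar> \<le> c * tv_dist (kernel_pow Z P \<tau> y) \<pi>"
      unfolding Q_def using y f osc
      by (intro abs_integral_diff_le_osc) (auto simp: prob_space_kernel_pow sets_kernel_pow
          space_kernel_pow pi_prob_space cong: measurable_cong_sets)
    also have "\<dots> \<le> c * (1 / 4)"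
      using osc[OF y y] y by (intro mult_left_mono tv_dist_tau_mix) auto
    finally show ?thesis by simp
  qed
  from this[OF z(1)] this[OF z(2)] show ?thesis by linarith
qed

lemma Q_osc_decay:
  assumes f: "f \<in> borel_measurable Z" and B: "\<And>z. z \<in> space Z \<Longrightarrow> \<bar>f z\<bar> \<le> B"
    and z: "z \<in> space Z" "z' \<in> space Z"
  shows "Q k f z - Q k f z' \<le> 2 * B * (1 / 2) ^ (k div \<tau>)"
  using z
proof (induction "k div \<tau>" arbitrary: k z z')
  case 0
  have "Q k f z - Q k f z' \<le> 2 * B"
  proof (rule Q_osc_le[OF f _ 0(2,3)])
    fix u v assume "u \<in> space Z" "v \<in> space Z"
    then show "f u - f v \<le> 2 * B" using B[of u] B[of v] by linarith
  qed
  with 0(1) show ?case by (metis mult.right_neutral power_0)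
next
  case (Suc n)
  have "\<tau> \<le> k"
    using Suc(2) tau_mix_ge_1 by (metis div_less linorder_not_le nat.distinct(1))
  then obtain k' where k: "k = \<tau> + k'" using le_Suc_ex by blast
  have n: "n = k' div \<tau>" using Suc(2) tau_mix_ge_1 by (simp add: k)
  have "Q \<tau> (Q k' f) z - Q \<tau> (Q k' f) z' \<le> 2 * B * (1 / 2) ^ (k' div \<tau>) / 2"
    by (rule Q_tau_osc_le) (use f Suc(1)[OF n] Suc(3,4) in auto)
  then show ?case
    using Suc(3,4) tau_mix_ge_1 by (simp add: k Q_add[OF f B])
qed

text \<open>Geometric mixing at the scale of the mixing time. Stationarity makes the mean of \<open>Q k f\<close> under
  \<open>\<pi>\<close> vanish, so that its values are bounded by its oscillation.\<close>

lemma Q_mixing: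
  assumes f: "f \<in> borel_measurable Z" and B: "\<And>z. z \<in> space Z \<Longrightarrow> \<bar>f z\<bar> \<le> B"
    and mean: "(LINT z|\<pi>. f z) = 0" and z: "z \<in> space Z"
  shows "\<bar>Q k f z\<bar> \<le> 2 * B * (1 / 2) ^ (k div \<tau>)"
proof -
  interpret \<pi>: prob_space \<pi> by (rule pi_prob_space)
  let ?c = "2 * B * (1 / 2) ^ (k div \<tau>)"
  have int: "integrable \<pi> (Q k f)"
    using f Q_abs_le[OF f B] by (intro \<pi>.integrable_const_bound[where B=B]) auto
  have mean_Q: "(LINT y|\<pi>. Q k f y) = 0"
    using Q_integral_bind[OF f B pi_prob_space, of k] mean by (simp add: pi_bind_kernel_pow)
  have "(LINT y|\<pi>. Q k f z - Q k f y) = Q k f z" "(LINT y|\<pi>. Q k f y - Q k f z) = - Q k f z"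
    using int \<pi>.prob_space by (simp_all add: mean_Q)
  moreover have "(LINT y|\<pi>. Q k f z - Q k f y) \<le> ?c" "(LINT y|\<pi>. Q k f y - Q k f z) \<le> ?c"
    using int Q_osc_decay[OF f B] z by (intro \<pi>.integral_le_const AE_I2; auto)+
  ultimately show ?thesis by linarith
qed

lemma sum_mixing_rates_le: "(\<Sum>m<n. (1 / 2 :: real) ^ (m div \<tau>)) \<le> 2 * real \<tau>"
proof -
  have \<tau>: "0 < \<tau>" using tau_mix_ge_1 by simp
  have "(\<Sum>m<n. (1 / 2 :: real) ^ (m div \<tau>)) \<le> (\<Sum>m<n * \<tau>. (1 / 2) ^ (m div \<tau>))"
    using \<tau> by (intro sum_mono2) auto
  also have "\<dots> = (\<Sum>i<n. \<Sum>m=i*\<tau>..<i*\<tau>+\<tau>. (1 / 2) ^ (m div \<tau>))"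
    by (rule sum.nat_group[symmetric])
  also have "\<dots> = (\<Sum>i<n. real \<tau> * (1 / 2) ^ i)"
  proof (rule sum.cong[OF refl])
    fix i
    have "m div \<tau> = i" if "m \<in> {i*\<tau>..<i*\<tau>+\<tau>}" for m
      using that by (intro div_nat_eqI) (auto simp: algebra_simps)
    then show "(\<Sum>m=i*\<tau>..<i*\<tau>+\<tau>. (1 / 2) ^ (m div \<tau>)) = real \<tau> * (1 / 2) ^ i" by simp
  qed
  also have "\<dots> = real \<tau> * (\<Sum>i<n. (1 / 2) ^ i)" by (simp add: sum_distrib_left)
  also have "(\<Sum>i<n. (1 / 2 :: real) ^ i) \<le> 2"
    by (subst geometric_sum) (auto simp: field_simps)
  finally show ?thesis by (simp add: mult_left_mono)
qed

end

section \<open>A burst of a Markov chain\<close>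

lemma ident_subalgebra:
  assumes "sets F \<subseteq> sets K" "space K = space F"
  shows "(\<lambda>\<omega>. \<omega>) \<in> K \<rightarrow>\<^sub>M F"
proof (rule measurableI)
  fix A assume A: "A \<in> sets F"
  have "A \<subseteq> space K" using sets.sets_into_space[OF A] by (simp add: assms(2))
  then have "(\<lambda>\<omega>. \<omega>) -` A \<inter> space K = A" by (simp add: Int_absorb2)
  with A assms(1) show "(\<lambda>\<omega>. \<omega>) -` A \<inter> space K \<in> sets K" by (simp add: subsetD)
qed (simp add: assms)

lemma integral_measurable_subprob_kernel:
  fixes f :: "'a \<Rightarrow> 'b \<Rightarrow> real"
  assumes f: "(\<lambda>(x, y). f x y) \<in> borel_measurable (M \<Otimes>\<^sub>M N)"
    and L: "L \<in> M \<rightarrow>\<^sub>M subprob_algebra N"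
  shows "(\<lambda>x. LINT y|L x. f x y) \<in> borel_measurable M"
proof -
  have K: "(\<lambda>x. distr (L x) (M \<Otimes>\<^sub>M N) (Pair x)) \<in> M \<rightarrow>\<^sub>M subprob_algebra (M \<Otimes>\<^sub>M N)"
  proof (rule measurable_distr2[OF _ L])
    show "case_prod Pair \<in> M \<Otimes>\<^sub>M N \<rightarrow>\<^sub>M M \<Otimes>\<^sub>M N"
      by (simp add: id_def)
  qed
  have "(\<lambda>x. LINT p|distr (L x) (M \<Otimes>\<^sub>M N) (Pair x). (case p of (x, y) \<Rightarrow> f x y)) \<in> borel_measurable M"
    using measurable_compose[OF K integral_measurable_subprob_algebra[OF f]] .
  then show ?thesis
  proof (rule measurable_cong[THEN iffD1, rotated])
    fix x assume x: "x \<in> space M"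
    have "Pair x \<in> L x \<rightarrow>\<^sub>M M \<Otimes>\<^sub>M N"
      using measurable_Pair1'[OF x, of N] sets_kernel[OF L x] by (simp cong: measurable_cong_sets)
    then show "(LINT p|distr (L x) (M \<Otimes>\<^sub>M N) (Pair x). (case p of (x, y) \<Rightarrow> f x y)) = (LINT y|L x. f x y)"
      using f by (subst integral_distr) auto
  qed
qed

text \<open>A burst of random length \<open>N\<close>: \<open>W 0\<close> is the state before the burst, \<open>W i\<close> its \<open>i\<close>-th state, and
  \<open>H i\<close> is what is known after \<open>i\<close> steps. The length is known from the start, and the Markov property
  holds as long as the burst lasts. The processes are indexed by all of \<open>nat\<close>; nothing is assumed
  about transitions after the end of the burst.\<close>

locale markov_burst = ergodic_chain Z P \<pi> + prob_space M
  for Z :: "'z measure" and P :: "'z \<Rightarrow> 'z measure" and \<pi> :: "'z measure" and M :: "'w measure" +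
  fixes H :: "nat \<Rightarrow> 'w measure" and W :: "nat \<Rightarrow> 'w \<Rightarrow> 'z" and N :: "'w \<Rightarrow> nat"
  assumes H_subalgebra: "\<And>i. subalgebra M (H i)"
    and H_Suc: "\<And>i. sets (H i) \<subseteq> sets (H (Suc i))"
    and W_H: "\<And>i. W i \<in> H i \<rightarrow>\<^sub>M Z"
    and N_H: "N \<in> H 0 \<rightarrow>\<^sub>M count_space UNIV"
    and step: "\<And>i B. B \<in> sets Z \<Longrightarrow> AE \<omega> in M. i < N \<omega> \<longrightarrow>
      real_cond_exp M (H i) (\<lambda>\<omega>. indicat_real B (W (Suc i) \<omega>)) \<omega> = measure (P (W i \<omega>)) B"
begin

lemma space_H[simp]: "space (H i) = space M"
  using H_subalgebra[of i] by (simp add: subalgebra_def)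

lemma H_mono: "i \<le> j \<Longrightarrow> sets (H i) \<subseteq> sets (H j)"
  by (rule lift_Suc_mono_le[of "\<lambda>i. sets (H i)", OF H_Suc])

lemma ident_H_H: "i \<le> j \<Longrightarrow> (\<lambda>\<omega>. \<omega>) \<in> H j \<rightarrow>\<^sub>M H i"
  by (intro ident_subalgebra H_mono) simp_all

lemma ident_M_H: "(\<lambda>\<omega>. \<omega>) \<in> M \<rightarrow>\<^sub>M H i"
  using H_subalgebra[of i] unfolding subalgebra_def by (intro ident_subalgebra) simp_all

lemma H_to_H:
  assumes "f \<in> H i \<rightarrow>\<^sub>M K" "i \<le> j"
  shows "f \<in> H j \<rightarrow>\<^sub>M K"
  by (rule measurable_compose[where f="\<lambda>\<omega>. \<omega>" and g=f, OF ident_H_H[OF assms(2)] assms(1)])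

lemma H_to_M:
  assumes "f \<in> H i \<rightarrow>\<^sub>M K"
  shows "f \<in> M \<rightarrow>\<^sub>M K"
  by (rule measurable_from_subalg[OF H_subalgebra assms])

lemma W_M[measurable]: "W i \<in> M \<rightarrow>\<^sub>M Z"
  by (rule H_to_M[OF W_H])

lemma W_space: "\<omega> \<in> space M \<Longrightarrow> W i \<omega> \<in> space Z"
  by (rule measurable_space[OF W_M])

lemma section_measurable:
  assumes "(\<lambda>p. f (fst p) (snd p)) \<in> borel_measurable (H i \<Otimes>\<^sub>M Z)" "\<omega> \<in> space M"
  shows "f \<omega> \<in> borel_measurable Z"
  using measurable_compose[OF measurable_Pair1' assms(1), of \<omega>] assms(2) by simp

lemma compose_state_measurable:
  assumes "(\<lambda>p. f (fst p) (snd p)) \<in> borel_measurable (H i \<Otimes>\<^sub>M Z)"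
    and "(\<lambda>\<omega>. \<omega>) \<in> K \<rightarrow>\<^sub>M H i" and "V \<in> K \<rightarrow>\<^sub>M Z"
  shows "(\<lambda>\<omega>. f \<omega> (V \<omega>)) \<in> borel_measurable K"
  using measurable_compose[OF measurable_Pair[OF assms(2,3)] assms(1)] by simp

lemma pair_H_mono:
  assumes "(\<lambda>p. f (fst p) (snd p)) \<in> borel_measurable (H i \<Otimes>\<^sub>M Z)" and "i \<le> j"
  shows "(\<lambda>p. f (fst p) (snd p)) \<in> borel_measurable (H j \<Otimes>\<^sub>M Z)"
proof -
  have "(\<lambda>p. (fst p, snd p)) \<in> H j \<Otimes>\<^sub>M Z \<rightarrow>\<^sub>M H i \<Otimes>\<^sub>M Z"
    by (rule measurable_Pair[OF measurable_compose[OF measurable_fst ident_H_H[OF assms(2)]] measurable_snd])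
  from measurable_compose[OF this assms(1)] show ?thesis by simp
qed

lemma Q_pair_measurable:
  assumes "(\<lambda>p. f (fst p) (snd p)) \<in> borel_measurable (H i \<Otimes>\<^sub>M Z)"
  shows "(\<lambda>p. Q k (f (fst p)) (snd p)) \<in> borel_measurable (H i \<Otimes>\<^sub>M Z)"
  unfolding Q_def
proof (rule integral_measurable_subprob_kernel)
  have "(\<lambda>q. (fst (fst q), snd q)) \<in> (H i \<Otimes>\<^sub>M Z) \<Otimes>\<^sub>M Z \<rightarrow>\<^sub>M H i \<Otimes>\<^sub>M Z" by measurable
  from measurable_compose[OF this assms]
  show "(\<lambda>(p, z). f (fst p) z) \<in> borel_measurable ((H i \<Otimes>\<^sub>M Z) \<Otimes>\<^sub>M Z)"
    by (simp add: case_prod_beta')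
  show "(\<lambda>p. kernel_pow Z P k (snd p)) \<in> H i \<Otimes>\<^sub>M Z \<rightarrow>\<^sub>M subprob_algebra Z"
    using measurable_compose[OF measurable_snd kernel_pow_subprob] .
qed

lemma burst_continues_H: "{\<omega> \<in> space M. i < N \<omega>} \<in> sets (H i)"
  using measurable_sets[OF H_to_H[OF N_H], of i "{i<..}"]
  by (simp add: vimage_def Int_def conj_commute)

text \<open>The probability measure restricted to the event that the burst has more than \<open>i\<close> states.\<close>

definition alive :: "nat \<Rightarrow> 'w measure" where
  "alive i = density M (indicator {\<omega> \<in> space M. i < N \<omega>})"

text \<open>The law of the pair of the past, here \<open>\<omega>\<close> itself seen through \<open>H i\<close>, and of the next state, given
  the current one.\<close>

definition next_law :: "nat \<Rightarrow> 'w \<Rightarrow> ('w \<times> 'z) measure" where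
  "next_law i \<omega> = distr (P (W i \<omega>)) (H i \<Otimes>\<^sub>M Z) (Pair \<omega>)"

lemma burst_continues[measurable]: "{\<omega> \<in> space M. i < N \<omega>} \<in> sets M"
  using burst_continues_H[of i] H_subalgebra[of i] by (auto simp: subalgebra_def)

lemma space_alive[simp]: "space (alive i) = space M"
  and sets_alive[simp, measurable_cong]: "sets (alive i) = sets M"
  by (simp_all add: alive_def)

lemma finite_measure_alive: "finite_measure (alive i)"
proof (rule finite_measureI)
  have "emeasure (alive i) (space (alive i)) \<le> (\<integral>\<^sup>+\<omega>. 1 \<partial>M)"
    unfolding space_alive alive_def
    by (subst emeasure_density) (auto intro!: emeasure_mono)
  then show "emeasure (alive i) (space (alive i)) \<noteq> \<infinity>"
    by (auto simp: emeasure_space_1 top_unique)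
qed

lemma integral_alive:
  assumes "u \<in> borel_measurable M" "\<And>\<omega>. N \<omega> \<le> i \<Longrightarrow> u \<omega> = (0::real)"
  shows "(LINT \<omega>|alive i. u \<omega>) = (LINT \<omega>|M. u \<omega>)"
proof -
  let ?A = "{\<omega> \<in> space M. i < N \<omega>}"
  have "alive i = density M (\<lambda>\<omega>. ennreal (indicat_real ?A \<omega>))"
    unfolding alive_def by (rule arg_cong[where f="density M"]) (auto simp: ennreal_indicator)
  then have "(LINT \<omega>|alive i. u \<omega>) = (LINT \<omega>|M. indicat_real ?A \<omega> *\<^sub>R u \<omega>)"
    using assms(1) by (simp only:) (intro integral_density; simp)
  also have "\<dots> = (LINT \<omega>|M. u \<omega>)"
    using assms(2) by (intro Bochner_Integration.integral_cong) (auto simp: indicator_def)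
  finally show ?thesis .
qed

lemma P_W_measurable: "(\<lambda>\<omega>. P (W i \<omega>)) \<in> M \<rightarrow>\<^sub>M prob_algebra Z"
  by (rule measurable_compose[OF W_M kernel])

lemma
  assumes "\<omega> \<in> space M"
  shows prob_space_P_W: "prob_space (P (W i \<omega>))"
    and sets_P_W: "sets (P (W i \<omega>)) = sets Z"
    and space_P_W: "space (P (W i \<omega>)) = space Z"
  using measurable_space[OF P_W_measurable assms]
  by (auto simp: space_prob_algebra dest: sets_eq_imp_space_eq)

lemma Pair_P_W_measurable:
  assumes "\<omega> \<in> space M"
  shows "Pair \<omega> \<in> P (W i \<omega>) \<rightarrow>\<^sub>M H i \<Otimes>\<^sub>M Z"
  using measurable_Pair1'[of \<omega> "H i" Z] assms sets_P_W[OF assms] by (simp cong: measurable_cong_sets)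

lemma next_law_measurable: "next_law i \<in> alive i \<rightarrow>\<^sub>M subprob_algebra (H i \<Otimes>\<^sub>M Z)"
proof -
  have "(\<lambda>\<omega>. distr (P (W i \<omega>)) (H i \<Otimes>\<^sub>M Z) (Pair \<omega>)) \<in> M \<rightarrow>\<^sub>M prob_algebra (H i \<Otimes>\<^sub>M Z)"
  proof (rule measurable_distr_prob_space2[OF P_W_measurable])
    have "(\<lambda>p. (fst p, snd p)) \<in> M \<Otimes>\<^sub>M Z \<rightarrow>\<^sub>M H i \<Otimes>\<^sub>M Z"
      by (rule measurable_Pair[OF measurable_compose[OF measurable_fst ident_M_H] measurable_snd])
    then show "(\<lambda>(\<omega>, z). (\<omega>, z)) \<in> M \<Otimes>\<^sub>M Z \<rightarrow>\<^sub>M H i \<Otimes>\<^sub>M Z"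
      by (simp add: case_prod_beta')
  qed
  from measurable_prob_algebraD[OF this] show ?thesis
    unfolding next_law_def by (simp cong: measurable_cong_sets)
qed

text \<open>The chain moves by \<open>P\<close> independently of the past: the joint law of the past and the next state,
  on the event that the burst has a next state, is the past law followed by the kernel. The
  conditional probabilities in the locale assumption give this on rectangles.\<close>

lemma joint_law_next_state:
  "distr (alive i) (H i \<Otimes>\<^sub>M Z) (\<lambda>\<omega>. (\<omega>, W (Suc i) \<omega>)) = alive i \<bind> next_law i" (is "?l = ?r")
proof -
  interpret Hi: finite_measure_subalgebra M "H i"
    by unfold_locales (rule H_subalgebra)
  have "(\<lambda>\<omega>. (\<omega>, W (Suc i) \<omega>)) \<in> M \<rightarrow>\<^sub>M H i \<Otimes>\<^sub>M Z"
    by (rule measurable_Pair[OF ident_M_H W_M])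
  then have pair_W: "(\<lambda>\<omega>. (\<omega>, W (Suc i) \<omega>)) \<in> alive i \<rightarrow>\<^sub>M H i \<Otimes>\<^sub>M Z"
    by (simp cong: measurable_cong_sets)
  interpret l: finite_measure ?l
    by (rule finite_measure.finite_measure_distr[OF finite_measure_alive pair_W])
  let ?E = "{A \<times> B | A B. A \<in> sets (H i) \<and> B \<in> sets Z}"
  show ?thesis
  proof (rule measure_eqI_generator_eq[of ?E "space (H i) \<times> space Z" _ _ "\<lambda>_. space (H i) \<times> space Z"])
    show "Int_stable ?E" by (rule Int_stable_pair_measure_generator)
    show "?E \<subseteq> Pow (space (H i) \<times> space Z)" by (rule pair_measure_closed)
    show "sets ?l = sigma_sets (space (H i) \<times> space Z) ?E"
      by (simp add: sets_pair_measure)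
    show "sets ?r = sigma_sets (space (H i) \<times> space Z) ?E"
      by (subst sets_bind[where N="H i \<Otimes>\<^sub>M Z"]) (simp_all add: next_law_def sets_pair_measure not_empty)
    show "range (\<lambda>_. space (H i) \<times> space Z) \<subseteq> ?E" by (auto simp del: space_H)
    show "(\<Union>_. space (H i) \<times> space Z) = space (H i) \<times> space Z" by simp
    show "emeasure ?l (space (H i) \<times> space Z) \<noteq> \<infinity>" by (simp add: l.emeasure_eq_measure)
  next
    fix R assume "R \<in> ?E"
    then obtain A B where R: "R = A \<times> B" and A: "A \<in> sets (H i)" and B: "B \<in> sets Z" by blast
    define A' where "A' = A \<inter> {\<omega> \<in> space M. i < N \<omega>}"
    have A': "A' \<in> sets (H i)" using A burst_continues_H by (simp add: A'_def)
    have A_M: "A \<in> sets M" "A' \<in> sets M" using A A' H_subalgebra[of i] by (auto simp: subalgebra_def)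
    let ?ind = "\<lambda>\<omega>. indicat_real B (W (Suc i) \<omega>)"
    have ind: "?ind \<in> borel_measurable M" using B by measurable
    have int: "integrable M ?ind"
      using ind by (intro integrable_const_bound[where B=1]) auto
    have measP: "(\<lambda>\<omega>. measure (P (W i \<omega>)) B) \<in> borel_measurable M"
      using measurable_compose[OF measurable_prob_algebraD[OF P_W_measurable] measurable_measure_subprob_algebra[OF B]] .
    have "emeasure ?l R = emeasure (alive i) (A \<inter> (W (Suc i) -` B \<inter> space M))"
      using pair_W A B sets.sets_into_space[OF A] by (subst emeasure_distr)
        (auto simp: R intro!: arg_cong[where f="emeasure (alive i)"])
    also have "\<dots> = (\<integral>\<^sup>+\<omega>. ennreal (indicat_real A' \<omega> * ?ind \<omega>) \<partial>M)"
      using A_M B by (subst alive_def, subst emeasure_density)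
        (auto intro!: nn_integral_cong simp: A'_def indicator_def)
    also have "\<dots> = ennreal (LINT \<omega>|M. indicat_real A' \<omega> * ?ind \<omega>)"
      using A_M ind by (intro nn_integral_eq_integral integrable_const_bound[where B=1])
        (auto simp: indicator_def)
    also have "(LINT \<omega>|M. indicat_real A' \<omega> * ?ind \<omega>)
        = (LINT \<omega>|M. indicat_real A' \<omega> * real_cond_exp M (H i) ?ind \<omega>)"
      using Hi.real_cond_exp_intA[OF int A'] by (simp add: set_lebesgue_integral_def)
    also have "\<dots> = (LINT \<omega>|M. indicat_real A' \<omega> * measure (P (W i \<omega>)) B)"
    proof (rule integral_cong_AE)
      show "AE \<omega> in M. indicat_real A' \<omega> * real_cond_exp M (H i) ?ind \<omega>
          = indicat_real A' \<omega> * measure (P (W i \<omega>)) B"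
        using step[OF B, of i] by eventually_elim (auto simp: A'_def indicator_def)
    qed (use A_M measP in auto)
    also have "ennreal \<dots> = (\<integral>\<^sup>+\<omega>. ennreal (indicat_real A' \<omega> * measure (P (W i \<omega>)) B) \<partial>M)"
      using A_M measP prob_space.prob_le_1[OF prob_space_P_W]
      by (intro nn_integral_eq_integral[symmetric] integrable_const_bound[where B=1] AE_I2)
        (auto simp: indicator_def)
    also have "\<dots> = (\<integral>\<^sup>+\<omega>. emeasure (next_law i \<omega>) R \<partial>alive i)"
    proof -
      have "emeasure (next_law i \<omega>) R = indicator A \<omega> * ennreal (measure (P (W i \<omega>)) B)"
        if \<omega>: "\<omega> \<in> space M" for \<omega>
      proof -
        interpret p: prob_space "P (W i \<omega>)" by (rule prob_space_P_W) fact
        have "emeasure (next_law i \<omega>) R = emeasure (P (W i \<omega>)) (Pair \<omega> -` R \<inter> space Z)"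
          using A B Pair_P_W_measurable[OF \<omega>] space_P_W[OF \<omega>]
          unfolding next_law_def by (subst emeasure_distr) (auto simp: R)
        also have "Pair \<omega> -` R \<inter> space Z = (if \<omega> \<in> A then B else {})"
          using sets.sets_into_space[OF B] by (auto simp: R)
        finally show ?thesis by (simp add: p.emeasure_eq_measure)
      qed
      moreover have "(\<lambda>\<omega>. emeasure (next_law i \<omega>) R) \<in> borel_measurable M"
        using measurable_emeasure_kernel[OF next_law_measurable, of R] A B
        by (simp add: R cong: measurable_cong_sets)
      ultimately show ?thesis
        by (subst alive_def, subst nn_integral_density)
          (auto intro!: nn_integral_cong simp: A'_def indicator_def)
    qed
    also have "\<dots> = emeasure ?r R"
      using next_law_measurable A B by (intro emeasure_bind[symmetric]) (auto simp: R not_empty)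
    finally show "emeasure ?l R = emeasure ?r R" .
  qed
qed

text \<open>The one-step Markov property for random integrands.\<close>

lemma integral_next_state:
  assumes f: "(\<lambda>p. f (fst p) (snd p)) \<in> borel_measurable (H i \<Otimes>\<^sub>M Z)"
    and B: "\<And>\<omega> z. \<omega> \<in> space M \<Longrightarrow> z \<in> space Z \<Longrightarrow> \<bar>f \<omega> z\<bar> \<le> (B::real)"
    and f0: "\<And>\<omega> z. N \<omega> \<le> i \<Longrightarrow> f \<omega> z = 0"
  shows "(LINT \<omega>|M. f \<omega> (W (Suc i) \<omega>)) = (LINT \<omega>|M. Q 1 (f \<omega>) (W i \<omega>))"
proof -
  have "(LINT \<omega>|M. f \<omega> (W (Suc i) \<omega>)) = (LINT \<omega>|alive i. f \<omega> (W (Suc i) \<omega>))"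
    using compose_state_measurable[OF f ident_M_H W_M] f0 by (intro integral_alive[symmetric])
  also have "\<dots> = (LINT p|distr (alive i) (H i \<Otimes>\<^sub>M Z) (\<lambda>\<omega>. (\<omega>, W (Suc i) \<omega>)). f (fst p) (snd p))"
    using f measurable_Pair[OF ident_M_H[of i] W_M[of "Suc i"]]
    by (subst integral_distr) (simp_all cong: measurable_cong_sets)
  also have "\<dots> = (LINT p|(alive i \<bind> next_law i). f (fst p) (snd p))"
    by (simp only: joint_law_next_state)
  also have "\<dots> = (LINT \<omega>|alive i. LINT p|next_law i \<omega>. f (fst p) (snd p))"
  proof (rule integral_bind[OF f _ next_law_measurable finite_measure_alive])
    show "\<bar>f (fst p) (snd p)\<bar> \<le> B" if "p \<in> space (H i \<Otimes>\<^sub>M Z)" for p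
      using that B[of "fst p" "snd p"] by (simp add: space_pair_measure mem_Times_iff)
    show "AE \<omega> in alive i. emeasure (next_law i \<omega>) (space (next_law i \<omega>)) \<le> ennreal 1"
      using prob_space.prob_space_distr[OF prob_space_P_W Pair_P_W_measurable,
          THEN prob_space.emeasure_space_1]
      by (intro AE_I2) (simp add: next_law_def)
  qed
  also have "\<dots> = (LINT \<omega>|alive i. Q 1 (f \<omega>) (W i \<omega>))"
  proof (rule Bochner_Integration.integral_cong[OF refl])
    fix \<omega> assume "\<omega> \<in> space (alive i)"
    then have \<omega>: "\<omega> \<in> space M" by simp
    have "(LINT p|next_law i \<omega>. f (fst p) (snd p)) = (LINT z|P (W i \<omega>). f \<omega> z)"
      unfolding next_law_def using f Pair_P_W_measurable[OF \<omega>] by (subst integral_distr) simp_all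
    also have "P (W i \<omega>) = kernel_pow Z P 1 (W i \<omega>)"
      using bind_return[OF measurable_prob_algebraD[OF kernel] W_space[OF \<omega>]] by simp
    finally show "(LINT p|next_law i \<omega>. f (fst p) (snd p)) = Q 1 (f \<omega>) (W i \<omega>)"
      by (simp only: Q_def)
  qed
  also have "\<dots> = (LINT \<omega>|M. Q 1 (f \<omega>) (W i \<omega>))"
  proof (rule integral_alive)
    show "(\<lambda>\<omega>. Q 1 (f \<omega>) (W i \<omega>)) \<in> borel_measurable M"
      by (rule compose_state_measurable[OF Q_pair_measurable[OF f] ident_M_H W_M])
    show "Q 1 (f \<omega>) (W i \<omega>) = 0" if "N \<omega> \<le> i" for \<omega>
      using f0[OF that] by (simp add: Q_def)
  qed
  finally show ?thesis .
qed

text \<open>The \<open>m\<close>-step Markov property, for integrands that may depend on the past and vanish unless the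
  burst reaches the later state.\<close>

lemma integral_later_state:
  assumes "(\<lambda>p. f (fst p) (snd p)) \<in> borel_measurable (H i \<Otimes>\<^sub>M Z)"
    and "\<And>\<omega> z. \<omega> \<in> space M \<Longrightarrow> z \<in> space Z \<Longrightarrow> \<bar>f \<omega> z\<bar> \<le> (B::real)"
    and "\<And>\<omega> z. N \<omega> < i + m \<Longrightarrow> f \<omega> z = 0"
  shows "(LINT \<omega>|M. f \<omega> (W (i + m) \<omega>)) = (LINT \<omega>|M. Q m (f \<omega>) (W i \<omega>))"
  using assms
proof (induction m arbitrary: f)
  case 0
  have "Q 0 (f \<omega>) (W i \<omega>) = f \<omega> (W i \<omega>)" if "\<omega> \<in> space M" for \<omega>
    using integral_return[OF W_space[OF that] section_measurable[OF 0(1) that], of i]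
    by (simp add: Q_def)
  then show ?case by (auto intro!: Bochner_Integration.integral_cong)
next
  case (Suc m)
  have "(LINT \<omega>|M. f \<omega> (W (i + Suc m) \<omega>)) = (LINT \<omega>|M. Q 1 (f \<omega>) (W (i + m) \<omega>))"
    using integral_next_state[OF pair_H_mono[OF Suc.prems(1), of "i + m"] Suc.prems(2)] Suc.prems(3)
    by simp
  also have "\<dots> = (LINT \<omega>|M. Q m (Q 1 (f \<omega>)) (W i \<omega>))"
  proof (rule Suc.IH)
    show "(\<lambda>p. Q 1 (f (fst p)) (snd p)) \<in> borel_measurable (H i \<Otimes>\<^sub>M Z)"
      by (rule Q_pair_measurable[OF Suc.prems(1)])
    show "\<bar>Q 1 (f \<omega>) z\<bar> \<le> B" if "\<omega> \<in> space M" "z \<in> space Z" for \<omega> z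
      using Suc.prems(2) that by (intro Q_abs_le section_measurable[OF Suc.prems(1)]) auto
    show "Q 1 (f \<omega>) z = 0" if "N \<omega> < i + m" for \<omega> z
      using Suc.prems(3) that by (simp add: Q_def)
  qed
  also have "\<dots> = (LINT \<omega>|M. Q (Suc m) (f \<omega>) (W i \<omega>))"
  proof (rule Bochner_Integration.integral_cong[OF refl])
    fix \<omega> assume \<omega>: "\<omega> \<in> space M"
    show "Q m (Q 1 (f \<omega>)) (W i \<omega>) = Q (Suc m) (f \<omega>) (W i \<omega>)"
      using Q_add[OF section_measurable[OF Suc.prems(1) \<omega>] Suc.prems(2)[OF \<omega>] W_space[OF \<omega>], of m 1 i]
      by simp
  qed
  finally show ?case .
qed

end

section \<open>Correlations along a burst\<close>

lemma (in ergodic_chain) sum_mixing_rates_abs_diff_le: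
  "(\<Sum>k=1..n. (1 / 2 :: real) ^ ((max i k - min i k) div \<tau>)) \<le> 4 * real \<tau>"
proof -
  let ?r = "\<lambda>d. (1 / 2 :: real) ^ (d div \<tau>)"
  have "(\<Sum>k=1..n. ?r (max i k - min i k)) \<le> (\<Sum>k\<in>{..i} \<union> {i..i + n}. ?r (max i k - min i k))"
    by (intro sum_mono2) auto
  also have "\<dots> \<le> (\<Sum>k\<in>{..i}. ?r (max i k - min i k)) + (\<Sum>k\<in>{i..i + n}. ?r (max i k - min i k))"
    by (subst sum.union_inter[symmetric]) (auto intro!: sum_nonneg)
  also have "(\<Sum>k\<in>{..i}. ?r (max i k - min i k)) = (\<Sum>d<Suc i. ?r d)"
    by (rule sum.reindex_bij_witness[where i="\<lambda>d. i - d" and j="\<lambda>k. i - k"]) (auto simp: max_def min_def)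
  also have "(\<Sum>k\<in>{i..i + n}. ?r (max i k - min i k)) = (\<Sum>d<Suc n. ?r d)"
    by (rule sum.reindex_bij_witness[where i="\<lambda>d. i + d" and j="\<lambda>k. k - i"]) (auto simp: max_def min_def)
  finally show ?thesis
    using sum_mixing_rates_le[of "Suc i"] sum_mixing_rates_le[of "Suc n"] by linarith
qed

context ergodic_chain
begin

text \<open>A random field \<open>\<psi> \<omega> z\<close> on the state space, known to the \<open>\<sigma>\<close>-algebra \<open>S\<close>, with mean zero under
  the stationary law for every \<open>\<omega>\<close>, and with the random bound \<open>C\<close>, itself bounded by the
  constant \<open>K\<close>.\<close>

definition centred_field ::
    "'w measure \<Rightarrow> ('w \<Rightarrow> 'z \<Rightarrow> 'b::euclidean_space) \<Rightarrow> ('w \<Rightarrow> real) \<Rightarrow> real \<Rightarrow> bool" where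
  "centred_field S \<psi> C K \<longleftrightarrow>
    (\<lambda>p. \<psi> (fst p) (snd p)) \<in> borel_measurable (S \<Otimes>\<^sub>M Z) \<and> C \<in> borel_measurable S \<and>
    (\<forall>\<omega>\<in>space S. C \<omega> \<le> K \<and> (\<forall>z\<in>space Z. norm (\<psi> \<omega> z) \<le> C \<omega>) \<and> (LINT z|\<pi>. \<psi> \<omega> z) = 0)"

end

context markov_burst
begin

lemma integrable_bounded:
  assumes "f \<in> borel_measurable M" "\<And>\<omega>. \<omega> \<in> space M \<Longrightarrow> norm (f \<omega>) \<le> B"
  shows "integrable M (f :: 'w \<Rightarrow> 'b::euclidean_space)"
  using assms by (intro integrable_const_bound[where B=B]) auto

context
  fixes \<psi> :: "'w \<Rightarrow> 'z \<Rightarrow> 'b::euclidean_space" and C :: "'w \<Rightarrow> real" and K :: real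
  assumes field: "centred_field (H 0) \<psi> C K"
begin

lemma
  shows pair_measurable: "(\<lambda>p. \<psi> (fst p) (snd p)) \<in> borel_measurable (H 0 \<Otimes>\<^sub>M Z)"
    and bound_measurable: "C \<in> borel_measurable (H 0)"
    and bound_le: "\<And>\<omega>. \<omega> \<in> space M \<Longrightarrow> C \<omega> \<le> K"
    and norm_le_bound: "\<And>\<omega> z. \<omega> \<in> space M \<Longrightarrow> z \<in> space Z \<Longrightarrow> norm (\<psi> \<omega> z) \<le> C \<omega>"
    and mean_zero: "\<And>\<omega>. \<omega> \<in> space M \<Longrightarrow> (LINT z|\<pi>. \<psi> \<omega> z) = 0"
  using field by (simp_all add: centred_field_def)

lemma bound_nonneg: "\<omega> \<in> space M \<Longrightarrow> 0 \<le> C \<omega>"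
  using norm_le_bound[OF _ W_space, of \<omega> \<omega> 0] norm_ge_zero order_trans by blast

lemma bound_sq_le: "\<omega> \<in> space M \<Longrightarrow> (C \<omega>)\<^sup>2 \<le> K\<^sup>2"
  using bound_nonneg bound_le by (intro power_mono)

lemma along_measurable: "i \<le> j \<Longrightarrow> (\<lambda>\<omega>. \<psi> \<omega> (W i \<omega>)) \<in> borel_measurable (H j)"
  by (rule compose_state_measurable[OF pair_measurable ident_H_H[OF le0] H_to_H[OF W_H]])

lemma along_le: "\<omega> \<in> space M \<Longrightarrow> norm (\<psi> \<omega> (W i \<omega>)) \<le> C \<omega>"
  by (rule norm_le_bound[OF _ W_space])

lemma inner_mixing:
  assumes \<omega>: "\<omega> \<in> space M" and z: "z \<in> space Z"
  shows "\<bar>Q m (\<lambda>z. a \<bullet> \<psi> \<omega> z) z\<bar> \<le> 2 * (norm a * C \<omega>) * (1 / 2) ^ (m div \<tau>)"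
proof (rule Q_mixing[OF _ _ _ z])
  interpret \<pi>: prob_space \<pi> by (rule pi_prob_space)
  have sec: "\<psi> \<omega> \<in> borel_measurable Z"
    by (rule section_measurable[OF pair_measurable \<omega>])
  then show "(\<lambda>z. a \<bullet> \<psi> \<omega> z) \<in> borel_measurable Z" by measurable
  show "\<bar>a \<bullet> \<psi> \<omega> z\<bar> \<le> norm a * C \<omega>" if "z \<in> space Z" for z
    using Cauchy_Schwarz_ineq2[of a "\<psi> \<omega> z"] mult_left_mono[OF norm_le_bound[OF \<omega> that] norm_ge_zero[of a]]
    by linarith
  have "integrable \<pi> (\<psi> \<omega>)"
    using sec norm_le_bound[OF \<omega>] by (intro \<pi>.integrable_const_bound[where B="C \<omega>"]) (auto cong: measurable_cong_sets)
  then show "(LINT z|\<pi>. a \<bullet> \<psi> \<omega> z) = 0"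
    by (simp add: mean_zero[OF \<omega>])
qed

text \<open>Correlations along the burst decay at the mixing rate, uniformly in the past.\<close>

lemma correlation_le:
  assumes u: "u \<in> borel_measurable (H 0)" and u01: "\<And>\<omega>. 0 \<le> u \<omega> \<and> u \<omega> \<le> 1"
    and u0: "\<And>\<omega>. N \<omega> < i + m \<Longrightarrow> u \<omega> = 0"
  shows "(LINT \<omega>|M. u \<omega> * (\<psi> \<omega> (W i \<omega>) \<bullet> \<psi> \<omega> (W (i + m) \<omega>)))
    \<le> (1 / 2) ^ (m div \<tau>) * (2 * (LINT \<omega>|M. u \<omega> * (C \<omega>)\<^sup>2))"
proof -
  define f where "f \<omega> z = (u \<omega> *\<^sub>R \<psi> \<omega> (W i \<omega>)) \<bullet> \<psi> \<omega> z" for \<omega> z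
  have uH: "u \<in> borel_measurable (H i)" by (rule H_to_H[OF u]) simp
  have u\<psi>: "(\<lambda>\<omega>. u \<omega> *\<^sub>R \<psi> \<omega> (W i \<omega>)) \<in> borel_measurable (H i)"
    using uH along_measurable[of i i] by measurable
  have f_meas: "(\<lambda>p. f (fst p) (snd p)) \<in> borel_measurable (H i \<Otimes>\<^sub>M Z)"
    unfolding f_def
    by (rule borel_measurable_inner[OF measurable_compose[OF measurable_fst u\<psi>] pair_H_mono[OF pair_measurable le0]])
  have norm_u\<psi>: "norm (u \<omega> *\<^sub>R \<psi> \<omega> (W i \<omega>)) \<le> u \<omega> * C \<omega>" if "\<omega> \<in> space M" for \<omega>
    using mult_left_mono[OF along_le[OF that, of i], of "u \<omega>"] u01[of \<omega>] by simp
  have norm_u\<psi>': "norm (u \<omega> *\<^sub>R \<psi> \<omega> (W i \<omega>)) \<le> K" if "\<omega> \<in> space M" for \<omega>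
    using norm_u\<psi>[OF that] mult_right_mono[of "u \<omega>" 1 "C \<omega>"] u01[of \<omega>] bound_nonneg[OF that] bound_le[OF that]
    by linarith
  have f_le: "\<bar>f \<omega> z\<bar> \<le> K * K" if "\<omega> \<in> space M" "z \<in> space Z" for \<omega> z
    unfolding f_def
    using Cauchy_Schwarz_ineq2[of "u \<omega> *\<^sub>R \<psi> \<omega> (W i \<omega>)" "\<psi> \<omega> z"]
      mult_mono[OF norm_u\<psi>'[OF that(1)] order_trans[OF norm_le_bound[OF that] bound_le[OF that(1)]] _ norm_ge_zero]
      order_trans[OF bound_nonneg[OF that(1)] bound_le[OF that(1)]]
    by linarith
  have f0: "f \<omega> z = 0" if "N \<omega> < i + m" for \<omega> z
    using u0[OF that] by (simp add: f_def)
  have Qf_meas: "(\<lambda>\<omega>. Q m (f \<omega>) (W i \<omega>)) \<in> borel_measurable M"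
    by (rule compose_state_measurable[OF Q_pair_measurable[OF f_meas] ident_M_H W_M])
  have "(LINT \<omega>|M. u \<omega> * (\<psi> \<omega> (W i \<omega>) \<bullet> \<psi> \<omega> (W (i + m) \<omega>))) = (LINT \<omega>|M. f \<omega> (W (i + m) \<omega>))"
    by (simp add: f_def)
  also have "\<dots> = (LINT \<omega>|M. Q m (f \<omega>) (W i \<omega>))"
    by (rule integral_later_state[OF f_meas f_le f0])
  also have "\<dots> \<le> (LINT \<omega>|M. (1 / 2) ^ (m div \<tau>) * (2 * (u \<omega> * (C \<omega>)\<^sup>2)))"
  proof (rule integral_mono)
    show "integrable M (\<lambda>\<omega>. Q m (f \<omega>) (W i \<omega>))"
    proof (rule integrable_bounded[OF Qf_meas])
      show "norm (Q m (f \<omega>) (W i \<omega>)) \<le> K * K" if "\<omega> \<in> space M" for \<omega>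
        using Q_abs_le[OF section_measurable[OF f_meas that] f_le[OF that] W_space[OF that]] by simp
    qed
    have "integrable M (\<lambda>\<omega>. u \<omega> * (C \<omega>)\<^sup>2)"
    proof (rule integrable_bounded)
      show "(\<lambda>\<omega>. u \<omega> * (C \<omega>)\<^sup>2) \<in> borel_measurable M"
        using H_to_M[OF u] H_to_M[OF bound_measurable] by measurable
      show "norm (u \<omega> * (C \<omega>)\<^sup>2) \<le> K\<^sup>2" if "\<omega> \<in> space M" for \<omega>
        using mult_mono[of "u \<omega>" 1 "(C \<omega>)\<^sup>2" "K\<^sup>2"] u01[of \<omega>] bound_sq_le[OF that] by simp
    qed
    then show "integrable M (\<lambda>\<omega>. (1 / 2) ^ (m div \<tau>) * (2 * (u \<omega> * (C \<omega>)\<^sup>2)))" by simp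
    fix \<omega> assume \<omega>: "\<omega> \<in> space M"
    have "Q m (f \<omega>) (W i \<omega>) \<le> 2 * (norm (u \<omega> *\<^sub>R \<psi> \<omega> (W i \<omega>)) * C \<omega>) * (1 / 2) ^ (m div \<tau>)"
      using inner_mixing[OF \<omega> W_space[OF \<omega>], of m "u \<omega> *\<^sub>R \<psi> \<omega> (W i \<omega>)" i]
      by (simp add: f_def[abs_def])
    also have "\<dots> \<le> 2 * ((u \<omega> * C \<omega>) * C \<omega>) * (1 / 2) ^ (m div \<tau>)"
      using norm_u\<psi>[OF \<omega>] bound_nonneg[OF \<omega>] by (intro mult_right_mono mult_left_mono) auto
    finally show "Q m (f \<omega>) (W i \<omega>) \<le> (1 / 2) ^ (m div \<tau>) * (2 * (u \<omega> * (C \<omega>)\<^sup>2))"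
      by (simp add: power2_eq_square mult_ac)
  qed
  also have "\<dots> = (1 / 2) ^ (m div \<tau>) * (2 * (LINT \<omega>|M. u \<omega> * (C \<omega>)\<^sup>2))" by simp
  finally show ?thesis .
qed

text \<open>By summability of the rates the \<open>n * n\<close> correlations add up to \<open>O (\<tau> * n)\<close> only.\<close>

lemma second_moment_sum_le:
  assumes u: "u \<in> borel_measurable (H 0)" and u01: "\<And>\<omega>. 0 \<le> u \<omega> \<and> u \<omega> \<le> 1"
    and u0: "\<And>\<omega>. N \<omega> < n \<Longrightarrow> u \<omega> = 0"
  shows "(LINT \<omega>|M. u \<omega> * (norm (\<Sum>i=1..n. \<psi> \<omega> (W i \<omega>)))\<^sup>2)
    \<le> 8 * real \<tau> * real n * (LINT \<omega>|M. u \<omega> * (C \<omega>)\<^sup>2)"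
proof -
  let ?c = "\<lambda>i k \<omega>. u \<omega> * (\<psi> \<omega> (W i \<omega>) \<bullet> \<psi> \<omega> (W k \<omega>))"
  let ?E = "LINT \<omega>|M. u \<omega> * (C \<omega>)\<^sup>2"
  have E: "0 \<le> ?E" using u01 by (intro Bochner_Integration.integral_nonneg) auto
  have int: "integrable M (?c i k)" for i k
  proof (rule integrable_bounded)
    show "?c i k \<in> borel_measurable M"
      using H_to_M[OF u] H_to_M[OF along_measurable[OF order_refl]] by measurable
    show "norm (?c i k \<omega>) \<le> K * K" if "\<omega> \<in> space M" for \<omega>
    proof -
      have "\<bar>\<psi> \<omega> (W i \<omega>) \<bullet> \<psi> \<omega> (W k \<omega>)\<bar> \<le> norm (\<psi> \<omega> (W i \<omega>)) * norm (\<psi> \<omega> (W k \<omega>))"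
        by (rule Cauchy_Schwarz_ineq2)
      also have "\<dots> \<le> K * K"
        using along_le[OF that] bound_le[OF that] bound_nonneg[OF that] by (intro mult_mono) (auto intro: order_trans)
      finally show ?thesis
        using mult_mono[of "u \<omega>" 1 "\<bar>\<psi> \<omega> (W i \<omega>) \<bullet> \<psi> \<omega> (W k \<omega>)\<bar>" "K * K"] u01[of \<omega>]
        by (simp add: abs_mult)
    qed
  qed
  have corr: "(LINT \<omega>|M. ?c i k \<omega>) \<le> (1 / 2) ^ ((max i k - min i k) div \<tau>) * (2 * ?E)"
    if "i \<le> n" "k \<le> n" for i k
  proof (cases "i \<le> k")
    case True
    then show ?thesis
      using correlation_le[OF u u01, of i "k - i"] u0 that by simp
  next
    case False
    then show ?thesis
      using correlation_le[OF u u01, of k "i - k"] u0 that by (simp add: inner_commute max_def min_def)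
  qed
  have "u \<omega> * (norm (\<Sum>i=1..n. \<psi> \<omega> (W i \<omega>)))\<^sup>2 = (\<Sum>i=1..n. \<Sum>k=1..n. ?c i k \<omega>)" for \<omega>
    by (simp add: power2_norm_eq_inner inner_sum_left inner_sum_right sum_distrib_left) (rule sum.swap)
  then have "(LINT \<omega>|M. u \<omega> * (norm (\<Sum>i=1..n. \<psi> \<omega> (W i \<omega>)))\<^sup>2)
      = (\<Sum>i=1..n. \<Sum>k=1..n. LINT \<omega>|M. ?c i k \<omega>)"
    by (simp only:) (subst Bochner_Integration.integral_sum, simp add: int, simp add: int)
  also have "\<dots> \<le> (\<Sum>i=1..n. \<Sum>k=1..n. (1 / 2) ^ ((max i k - min i k) div \<tau>) * (2 * ?E))"
    using corr by (intro sum_mono) auto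
  also have "\<dots> = (\<Sum>i=1..n. (\<Sum>k=1..n. (1 / 2) ^ ((max i k - min i k) div \<tau>)) * (2 * ?E))"
    by (simp only: sum_distrib_right)
  also have "\<dots> \<le> (\<Sum>i=1..n. 4 * real \<tau> * (2 * ?E))"
    using E sum_mixing_rates_abs_diff_le by (intro sum_mono mult_right_mono) auto
  also have "\<dots> = 8 * real \<tau> * real n * ?E" by simp
  finally show ?thesis .
qed

end

end

section \<open>The multilevel estimator on one burst\<close>

text \<open>A burst whose length is drawn through the level \<open>J\<close>. The \<open>\<sigma>\<close>-algebra \<open>F\<close> is the history before
  the burst: it knows the current state \<open>W 0\<close> but not \<open>J\<close>, which is independent of it.\<close>

locale mlmc_burst = markov_burst Z P \<pi> M H W "\<lambda>\<omega>. burst_len T (J \<omega>)"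
  for Z :: "'z measure" and P :: "'z \<Rightarrow> 'z measure" and \<pi> :: "'z measure" and M :: "'w measure"
    and H :: "nat \<Rightarrow> 'w measure" and W :: "nat \<Rightarrow> 'w \<Rightarrow> 'z" and T :: nat and J :: "'w \<Rightarrow> nat" +
  fixes F :: "'w measure"
  assumes F_space: "space F = space M" and F_H: "sets F \<subseteq> sets (H 0)"
    and W_F: "W 0 \<in> F \<rightarrow>\<^sub>M Z"
    and J_H: "J \<in> H 0 \<rightarrow>\<^sub>M count_space UNIV"
    and J_law: "\<And>j. 1 \<le> j \<Longrightarrow> prob {\<omega> \<in> space M. J \<omega> = j} = (1 / 2) ^ j"
    and J_indep: "\<And>A j. A \<in> sets F \<Longrightarrow>
      prob (A \<inter> {\<omega> \<in> space M. J \<omega> = j}) = prob A * prob {\<omega> \<in> space M. J \<omega> = j}"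
begin

lemma F_subalgebra: "subalgebra M F"
  using F_H H_subalgebra[of 0] by (auto simp: subalgebra_def F_space)

lemma ident_H_F: "(\<lambda>\<omega>. \<omega>) \<in> H i \<rightarrow>\<^sub>M F"
  using F_H H_mono[of 0 i] by (intro ident_subalgebra) (auto simp: F_space)

lemma F_to_H: "f \<in> F \<rightarrow>\<^sub>M K \<Longrightarrow> f \<in> H i \<rightarrow>\<^sub>M K"
  by (rule measurable_compose[where f="\<lambda>\<omega>. \<omega>" and g=f, OF ident_H_F])

lemma F_to_M: "f \<in> F \<rightarrow>\<^sub>M K \<Longrightarrow> f \<in> M \<rightarrow>\<^sub>M K"
  by (rule measurable_from_subalg[OF F_subalgebra])

lemma pair_F_to_H:
  assumes "(\<lambda>p. f (fst p) (snd p)) \<in> borel_measurable (F \<Otimes>\<^sub>M Z)"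
  shows "(\<lambda>p. f (fst p) (snd p)) \<in> borel_measurable (H i \<Otimes>\<^sub>M Z)"
proof -
  have "(\<lambda>p. (fst p, snd p)) \<in> H i \<Otimes>\<^sub>M Z \<rightarrow>\<^sub>M F \<Otimes>\<^sub>M Z"
    by (rule measurable_Pair[OF measurable_compose[OF measurable_fst ident_H_F] measurable_snd])
  from measurable_compose[OF this assms] show ?thesis by simp
qed

abbreviation level :: "nat \<Rightarrow> 'w \<Rightarrow> real" where
  "level j \<equiv> indicator {\<omega> \<in> space M. J \<omega> = j}"

lemma level_event_H: "{\<omega> \<in> space M. J \<omega> = j} \<in> sets (H i)"
  using measurable_sets[OF H_to_H[OF J_H le0], of "{j}" i]
  by (simp add: vimage_def Int_def conj_commute)

lemma level_event: "{\<omega> \<in> space M. J \<omega> = j} \<in> sets M"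
  using level_event_H[of j 0] H_subalgebra[of 0] by (auto simp: subalgebra_def)

lemma level_H: "level j \<in> borel_measurable (H i)"
  using level_event_H by simp

lemma level_M[measurable]: "level j \<in> borel_measurable M"
  by (rule H_to_M[OF level_H])

lemma integral_level:
  assumes u: "u \<in> borel_measurable F" and B: "\<And>\<omega>. \<omega> \<in> space M \<Longrightarrow> \<bar>u \<omega>\<bar> \<le> (B::real)" and j: "1 \<le> j"
  shows "(LINT \<omega>|M. u \<omega> * level j \<omega>) = (1 / 2) ^ j * (LINT \<omega>|M. u \<omega>)"
proof -
  interpret F: finite_measure_subalgebra M F
    by unfold_locales (rule F_subalgebra)
  have int_level: "integrable M (level j)"
    by (rule integrable_bounded[where B=1]) auto
  have ce: "AE \<omega> in M. real_cond_exp M F (level j) \<omega> = (1 / 2) ^ j"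
  proof (rule F.real_cond_exp_charact)
    fix A assume A: "A \<in> sets F"
    then have A_M: "A \<in> sets M" using F_subalgebra by (auto simp: subalgebra_def)
    have "(LINT \<omega>:A|M. level j \<omega>) = (LINT \<omega>|M. indicator (A \<inter> {\<omega> \<in> space M. J \<omega> = j}) \<omega>)"
      unfolding set_lebesgue_integral_def by (simp add: indicator_inter_arith)
    also have "\<dots> = prob A * (1 / 2) ^ j"
      using A_M level_event by (simp add: J_indep[OF A] J_law[OF j])
    also have "\<dots> = (LINT \<omega>:A|M. (1 / 2) ^ j)"
      using A_M by (simp add: set_lebesgue_integral_def)
    finally show "(LINT \<omega>:A|M. level j \<omega>) = (LINT \<omega>:A|M. (1 / 2) ^ j)" .
  qed (use int_level in auto)
  have u_M: "u \<in> borel_measurable M" by (rule F_to_M[OF u])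
  have int_u: "integrable M (\<lambda>\<omega>. u \<omega> * level j \<omega>)"
  proof (rule integrable_bounded[where B=B])
    show "(\<lambda>\<omega>. u \<omega> * level j \<omega>) \<in> borel_measurable M" using u_M by measurable
    show "norm (u \<omega> * level j \<omega>) \<le> B" if "\<omega> \<in> space M" for \<omega>
      using B[OF that] by (auto simp: indicator_def)
  qed
  have "(LINT \<omega>|M. u \<omega> * level j \<omega>) = (LINT \<omega>|M. u \<omega> * real_cond_exp M F (level j) \<omega>)"
    using F.real_cond_exp_intg(2)[OF int_u u] by simp
  also have "\<dots> = (LINT \<omega>|M. u \<omega> * (1 / 2) ^ j)"
    using ce u_M by (intro integral_cong_AE) auto
  finally show ?thesis by (simp add: mult.commute)
qed

context
  fixes \<psi> :: "'w \<Rightarrow> 'z \<Rightarrow> 'b::euclidean_space" and C :: "'w \<Rightarrow> real" and K :: real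
  assumes field_F: "centred_field F \<psi> C K"
begin

lemma field_pair_F: "(\<lambda>p. \<psi> (fst p) (snd p)) \<in> borel_measurable (F \<Otimes>\<^sub>M Z)" and field_bound_F: "C \<in> borel_measurable F"
  using field_F by (simp_all add: centred_field_def)

lemma field_H: "centred_field (H 0) \<psi> C K"
  using field_F pair_F_to_H[OF field_pair_F] F_to_H[OF field_bound_F] by (simp add: centred_field_def F_space)

lemmas field_bound_le = bound_le[OF field_H]
  and field_bound_nonneg = bound_nonneg[OF field_H]
  and field_bound_sq_le = bound_sq_le[OF field_H]
  and field_norm_le = norm_le_bound[OF field_H]
  and field_along_le = along_le[OF field_H]
  and field_along_measurable = along_measurable[OF field_H]
  and field_inner_mixing = inner_mixing[OF field_H]
  and field_second_moment = second_moment_sum_le[OF field_H]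

text \<open>The mean over the first \<open>2 ^ j\<close> states of the burst, and the multilevel estimate, of the field.\<close>

abbreviation level_mean :: "nat \<Rightarrow> 'w \<Rightarrow> 'b" where
  "level_mean j \<omega> \<equiv> emp_mean (\<lambda>i. W i \<omega>) j (\<psi> \<omega>)"

abbreviation estimate :: "'w \<Rightarrow> 'b" where
  "estimate \<omega> \<equiv> mlmc T (J \<omega>) (\<lambda>i. W i \<omega>) (\<psi> \<omega>)"

lemma field_along_M[measurable]: "(\<lambda>\<omega>. \<psi> \<omega> (W i \<omega>)) \<in> borel_measurable M"
  by (rule H_to_M[OF field_along_measurable[OF order_refl]])

lemma field_bound_M[measurable]: "C \<in> borel_measurable M"
  by (rule F_to_M[OF field_bound_F])

lemma level_mean_M[measurable]: "level_mean j \<in> borel_measurable M"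
  unfolding emp_mean_def by measurable

lemma level_mean_le: "\<omega> \<in> space M \<Longrightarrow> norm (level_mean j \<omega>) \<le> C \<omega>"
proof -
  assume \<omega>: "\<omega> \<in> space M"
  have "norm (\<Sum>i=1..2^j. \<psi> \<omega> (W i \<omega>)) \<le> (\<Sum>i=1..(2::nat)^j. C \<omega>)"
    by (rule sum_norm_le) (rule field_along_le[OF \<omega>])
  then show ?thesis by (simp add: emp_mean_def field_simps)
qed

lemma level_mean_0: "level_mean 0 \<omega> = \<psi> \<omega> (W 1 \<omega>)"
  by (simp add: emp_mean_def)

text \<open>At level \<open>0\<close>, which has probability zero, the correction vanishes since \<open>0 - 1 = 0\<close> on the
  natural numbers; hence only \<open>1, \<dots>, j_max T\<close> matter.\<close>

lemma estimate_eq: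
  assumes "\<omega> \<in> space M"
  shows "estimate \<omega> = level_mean 0 \<omega>
    + (\<Sum>j=1..j_max T. level j \<omega> *\<^sub>R (2 ^ j *\<^sub>R (level_mean j \<omega> - level_mean (j - 1) \<omega>)))"
proof -
  let ?d = "\<lambda>j. 2 ^ j *\<^sub>R (level_mean j \<omega> - level_mean (j - 1) \<omega>)"
  have "(\<Sum>j=1..j_max T. level j \<omega> *\<^sub>R ?d j) = (\<Sum>j=1..j_max T. if j = J \<omega> then ?d j else 0)"
    using assms by (intro sum.cong) (auto simp: indicator_def)
  also have "\<dots> = (if J \<omega> \<in> {1..j_max T} then ?d (J \<omega>) else 0)" by (simp add: sum.delta)
  also have "\<dots> = (if J \<omega> \<le> j_max T then ?d (J \<omega>) else 0)" by (cases "J \<omega>") auto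
  finally show ?thesis by (simp only: mlmc_def)
qed

lemma estimate_measurable: "estimate \<in> borel_measurable M"
  by (subst measurable_cong[OF estimate_eq]) measurable

lemma estimate_bounded:
  assumes "\<omega> \<in> space M"
  shows "norm (estimate \<omega>) \<le> K + (\<Sum>j=1..j_max T. 2 ^ j * (2 * K))"
proof -
  have mean_K: "norm (level_mean j \<omega>) \<le> K" for j
    using level_mean_le[OF assms] field_bound_le[OF assms] by (rule order_trans)
  then have K: "0 \<le> K" using norm_ge_zero order_trans by blast
  have "norm (level j \<omega> *\<^sub>R (2 ^ j *\<^sub>R (level_mean j \<omega> - level_mean (j - 1) \<omega>))) \<le> 2 ^ j * (2 * K)" for j
    using norm_triangle_ineq4[of "level_mean j \<omega>" "level_mean (j - 1) \<omega>"] mean_K[of j] mean_K[of "j - 1"] K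
    by (auto simp: indicator_def)
  then show ?thesis
    unfolding estimate_eq[OF assms]
    by (intro norm_triangle_le add_mono mean_K order_trans[OF norm_sum] sum_mono)
qed

lemma estimate_sq_le:
  assumes "\<omega> \<in> space M"
  shows "(norm (estimate \<omega>))\<^sup>2 \<le> 2 * (norm (level_mean 0 \<omega>))\<^sup>2
    + (\<Sum>j=1..j_max T. 4 * 4 ^ j * (level j \<omega> * (norm (level_mean j \<omega>))\<^sup>2
        + level j \<omega> * (norm (level_mean (j - 1) \<omega>))\<^sup>2))"
proof -
  have sq_add: "(norm (a + b))\<^sup>2 \<le> 2 * (norm a)\<^sup>2 + 2 * (norm b)\<^sup>2" for a b :: 'b
  proof -
    have "(norm (a + b))\<^sup>2 \<le> (norm a + norm b)\<^sup>2" by (intro power_mono norm_triangle_ineq) simp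
    also have "\<dots> \<le> 2 * (norm a)\<^sup>2 + 2 * (norm b)\<^sup>2"
      using sum_squares_bound[of "norm a" "norm b"] by (simp add: power2_sum)
    finally show ?thesis .
  qed
  let ?d = "\<lambda>j. 2 ^ j *\<^sub>R (level_mean j \<omega> - level_mean (j - 1) \<omega>)"
  let ?t = "\<lambda>j. 4 * 4 ^ j * (level j \<omega> * (norm (level_mean j \<omega>))\<^sup>2
        + level j \<omega> * (norm (level_mean (j - 1) \<omega>))\<^sup>2)"
  show ?thesis
  proof (cases "J \<omega> \<in> {1..j_max T}")
    case True
    let ?j = "J \<omega>"
    have "(\<Sum>j=1..j_max T. level j \<omega> *\<^sub>R ?d j) = (\<Sum>j=1..j_max T. if j = ?j then ?d j else 0)"
      using assms by (intro sum.cong) (auto simp: indicator_def)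
    also have "\<dots> = ?d ?j" using True by (simp add: sum.delta)
    finally have est: "estimate \<omega> = level_mean 0 \<omega> + ?d ?j" by (simp only: estimate_eq[OF assms])
    have "(norm (?d ?j))\<^sup>2 = 4 ^ ?j * (norm (level_mean ?j \<omega> + - level_mean (?j - 1) \<omega>))\<^sup>2"
      by (simp add: power_mult_distrib power2_eq_square flip: power_mult_distrib[of "2::real" 2])
    also have "\<dots> \<le> 4 ^ ?j * (2 * (norm (level_mean ?j \<omega>))\<^sup>2 + 2 * (norm (level_mean (?j - 1) \<omega>))\<^sup>2)"
      using sq_add[of "level_mean ?j \<omega>" "- level_mean (?j - 1) \<omega>"]
      by (intro mult_left_mono) auto
    also have "\<dots> = ?t ?j / 2" using assms by (simp add: indicator_def)
    finally have d: "2 * (norm (?d ?j))\<^sup>2 \<le> ?t ?j" by simp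
    have "?t ?j \<le> (\<Sum>j=1..j_max T. ?t j)"
      by (rule member_le_sum) (use True in auto)
    then show ?thesis
      using sq_add[of "level_mean 0 \<omega>" "?d ?j"] d unfolding est by linarith
  next
    case False
    then have "(\<Sum>j=1..j_max T. level j \<omega> *\<^sub>R ?d j) = 0"
      by (intro sum.neutral) (auto simp: indicator_def)
    then have "estimate \<omega> = level_mean 0 \<omega>" by (simp only: estimate_eq[OF assms] add_0_right)
    moreover have "0 \<le> (\<Sum>j=1..j_max T. ?t j)" by (intro sum_nonneg) auto
    ultimately show ?thesis using zero_le_power2[of "norm (level_mean 0 \<omega>)"] by simp
  qed
qed

lemma level_mean_second_moment:
  assumes u: "u \<in> borel_measurable F" and u01: "\<And>\<omega>. 0 \<le> u \<omega> \<and> u \<omega> \<le> 1"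
    and j: "1 \<le> j" "j \<le> j_max T" and k: "k \<le> j"
  shows "(LINT \<omega>|M. u \<omega> * (level j \<omega> * (norm (level_mean k \<omega>))\<^sup>2))
    \<le> 8 * real \<tau> / (2 ^ k * 2 ^ j) * (LINT \<omega>|M. u \<omega> * (C \<omega>)\<^sup>2)"
proof -
  have uC: "\<bar>u \<omega> * (C \<omega>)\<^sup>2\<bar> \<le> K\<^sup>2" if "\<omega> \<in> space M" for \<omega>
    using mult_mono[of "u \<omega>" 1 "(C \<omega>)\<^sup>2" "K\<^sup>2"] u01[of \<omega>] field_bound_sq_le[OF that] by simp
  have norm_mean: "(norm (level_mean k \<omega>))\<^sup>2 = (norm (\<Sum>i=1..2^k. \<psi> \<omega> (W i \<omega>)))\<^sup>2 / 4 ^ k" for \<omega>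
    by (simp add: emp_mean_def power_divide flip: power_mult_distrib) (simp add: power2_eq_square flip: power_mult_distrib)
  have "(LINT \<omega>|M. u \<omega> * (level j \<omega> * (norm (level_mean k \<omega>))\<^sup>2))
      = (LINT \<omega>|M. (u \<omega> * level j \<omega>) * (norm (\<Sum>i=1..2^k. \<psi> \<omega> (W i \<omega>)))\<^sup>2 / 4 ^ k)"
    by (simp add: norm_mean mult.assoc)
  also have "\<dots> = (LINT \<omega>|M. (u \<omega> * level j \<omega>) * (norm (\<Sum>i=1..2^k. \<psi> \<omega> (W i \<omega>)))\<^sup>2) / 4 ^ k"
    by simp
  also have "(LINT \<omega>|M. (u \<omega> * level j \<omega>) * (norm (\<Sum>i=1..2^k. \<psi> \<omega> (W i \<omega>)))\<^sup>2)
      \<le> 8 * real \<tau> * real (2 ^ k) * (LINT \<omega>|M. (u \<omega> * level j \<omega>) * (C \<omega>)\<^sup>2)"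
  proof (rule field_second_moment)
    show "(\<lambda>\<omega>. u \<omega> * level j \<omega>) \<in> borel_measurable (H 0)"
      using F_to_H[OF u] level_H by measurable
    show "0 \<le> u \<omega> * level j \<omega> \<and> u \<omega> * level j \<omega> \<le> 1" for \<omega>
      using u01[of \<omega>] by (simp add: indicator_def)
    show "u \<omega> * level j \<omega> = 0" if "burst_len T (J \<omega>) < 2 ^ k" for \<omega>
    proof -
      have "J \<omega> \<noteq> j"
        using that j k power_increasing[OF k, of "2::nat"] by (auto simp: burst_len_def)
      then show ?thesis by (simp add: indicator_def)
    qed
  qed
  also have "(LINT \<omega>|M. (u \<omega> * level j \<omega>) * (C \<omega>)\<^sup>2) = (LINT \<omega>|M. (u \<omega> * (C \<omega>)\<^sup>2) * level j \<omega>)"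
    by (simp add: mult_ac)
  also have "\<dots> = (1 / 2) ^ j * (LINT \<omega>|M. u \<omega> * (C \<omega>)\<^sup>2)"
    using u field_bound_F uC j(1) by (intro integral_level) auto
  finally have "(LINT \<omega>|M. u \<omega> * (level j \<omega> * (norm (level_mean k \<omega>))\<^sup>2))
      \<le> 8 * real \<tau> * real (2 ^ k) * ((1 / 2) ^ j * (LINT \<omega>|M. u \<omega> * (C \<omega>)\<^sup>2)) / 4 ^ k"
    by (simp add: divide_right_mono)
  moreover have "(4::real) ^ k = 2 ^ k * 2 ^ k" by (simp flip: power_mult_distrib)
  ultimately show ?thesis by (simp add: power_one_over mult_ac)
qed

text \<open>Level \<open>j\<close> has probability \<open>2 ^ - j\<close>, its correction is scaled by \<open>2 ^ j\<close> and
  the empirical means have second moment of order \<open>\<tau> / 2 ^ j\<close>: the bound is the same for every level.\<close>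

lemma estimate_second_moment:
  assumes u: "u \<in> borel_measurable F" and u01: "\<And>\<omega>. 0 \<le> u \<omega> \<and> u \<omega> \<le> 1"
  shows "(LINT \<omega>|M. u \<omega> * (norm (estimate \<omega>))\<^sup>2)
    \<le> (2 + 96 * real \<tau> * real (j_max T)) * (LINT \<omega>|M. u \<omega> * (C \<omega>)\<^sup>2)"
proof -
  let ?E = "LINT \<omega>|M. u \<omega> * (C \<omega>)\<^sup>2"
  have u_M[measurable]: "u \<in> borel_measurable M" by (rule F_to_M[OF u])
  let ?m = "\<lambda>j k \<omega>. u \<omega> * (level j \<omega> * (norm (level_mean k \<omega>))\<^sup>2)"
  have mean_sq: "(norm (level_mean k \<omega>))\<^sup>2 \<le> (C \<omega>)\<^sup>2" if "\<omega> \<in> space M" for k \<omega>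
    using level_mean_le[OF that] by (intro power_mono) auto
  have int0: "integrable M (\<lambda>\<omega>. u \<omega> * (norm (level_mean 0 \<omega>))\<^sup>2)"
  proof (rule integrable_bounded)
    show "norm (u \<omega> * (norm (level_mean 0 \<omega>))\<^sup>2) \<le> K\<^sup>2" if "\<omega> \<in> space M" for \<omega>
      using mult_mono[of "u \<omega>" 1 "(norm (level_mean 0 \<omega>))\<^sup>2" "K\<^sup>2"] u01[of \<omega>]
        mean_sq[OF that, of 0] field_bound_sq_le[OF that] by simp
  qed measurable
  have intm: "integrable M (?m j k)" for j k
  proof (rule integrable_bounded)
    show "norm (?m j k \<omega>) \<le> K\<^sup>2" if "\<omega> \<in> space M" for \<omega>
      using mult_mono[of "u \<omega>" 1 "level j \<omega> * (norm (level_mean k \<omega>))\<^sup>2" "K\<^sup>2"] u01[of \<omega>]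
        mean_sq[OF that, of k] field_bound_sq_le[OF that] by (auto simp: indicator_def)
  qed measurable
  have intC: "integrable M (\<lambda>\<omega>. u \<omega> * (C \<omega>)\<^sup>2)"
  proof (rule integrable_bounded)
    show "norm (u \<omega> * (C \<omega>)\<^sup>2) \<le> K\<^sup>2" if "\<omega> \<in> space M" for \<omega>
      using mult_mono[of "u \<omega>" 1 "(C \<omega>)\<^sup>2" "K\<^sup>2"] u01[of \<omega>] field_bound_sq_le[OF that] by simp
  qed measurable
  let ?R = "\<lambda>\<omega>. 2 * (u \<omega> * (norm (level_mean 0 \<omega>))\<^sup>2)
    + (\<Sum>j=1..j_max T. 4 * 4 ^ j * (?m j j \<omega> + ?m j (j - 1) \<omega>))"
  have le_R: "u \<omega> * (norm (estimate \<omega>))\<^sup>2 \<le> ?R \<omega>" if "\<omega> \<in> space M" for \<omega>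
    using mult_left_mono[OF estimate_sq_le[OF that], of "u \<omega>"] u01[of \<omega>]
    by (simp add: algebra_simps sum_distrib_left sum.distrib)
  have int_R: "integrable M ?R"
    using int0 intm by (intro Bochner_Integration.integrable_add Bochner_Integration.integrable_sum
        integrable_mult_right)
  have "(LINT \<omega>|M. u \<omega> * (norm (estimate \<omega>))\<^sup>2) \<le> (LINT \<omega>|M. ?R \<omega>)"
    using u01 by (intro integral_mono' int_R le_R) (auto intro!: add_nonneg_nonneg sum_nonneg)
  also have "\<dots> = 2 * (LINT \<omega>|M. u \<omega> * (norm (level_mean 0 \<omega>))\<^sup>2)
      + (\<Sum>j=1..j_max T. 4 * 4 ^ j * ((LINT \<omega>|M. ?m j j \<omega>) + (LINT \<omega>|M. ?m j (j - 1) \<omega>)))"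
    using int0 intm by simp
  also have "\<dots> \<le> 2 * ?E + (\<Sum>j=1..j_max T. 96 * real \<tau> * ?E)"
  proof (intro add_mono sum_mono mult_left_mono)
    show "(LINT \<omega>|M. u \<omega> * (norm (level_mean 0 \<omega>))\<^sup>2) \<le> ?E"
      using u01 mean_sq by (intro integral_mono int0 intC mult_left_mono) auto
    fix j assume j: "j \<in> {1..j_max T}"
    then obtain i where i: "j = Suc i" by (cases j) auto
    have "(4::real) ^ i = 2 ^ i * 2 ^ i" by (simp flip: power_mult_distrib)
    then have pow: "4 * (4::real) ^ j * (8 * real \<tau> / (2 ^ j * 2 ^ j) + 8 * real \<tau> / (2 ^ (j - 1) * 2 ^ j))
        = 96 * real \<tau>"
      by (simp add: i field_simps)
    have "(LINT \<omega>|M. ?m j j \<omega>) + (LINT \<omega>|M. ?m j (j - 1) \<omega>)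
        \<le> (8 * real \<tau> / (2 ^ j * 2 ^ j) + 8 * real \<tau> / (2 ^ (j - 1) * 2 ^ j)) * ?E"
      using level_mean_second_moment[OF u u01, of j j] level_mean_second_moment[OF u u01, of j "j - 1"] j
      by (simp add: distrib_right)
    from mult_left_mono[OF this, of "4 * 4 ^ j"]
    show "4 * 4 ^ j * ((LINT \<omega>|M. ?m j j \<omega>) + (LINT \<omega>|M. ?m j (j - 1) \<omega>)) \<le> 96 * real \<tau> * ?E"
      unfolding mult.assoc[symmetric] pow by simp
  qed simp
  also have "\<dots> = (2 + 96 * real \<tau> * real (j_max T)) * ?E"
    by (simp add: algebra_simps)
  finally show ?thesis .
qed

text \<open>In expectation the corrections telescope, so that the bias is that of an average over
  \<open>2 ^ j_max T\<close> states.\<close>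

lemma estimate_bias:
  assumes w: "w \<in> borel_measurable F" and w_le: "\<And>\<omega>. \<omega> \<in> space M \<Longrightarrow> norm (w \<omega>) \<le> B"
  shows "(LINT \<omega>|M. w \<omega> \<bullet> estimate \<omega>)
    \<le> 4 * real \<tau> / 2 ^ j_max T * (LINT \<omega>|M. norm (w \<omega>) * C \<omega>)"
proof -
  let ?E = "LINT \<omega>|M. norm (w \<omega>) * C \<omega>"
  have w_M[measurable]: "w \<in> borel_measurable M" by (rule F_to_M[OF w])
  have wC: "norm (w \<omega>) * C \<omega> \<le> B * K" if "\<omega> \<in> space M" for \<omega>
    using w_le[OF that] field_bound_le[OF that] field_bound_nonneg[OF that]
    by (intro mult_mono) (auto intro: order_trans[OF norm_ge_zero])
  have wC0: "0 \<le> norm (w \<omega>) * C \<omega>" if "\<omega> \<in> space M" for \<omega>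
    using field_bound_nonneg[OF that] by simp
  have int_wC: "integrable M (\<lambda>\<omega>. norm (w \<omega>) * C \<omega>)"
  proof (rule integrable_bounded)
    show "norm (norm (w \<omega>) * C \<omega>) \<le> B * K" if "\<omega> \<in> space M" for \<omega>
      using wC[OF that] wC0[OF that] by simp
  qed measurable
  have inner_le: "\<bar>w \<omega> \<bullet> a\<bar> \<le> B * K" if "\<omega> \<in> space M" "norm a \<le> C \<omega>" for \<omega> a
    using Cauchy_Schwarz_ineq2[of "w \<omega>" a] mult_left_mono[OF that(2) norm_ge_zero[of "w \<omega>"]] wC[OF that(1)]
    by linarith
  define f where "f \<omega> z = w \<omega> \<bullet> \<psi> \<omega> z" for \<omega> z
  have f_F: "(\<lambda>p. f (fst p) (snd p)) \<in> borel_measurable (F \<Otimes>\<^sub>M Z)"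
    unfolding f_def by (rule borel_measurable_inner[OF measurable_compose[OF measurable_fst w] field_pair_F])
  have f_le: "\<bar>f \<omega> z\<bar> \<le> B * K" if "\<omega> \<in> space M" "z \<in> space Z" for \<omega> z
    unfolding f_def by (rule inner_le[OF that(1) field_norm_le[OF that]])
  define a where "a i = (LINT \<omega>|M. Q i (f \<omega>) (W 0 \<omega>))" for i
  have QfW_F: "(\<lambda>\<omega>. Q i (f \<omega>) (W 0 \<omega>)) \<in> borel_measurable F" for i
  proof -
    have "(\<lambda>p. Q i (f (fst p)) (snd p)) \<in> borel_measurable (F \<Otimes>\<^sub>M Z)"
      unfolding Q_def
    proof (rule integral_measurable_subprob_kernel)
      have "(\<lambda>q. (fst (fst q), snd q)) \<in> (F \<Otimes>\<^sub>M Z) \<Otimes>\<^sub>M Z \<rightarrow>\<^sub>M F \<Otimes>\<^sub>M Z" by measurable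
      from measurable_compose[OF this f_F]
      show "(\<lambda>(p, z). f (fst p) z) \<in> borel_measurable ((F \<Otimes>\<^sub>M Z) \<Otimes>\<^sub>M Z)"
        by (simp add: case_prod_beta')
      show "(\<lambda>p. kernel_pow Z P i (snd p)) \<in> F \<Otimes>\<^sub>M Z \<rightarrow>\<^sub>M subprob_algebra Z"
        using measurable_compose[OF measurable_snd kernel_pow_subprob] .
    qed
    from measurable_compose[OF measurable_Pair[OF measurable_ident W_F] this]
    show ?thesis by simp
  qed
  have QfW_le: "\<bar>Q i (f \<omega>) (W 0 \<omega>)\<bar> \<le> B * K" if "\<omega> \<in> space M" for i \<omega>
    by (rule Q_abs_le[OF section_measurable[OF pair_F_to_H[OF f_F] that] f_le[OF that] W_space[OF that]])
  have state: "(LINT \<omega>|M. level j \<omega> * (w \<omega> \<bullet> \<psi> \<omega> (W i \<omega>))) = (1 / 2) ^ j * a i"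
    if "1 \<le> j" "j \<le> j_max T" "i \<le> 2 ^ j" for i j
  proof -
    have "(LINT \<omega>|M. level j \<omega> * (w \<omega> \<bullet> \<psi> \<omega> (W i \<omega>))) = (LINT \<omega>|M. level j \<omega> * f \<omega> (W (0 + i) \<omega>))"
      by (simp add: f_def)
    also have "\<dots> = (LINT \<omega>|M. Q i (\<lambda>z. level j \<omega> * f \<omega> z) (W 0 \<omega>))"
    proof (rule integral_later_state)
      show "(\<lambda>p. level j (fst p) * f (fst p) (snd p)) \<in> borel_measurable (H 0 \<Otimes>\<^sub>M Z)"
        by (rule borel_measurable_times[OF measurable_compose[OF measurable_fst level_H] pair_F_to_H[OF f_F]])
      show "\<bar>level j \<omega> * f \<omega> z\<bar> \<le> B * K" if "\<omega> \<in> space M" "z \<in> space Z" for \<omega> z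
        using f_le[OF that] by (auto simp: indicator_def)
      show "level j \<omega> * f \<omega> z = 0" if "burst_len T (J \<omega>) < 0 + i" for \<omega> z
        using that \<open>j \<le> j_max T\<close> \<open>i \<le> 2 ^ j\<close> by (auto simp: indicator_def burst_len_def)
    qed
    also have "\<dots> = (LINT \<omega>|M. Q i (f \<omega>) (W 0 \<omega>) * level j \<omega>)"
      by (simp add: Q_def mult.commute)
    also have "\<dots> = (1 / 2) ^ j * a i"
      unfolding a_def by (rule integral_level[OF QfW_F QfW_le that(1)])
    finally show ?thesis .
  qed
  have state1: "(LINT \<omega>|M. w \<omega> \<bullet> \<psi> \<omega> (W 1 \<omega>)) = a 1"
  proof -
    have "(LINT \<omega>|M. w \<omega> \<bullet> \<psi> \<omega> (W 1 \<omega>)) = (LINT \<omega>|M. f \<omega> (W (0 + 1) \<omega>))"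
      by (simp add: f_def)
    also have "\<dots> = a 1"
      unfolding a_def
    proof (rule integral_later_state[OF pair_F_to_H[OF f_F] f_le])
      show "f \<omega> z = 0" if "burst_len T (J \<omega>) < 0 + 1" for \<omega> z
        using that by (auto simp: burst_len_def split: if_splits)
    qed
    finally show ?thesis .
  qed
  have int_state: "integrable M (\<lambda>\<omega>. level j \<omega> * (w \<omega> \<bullet> \<psi> \<omega> (W i \<omega>)))" for i j
  proof (rule integrable_bounded)
    show "norm (level j \<omega> * (w \<omega> \<bullet> \<psi> \<omega> (W i \<omega>))) \<le> B * K" if "\<omega> \<in> space M" for \<omega>
      using inner_le[OF that field_along_le[OF that]] wC[OF that] wC0[OF that] by (auto simp: indicator_def)
  qed measurable
  have int_state1: "integrable M (\<lambda>\<omega>. w \<omega> \<bullet> \<psi> \<omega> (W 1 \<omega>))"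
  proof (rule integrable_bounded)
    show "norm (w \<omega> \<bullet> \<psi> \<omega> (W 1 \<omega>)) \<le> B * K" if "\<omega> \<in> space M" for \<omega>
      using inner_le[OF that field_along_le[OF that]] by simp
  qed measurable
  define A where "A k = (\<Sum>i=1..2^k. a i) / 2 ^ k" for k
  have mean_inner: "level j \<omega> * (w \<omega> \<bullet> level_mean k \<omega>)
      = (\<Sum>i=1..2^k. level j \<omega> * (w \<omega> \<bullet> \<psi> \<omega> (W i \<omega>))) / 2 ^ k" for j k \<omega>
  proof -
    have "w \<omega> \<bullet> level_mean k \<omega> = (\<Sum>i=1..2^k. w \<omega> \<bullet> \<psi> \<omega> (W i \<omega>)) / 2 ^ k"
      by (simp add: emp_mean_def inner_sum_right)
    then show ?thesis by (simp only: times_divide_eq_right sum_distrib_left)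
  qed
  have int_mean: "integrable M (\<lambda>\<omega>. level j \<omega> * (w \<omega> \<bullet> level_mean k \<omega>))" for j k
    unfolding mean_inner using int_state
    by (intro integrable_divide_zero Bochner_Integration.integrable_sum)
  have level_mean_integral: "(LINT \<omega>|M. level j \<omega> * (w \<omega> \<bullet> level_mean k \<omega>)) = (1 / 2) ^ j * A k"
    if "1 \<le> j" "j \<le> j_max T" "k \<le> j" for j k
  proof -
    have pow_le: "(2::nat) ^ k \<le> 2 ^ j" using that(3) by (intro power_increasing) auto
    have "(\<Sum>i=1..2^k. LINT \<omega>|M. level j \<omega> * (w \<omega> \<bullet> \<psi> \<omega> (W i \<omega>))) = (\<Sum>i=1..2^k. (1 / 2) ^ j * a i)"
      using that(1,2) by (intro sum.cong refl state) (auto intro: order_trans[OF _ pow_le])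
    then show ?thesis
      unfolding mean_inner integral_divide_zero Bochner_Integration.integral_sum[OF int_state] A_def
      by (simp only: sum_distrib_left times_divide_eq_right)
  qed
  have "(LINT \<omega>|M. w \<omega> \<bullet> estimate \<omega>)
      = (LINT \<omega>|M. w \<omega> \<bullet> \<psi> \<omega> (W 1 \<omega>) + (\<Sum>j=1..j_max T. 2 ^ j *
          (level j \<omega> * (w \<omega> \<bullet> level_mean j \<omega>) - level j \<omega> * (w \<omega> \<bullet> level_mean (j - 1) \<omega>))))"
    by (intro Bochner_Integration.integral_cong refl)
      (simp add: estimate_eq level_mean_0 inner_add_right inner_sum_right inner_diff_right algebra_simps)
  also have "\<dots> = a 1 + (\<Sum>j=1..j_max T. 2 ^ j * ((1 / 2) ^ j * A j - (1 / 2) ^ j * A (j - 1)))"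
    using int_state1 int_mean state1 by (simp add: level_mean_integral)
  also have "\<dots> = A 0 + (\<Sum>j=1..j_max T. A j - A (j - 1))"
    by (simp add: A_def[of 0] right_diff_distrib power_one_over)
  also have "(\<Sum>j=1..j_max T. A j - A (j - 1)) = A (j_max T) - A 0"
    using sum_telescope''[of 0 "j_max T" A] by simp
  also have "A 0 + (A (j_max T) - A 0) = (\<Sum>i=1..2^j_max T. a i) / 2 ^ j_max T"
    by (simp add: A_def)
  also have "(\<Sum>i=1..2^j_max T. a i) \<le> (\<Sum>i=1..2^j_max T. (1 / 2) ^ (i div \<tau>) * (2 * ?E))"
  proof (rule sum_mono)
    fix i
    have "a i \<le> (LINT \<omega>|M. (1 / 2) ^ (i div \<tau>) * (2 * (norm (w \<omega>) * C \<omega>)))"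
      unfolding a_def
    proof (rule integral_mono)
      show "integrable M (\<lambda>\<omega>. Q i (f \<omega>) (W 0 \<omega>))"
        using F_to_M[OF QfW_F] QfW_le by (intro integrable_bounded[where B="B * K"]) auto
      show "Q i (f \<omega>) (W 0 \<omega>) \<le> (1 / 2) ^ (i div \<tau>) * (2 * (norm (w \<omega>) * C \<omega>))" if "\<omega> \<in> space M" for \<omega>
        using field_inner_mixing[OF that W_space[OF that], of i "w \<omega>" 0]
        by (simp add: f_def[abs_def] mult_ac)
    qed (use int_wC in simp)
    then show "a i \<le> (1 / 2) ^ (i div \<tau>) * (2 * ?E)" by simp
  qed
  also have "\<dots> = (\<Sum>i=1..2^j_max T. (1 / 2) ^ (i div \<tau>)) * (2 * ?E)"
    by (simp only: sum_distrib_right)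
  also have "\<dots> \<le> (2 * real \<tau>) * (2 * ?E)"
  proof (rule mult_right_mono)
    have "(\<Sum>i=1..2^j_max T. (1 / 2 :: real) ^ (i div \<tau>)) \<le> (\<Sum>i<Suc (2^j_max T). (1 / 2) ^ (i div \<tau>))"
      by (intro sum_mono2) auto
    then show "(\<Sum>i=1..2^j_max T. (1 / 2 :: real) ^ (i div \<tau>)) \<le> 2 * real \<tau>"
      using sum_mixing_rates_le[of "Suc (2^j_max T)"] by linarith
    show "0 \<le> 2 * ?E" using wC0 by (auto intro!: Bochner_Integration.integral_nonneg)
  qed
  finally show ?thesis by (simp add: divide_right_mono field_simps)
qed

end

end

section \<open>The step weights\<close>

lemma weighted_step_nonneg: "0 \<le> weighted_step l x i"
  by (simp add: weighted_step_def)

text \<open>The lower bound \<open>T powr (- 2 / 3)\<close> holds because a sum of \<open>t \<le> T\<close> terms is at most \<open>T\<close> times the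
  largest one.\<close>

lemma
  assumes "0 < \<beta>"
  shows alpha_hat_pos: "0 < alpha_hat \<beta> l x t"
    and alpha_hat_ge: "t \<le> T \<Longrightarrow> 0 < T \<Longrightarrow> real T powr (- 2 / 3) \<le> alpha_hat \<beta> l x t"
proof -
  let ?u = "\<lambda>i. \<beta> + weighted_step l x i"
  define m where "m = Max (?u ` {..<t})"
  have u: "0 < ?u i" for i using assms weighted_step_nonneg[of l x i] by simp
  have le_m: "?u i \<le> m" if "i < t" for i unfolding m_def using that by (intro Max_ge) auto
  have sum_nonneg: "0 \<le> sum ?u {..<t}" using u by (intro sum_nonneg) (auto intro: less_imp_le)
  have m: "0 < m" if "t \<noteq> 0" using le_m[of 0] u[of 0] that by simp
  show "0 < alpha_hat \<beta> l x t"
    using m sum_nonneg by (auto simp: alpha_hat_def m_def[symmetric])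
  assume t: "t \<le> T" and T: "0 < T"
  show "real T powr (- 2 / 3) \<le> alpha_hat \<beta> l x t"
  proof (cases "t = 0")
    case True
    then show ?thesis using T powr_mono[of "- 2 / 3" 0 "real T"] by (simp add: alpha_hat_def)
  next
    case False
    have "sum ?u {..<t} \<le> real t * m"
      using sum_bounded_above[of "{..<t}" ?u m] le_m by simp
    also have "\<dots> \<le> real T * m" using t m[OF False] by (intro mult_right_mono) auto
    finally have "1 + sum ?u {..<t} \<le> real T * (1 + m)"
      using T by (simp add: algebra_simps)
    then have "1 / real T \<le> (1 + m) / (1 + sum ?u {..<t})"
      using T sum_nonneg m[OF False] by (simp add: field_simps)
    then have "(1 / real T) powr (2 / 3) \<le> ((1 + m) / (1 + sum ?u {..<t})) powr (2 / 3)"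
      using T by (intro powr_mono2) auto
    then show ?thesis
      using False T by (simp add: alpha_hat_def m_def[symmetric] powr_minus_divide powr_divide)
  qed
qed

lemma alpha_le_1: "alpha \<beta> l x t \<le> 1"
proof -
  have "alpha \<beta> l x t \<le> alpha_hat \<beta> l x 0"
    unfolding alpha_def by (intro Min_le) auto
  then show ?thesis by (simp add: alpha_hat_def)
qed

lemma alpha_0: "alpha \<beta> l x 0 = 1"
  by (simp add: alpha_def alpha_hat_def)

lemma alpha_pos: "0 < \<beta> \<Longrightarrow> 0 < alpha \<beta> l x t"
  unfolding alpha_def by (subst Min_gr_iff) (auto simp: alpha_hat_pos)

lemma alpha_ge: "0 < \<beta> \<Longrightarrow> t \<le> T \<Longrightarrow> 0 < T \<Longrightarrow> real T powr (- 2 / 3) \<le> alpha \<beta> l x t"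
  unfolding alpha_def using alpha_hat_ge[of \<beta> _ T l x] le_trans by (subst Min_ge_iff) blast+

lemma alpha_measurable:
  fixes x :: "nat \<Rightarrow> 'w \<Rightarrow> 'a::euclidean_space"
  assumes x: "\<And>i. i \<le> t \<Longrightarrow> x i \<in> borel_measurable S" and l: "\<And>i. i < t \<Longrightarrow> l i \<in> borel_measurable S"
  shows "(\<lambda>\<omega>. alpha \<beta> (\<lambda>i. l i \<omega>) (\<lambda>i. x i \<omega>) t) \<in> borel_measurable S"
  unfolding alpha_def
proof (rule borel_measurable_Min)
  fix k assume k: "k \<in> {..t}"
  have step: "(\<lambda>\<omega>. weighted_step (\<lambda>i. l i \<omega>) (\<lambda>i. x i \<omega>) i) \<in> borel_measurable S" if "i < k" for i
    unfolding weighted_step_def using x[of i] x[of "Suc i"] l[of i] that k by simp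
  then have num: "(\<lambda>\<omega>. Max ((\<lambda>i. \<beta> + weighted_step (\<lambda>i. l i \<omega>) (\<lambda>i. x i \<omega>) i) ` {..<k})) \<in> borel_measurable S"
    by (intro borel_measurable_Max) auto
  have den: "(\<lambda>\<omega>. \<Sum>i<k. \<beta> + weighted_step (\<lambda>i. l i \<omega>) (\<lambda>i. x i \<omega>) i) \<in> borel_measurable S"
    using step by (intro borel_measurable_sum) auto
  show "(\<lambda>\<omega>. alpha_hat \<beta> (\<lambda>i. l i \<omega>) (\<lambda>i. x i \<omega>) k) \<in> borel_measurable S"
    unfolding alpha_hat_def using num den by (cases "k = 0") auto
qed simp

section \<open>The stochastic gradients and the iterates\<close>

lemma continuous_on_compose_measurable:
  fixes f :: "'a::euclidean_space \<Rightarrow> 'b::euclidean_space"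
  assumes f: "continuous_on X f" and X: "closed X"
    and \<theta>: "\<theta> \<in> borel_measurable S" "\<And>\<omega>. \<omega> \<in> space S \<Longrightarrow> \<theta> \<omega> \<in> X"
  shows "(\<lambda>\<omega>. f (\<theta> \<omega>)) \<in> borel_measurable S"
proof -
  have "\<theta> \<in> S \<rightarrow>\<^sub>M restrict_space borel X"
    using \<theta> by (intro measurable_restrict_space2) auto
  from measurable_compose[OF this borel_measurable_continuous_on_restrict[OF f]] show ?thesis .
qed

lemma add_measurable_nat:
  fixes a b :: "'w \<Rightarrow> nat"
  assumes "a \<in> S \<rightarrow>\<^sub>M count_space UNIV" "b \<in> S \<rightarrow>\<^sub>M count_space UNIV"
  shows "(\<lambda>\<omega>. a \<omega> + b \<omega>) \<in> S \<rightarrow>\<^sub>M count_space UNIV"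
  by (rule measurable_compose_countable[where f="\<lambda>i \<omega>. i + b \<omega>", OF _ assms(1)])
    (rule measurable_compose[OF assms(2)], simp)

lemma generated_measurable:
  assumes "sets (vimage_algebra (space M) f N) \<subseteq> sets S" "space S = space M" "f \<in> space M \<rightarrow> space N"
  shows "f \<in> S \<rightarrow>\<^sub>M N"
proof (rule measurableI)
  show "f \<omega> \<in> space N" if "\<omega> \<in> space S" for \<omega> using that assms(2,3) by auto
  show "f -` A \<inter> space S \<in> sets S" if "A \<in> sets N" for A
    using in_vimage_algebra[OF that, of f "space M"] assms(1,2) by auto
qed

lemma emp_mean_affine:
  "emp_mean z j (\<lambda>y. \<phi> y - a - c *\<^sub>R (\<phi>' y - a')) = emp_mean z j \<phi> - a - c *\<^sub>R (emp_mean z j \<phi>' - a')"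
proof -
  have "(\<Sum>i=1..2^j. \<phi> (z i) - a - c *\<^sub>R (\<phi>' (z i) - a'))
      = (\<Sum>i=1..2^j. \<phi> (z i)) - 2 ^ j *\<^sub>R a - c *\<^sub>R ((\<Sum>i=1..2^j. \<phi>' (z i)) - 2 ^ j *\<^sub>R a')"
    by (simp add: sum_subtractf sum_constant_scaleR flip: scaleR_sum_right)
  then show ?thesis
    unfolding emp_mean_def by (simp only:) (simp add: algebra_simps)
qed

lemma mlmc_affine:
  "mlmc T j z (\<lambda>y. \<phi> y - a - c *\<^sub>R (\<phi>' y - a')) = mlmc T j z \<phi> - a - c *\<^sub>R (mlmc T j z \<phi>' - a')"
  unfolding mlmc_def emp_mean_affine by (simp add: algebra_simps)

context composite_problem
begin

lemma closed_X: "closed X" using X(1) by (rule compact_imp_closed)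

lemma h_real:
  assumes "y \<in> X"
  shows "h y = ereal (real_of_ereal (h y))"
  using h_proper(1)[of y] h_finite[OF assms] by (cases "h y") auto

lemma gap_nonneg:
  assumes v: "v \<in> LMO X h g" and y: "y \<in> X"
  shows "v \<in> X" "0 \<le> real_of_ereal (h y) - real_of_ereal (h v) - g \<bullet> (v - y)"
proof -
  show vX: "v \<in> X" using v by (simp add: LMO_def is_arg_min_def)
  have "\<not> ereal (y \<bullet> g) + h y < ereal (v \<bullet> g) + h v"
    using v y by (simp add: LMO_def is_arg_min_def)
  then have "\<not> y \<bullet> g + real_of_ereal (h y) < v \<bullet> g + real_of_ereal (h v)"
    using h_real[OF vX] h_real[OF y] by (metis plus_ereal.simps(1) less_ereal.simps(1))
  then show "0 \<le> real_of_ereal (h y) - real_of_ereal (h v) - g \<bullet> (v - y)"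
    by (simp add: inner_diff_right inner_commute)
qed

lemma h_compose_measurable:
  assumes "\<theta> \<in> borel_measurable S" "\<And>\<omega>. \<omega> \<in> space S \<Longrightarrow> \<theta> \<omega> \<in> X"
  shows "(\<lambda>\<omega>. real_of_ereal (h (\<theta> \<omega>))) \<in> borel_measurable S"
  by (rule continuous_on_compose_measurable[OF lipschitz_on_continuous_on[OF h_lipschitz] closed_X assms])

end

context mlmc_fw
begin

lemma Z_not_empty: "space Z \<noteq> {}"
proof -
  obtain \<omega> where "\<omega> \<in> space M" using not_empty by blast
  from measurable_space[OF Y_measurable[of 0] this] show ?thesis by blast
qed

lemma
  assumes "\<omega> \<in> space M" "t \<le> T"
  shows run_l: "l t \<omega> = \<rho> * sqrt (1 + (\<Sum>i<t. weighted_step (\<lambda>i. l i \<omega>) (\<lambda>i. x i \<omega>) i))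
      * alpha \<beta> (\<lambda>i. l i \<omega>) (\<lambda>i. x i \<omega>) t powr (- 1 / 4)"
    and run_g: "g t \<omega> = closest_point (cball 0 G')
      ((1 - alpha \<beta> (\<lambda>i. l i \<omega>) (\<lambda>i. x i \<omega>) t) *\<^sub>R ((if t = 0 then 0 else g (t - 1) \<omega>)
          - mlmc T (J t \<omega>) (\<lambda>i. Y (burst_start T (\<lambda>s. J s \<omega>) t + i) \<omega>) (gz (x (t - 1) \<omega>)))
        + mlmc T (J t \<omega>) (\<lambda>i. Y (burst_start T (\<lambda>s. J s \<omega>) t + i) \<omega>) (gz (x t \<omega>)))"
    and run_v: "v t \<omega> \<in> LMO X h (g t \<omega>)"
    and run_x: "x (Suc t) \<omega> = x t \<omega> +
      min ((real_of_ereal (h (x t \<omega>)) - real_of_ereal (h (v t \<omega>)) - g t \<omega> \<bullet> (v t \<omega> - x t \<omega>)) /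
           (l t \<omega> * (norm (v t \<omega> - x t \<omega>))\<^sup>2)) 1 *\<^sub>R (v t \<omega> - x t \<omega>)"
proof -
  note run_t = run[OF assms(1), unfolded mlmc_fw_run_def Let_def, THEN conjunct2, THEN conjunct2,
      rule_format, OF assms(2)]
  show "l t \<omega> = \<rho> * sqrt (1 + (\<Sum>i<t. weighted_step (\<lambda>i. l i \<omega>) (\<lambda>i. x i \<omega>) i))
      * alpha \<beta> (\<lambda>i. l i \<omega>) (\<lambda>i. x i \<omega>) t powr (- 1 / 4)"
    by (rule run_t[THEN conjunct1])
  show "g t \<omega> = closest_point (cball 0 G')
      ((1 - alpha \<beta> (\<lambda>i. l i \<omega>) (\<lambda>i. x i \<omega>) t) *\<^sub>R ((if t = 0 then 0 else g (t - 1) \<omega>)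
          - mlmc T (J t \<omega>) (\<lambda>i. Y (burst_start T (\<lambda>s. J s \<omega>) t + i) \<omega>) (gz (x (t - 1) \<omega>)))
        + mlmc T (J t \<omega>) (\<lambda>i. Y (burst_start T (\<lambda>s. J s \<omega>) t + i) \<omega>) (gz (x t \<omega>)))"
    by (rule run_t[THEN conjunct2, THEN conjunct1])
  show "v t \<omega> \<in> LMO X h (g t \<omega>)"
    by (rule run_t[THEN conjunct2, THEN conjunct2, THEN conjunct1])
  \<comment> \<open>Division by zero makes the case \<open>v t = x t\<close> superfluous.\<close>
  show "x (Suc t) \<omega> = x t \<omega> +
      min ((real_of_ereal (h (x t \<omega>)) - real_of_ereal (h (v t \<omega>)) - g t \<omega> \<bullet> (v t \<omega> - x t \<omega>)) /
           (l t \<omega> * (norm (v t \<omega> - x t \<omega>))\<^sup>2)) 1 *\<^sub>R (v t \<omega> - x t \<omega>)"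
    using run_t[THEN conjunct2, THEN conjunct2, THEN conjunct2] by (cases "v t \<omega> = x t \<omega>") simp_all
qed

lemma x_in_X:
  assumes \<omega>: "\<omega> \<in> space M"
  shows "t \<le> Suc T \<Longrightarrow> x t \<omega> \<in> X"
proof (induction t)
  case 0
  show ?case using run[OF \<omega>] by (simp add: mlmc_fw_run_def)
next
  case (Suc t)
  then have xt: "x t \<omega> \<in> X" and t: "t \<le> T" by auto
  define \<eta> where "\<eta> = min ((real_of_ereal (h (x t \<omega>)) - real_of_ereal (h (v t \<omega>)) - g t \<omega> \<bullet> (v t \<omega> - x t \<omega>)) /
           (l t \<omega> * (norm (v t \<omega> - x t \<omega>))\<^sup>2)) 1"
  have "0 \<le> l t \<omega>"
    unfolding run_l[OF \<omega> t] using params(1) weighted_step_nonneg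
    by (intro mult_nonneg_nonneg real_sqrt_ge_zero add_nonneg_nonneg sum_nonneg) auto
  then have \<eta>: "0 \<le> \<eta>" "\<eta> \<le> 1"
    using gap_nonneg(2)[OF run_v[OF \<omega> t] xt] by (auto simp: \<eta>_def)
  have "x (Suc t) \<omega> = (1 - \<eta>) *\<^sub>R x t \<omega> + \<eta> *\<^sub>R v t \<omega>"
    unfolding run_x[OF \<omega> t] \<eta>_def[symmetric] by (simp add: algebra_simps)
  then show ?case
    using X(2) xt gap_nonneg(1)[OF run_v[OF \<omega> t] xt] \<eta> by (simp add: convex_alt)
qed

lemma X_not_empty: "X \<noteq> {}"
proof -
  obtain \<omega> where "\<omega> \<in> space M" using not_empty by blast
  from x_in_X[OF this, of 0] show ?thesis by blast
qed

lemma G_nonneg: "0 \<le> G" and G'_nonneg: "0 \<le> G'" and noise_nonneg: "0 \<le> G\<^sub>\<sigma>" and L_nonneg: "0 \<le> L"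
proof -
  obtain y where y: "y \<in> X" using X_not_empty by blast
  obtain z where z: "z \<in> space Z" using Z_not_empty by blast
  show "0 \<le> G" using gradient_bound[OF y] norm_ge_zero[of "gf y"] by linarith
  then show "0 \<le> G'" using params(3) by simp
  show "0 \<le> G\<^sub>\<sigma>" using noise_bound[OF y z] norm_ge_zero[of "gz y z - gf y"] by linarith
  show "0 \<le> L" using gradient_lipschitz[OF z] by (simp add: lipschitz_on_def)
qed

lemma gz_lipschitz: "z \<in> space Z \<Longrightarrow> y \<in> X \<Longrightarrow> y' \<in> X \<Longrightarrow> norm (gz y z - gz y' z) \<le> L * norm (y - y')"
  using lipschitz_onD[OF gradient_lipschitz] by (simp add: dist_norm)

lemma gf_lipschitz:
  assumes "y \<in> X" "y' \<in> X"
  shows "norm (gf y - gf y') \<le> L * norm (y - y')"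
proof -
  interpret \<pi>: prob_space \<pi> by (rule pi_prob_space)
  have int: "integrable \<pi> (\<lambda>z. gz y z - gz y' z)"
    using gradient_integrable assms by simp
  have "gf y - gf y' = (LINT z|\<pi>. gz y z - gz y' z)"
    using gradient_integrable assms by (simp add: gradient_unbiased)
  then have "norm (gf y - gf y') \<le> (LINT z|\<pi>. norm (gz y z - gz y' z))"
    by (simp only: integral_norm_bound)
  also have "\<dots> \<le> L * norm (y - y')"
    using int gz_lipschitz assms by (intro \<pi>.integral_le_const integrable_norm AE_I2) auto
  finally show ?thesis .
qed

lemma gf_compose_measurable:
  assumes "\<theta> \<in> borel_measurable S" "\<And>\<omega>. \<omega> \<in> space S \<Longrightarrow> \<theta> \<omega> \<in> X"
  shows "(\<lambda>\<omega>. gf (\<theta> \<omega>)) \<in> borel_measurable S"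
proof -
  have "L-lipschitz_on X gf"
    using gf_lipschitz L_nonneg by (auto intro!: lipschitz_onI simp: dist_norm)
  from continuous_on_compose_measurable[OF lipschitz_on_continuous_on[OF this] closed_X assms]
  show ?thesis .
qed

text \<open>The sample gradient is measurable in \<open>z\<close> and Lipschitz in the point, hence jointly
  measurable: it is the limit of its values at ever closer points of a countable dense set.\<close>

lemma gz_compose_measurable:
  assumes \<theta>: "\<theta> \<in> borel_measurable S" "\<And>\<omega>. \<omega> \<in> space S \<Longrightarrow> \<theta> \<omega> \<in> X" and V: "V \<in> S \<rightarrow>\<^sub>M Z"
  shows "(\<lambda>\<omega>. gz (\<theta> \<omega>) (V \<omega>)) \<in> borel_measurable S"
proof -
  obtain D where D: "countable D" "D \<subseteq> X" "X \<subseteq> closure D"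
    using separable[of X] by blast
  have D_ne: "D \<noteq> {}" using D(3) X_not_empty by auto
  define d where "d = from_nat_into D"
  have d: "d k \<in> X" for k using from_nat_into[OF D_ne] D(2) by (auto simp: d_def)
  have dense: "\<exists>k. dist (\<theta> \<omega>) (d k) < 1 / real (Suc n)" if "\<omega> \<in> space S" for n \<omega>
  proof -
    have "\<theta> \<omega> \<in> closure D" using \<theta>(2)[OF that] D(3) by blast
    then obtain y where "y \<in> D" "dist y (\<theta> \<omega>) < 1 / real (Suc n)"
      unfolding closure_approachable by (meson of_nat_0_less_iff zero_less_Suc zero_less_divide_1_iff)
    then show ?thesis
      using from_nat_into_surj[OF D(1)] by (metis d_def dist_commute)
  qed
  define k where "k n \<omega> = (LEAST k. dist (\<theta> \<omega>) (d k) < 1 / real (Suc n))" for n \<omega>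
  have k: "dist (\<theta> \<omega>) (d (k n \<omega>)) < 1 / real (Suc n)" if "\<omega> \<in> space S" for n \<omega>
    unfolding k_def using LeastI_ex[OF dense[OF that]] .
  have k_meas: "k n \<in> S \<rightarrow>\<^sub>M count_space UNIV" for n
    unfolding k_def using \<theta>(1) by measurable
  show ?thesis
  proof (rule borel_measurable_LIMSEQ_metric)
    show "(\<lambda>\<omega>. gz (d (k n \<omega>)) (V \<omega>)) \<in> borel_measurable S" for n
    proof (rule measurable_compose_countable[OF _ k_meas])
      fix i
      have "gz (d i) \<in> borel_measurable Z"
        using borel_measurable_integrable[OF gradient_integrable[OF d]] by (simp cong: measurable_cong_sets)
      from measurable_compose[OF V this] show "(\<lambda>\<omega>. gz (d i) (V \<omega>)) \<in> borel_measurable S" .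
    qed
    fix \<omega> assume \<omega>: "\<omega> \<in> space S"
    have "norm (gz (d (k n \<omega>)) (V \<omega>) - gz (\<theta> \<omega>) (V \<omega>)) \<le> L * (1 / real (Suc n))" for n
      using gz_lipschitz[OF measurable_space[OF V \<omega>] d \<theta>(2)[OF \<omega>]]
        mult_left_mono[OF less_imp_le[OF k[OF \<omega>]] L_nonneg]
      by (simp add: dist_norm norm_minus_commute) (meson order_trans)
    then have "(\<lambda>n. gz (d (k n \<omega>)) (V \<omega>) - gz (\<theta> \<omega>) (V \<omega>)) \<longlonglongrightarrow> 0"
      by (intro Lim_null_comparison[OF always_eventually tendsto_mult_right_zero[OF LIMSEQ_inverse_real_of_nat[unfolded inverse_eq_divide]]])
        auto
    then show "(\<lambda>n. gz (d (k n \<omega>)) (V \<omega>)) \<longlonglongrightarrow> gz (\<theta> \<omega>) (V \<omega>)"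
      by (simp only: LIM_zero_iff)
  qed
qed

lemma l_measurable:
  assumes "space S = space M" "t \<le> T"
  shows "(\<And>i. i \<le> t \<Longrightarrow> x i \<in> borel_measurable S) \<Longrightarrow> l t \<in> borel_measurable S"
  using assms(2)
proof (induction t rule: less_induct)
  case (less t)
  have l: "l i \<in> borel_measurable S" if "i < t" for i
    using that less by (intro less.IH) auto
  have step: "(\<lambda>\<omega>. weighted_step (\<lambda>i. l i \<omega>) (\<lambda>i. x i \<omega>) i) \<in> borel_measurable S" if "i < t" for i
    unfolding weighted_step_def using less.prems(1)[of i] less.prems(1)[of "Suc i"] l[OF that] that by simp
  have \<alpha>: "(\<lambda>\<omega>. alpha \<beta> (\<lambda>i. l i \<omega>) (\<lambda>i. x i \<omega>) t) \<in> borel_measurable S"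
    by (rule alpha_measurable[OF less.prems(1) l])
  have sum: "(\<lambda>\<omega>. \<Sum>i<t. weighted_step (\<lambda>i. l i \<omega>) (\<lambda>i. x i \<omega>) i) \<in> borel_measurable S"
    using step by (intro borel_measurable_sum) auto
  show ?case
  proof (rule measurable_cong[THEN iffD2])
    show "l t \<omega> = \<rho> * sqrt (1 + (\<Sum>i<t. weighted_step (\<lambda>i. l i \<omega>) (\<lambda>i. x i \<omega>) i))
      * alpha \<beta> (\<lambda>i. l i \<omega>) (\<lambda>i. x i \<omega>) t powr (- 1 / 4)" if "\<omega> \<in> space S" for \<omega>
      using run_l[OF _ less.prems(2)] that assms(1) by simp
  qed (use \<alpha> sum in measurable)
qed

lemma step_weight_measurable:
  assumes "space S = space M" "t \<le> T" "\<And>i. i \<le> t \<Longrightarrow> x i \<in> borel_measurable S"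
  shows "(\<lambda>\<omega>. alpha \<beta> (\<lambda>i. l i \<omega>) (\<lambda>i. x i \<omega>) t) \<in> borel_measurable S"
  using assms by (intro alpha_measurable l_measurable) auto

abbreviation start :: "nat \<Rightarrow> 'w \<Rightarrow> nat" where
  "start t \<omega> \<equiv> burst_start T (\<lambda>s. J s \<omega>) t"

text \<open>The \<open>i\<close>-th state of burst \<open>t\<close>; \<open>W t 0\<close> is the state before the burst.\<close>

abbreviation W :: "nat \<Rightarrow> nat \<Rightarrow> 'w \<Rightarrow> 'z" where
  "W t i \<omega> \<equiv> Y (start t \<omega> + i) \<omega>"

lemma start_measurable:
  assumes "\<And>s. s < t \<Longrightarrow> J s \<in> S \<rightarrow>\<^sub>M count_space UNIV"
  shows "start t \<in> S \<rightarrow>\<^sub>M count_space UNIV"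
  using assms
proof (induction t)
  case 0
  then show ?case by (simp add: burst_start_def)
next
  case (Suc t)
  have "(\<lambda>\<omega>. start t \<omega> + burst_len T (J t \<omega>)) \<in> S \<rightarrow>\<^sub>M count_space UNIV"
    using Suc measurable_compose[of "J t" S "count_space UNIV" "burst_len T"] by (intro add_measurable_nat) auto
  then show ?case by (simp add: burst_start_def)
qed

lemma W_measurable:
  assumes "t \<le> T"
  shows "W t i \<in> M \<rightarrow>\<^sub>M Z"
proof (rule measurable_compose_countable[where f="\<lambda>k. Y (k + i)" and g="start t", OF Y_measurable])
  show "start t \<in> M \<rightarrow>\<^sub>M count_space UNIV"
    using assms by (intro start_measurable J_measurable) auto
qed

lemma mlmc_measurable:
  assumes t: "t \<le> T" and \<theta>: "\<theta> \<in> borel_measurable M" "\<And>\<omega>. \<omega> \<in> space M \<Longrightarrow> \<theta> \<omega> \<in> X"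
  shows "(\<lambda>\<omega>. mlmc T (J t \<omega>) (\<lambda>i. W t i \<omega>) (gz (\<theta> \<omega>))) \<in> borel_measurable M"
proof (rule measurable_compose_countable[OF _ J_measurable[OF t]])
  fix j
  have [measurable]: "(\<lambda>\<omega>. emp_mean (\<lambda>i. W t i \<omega>) k (gz (\<theta> \<omega>))) \<in> borel_measurable M" for k
    unfolding emp_mean_def using gz_compose_measurable[OF \<theta> W_measurable[OF t]]
    by (intro borel_measurable_scaleR borel_measurable_sum) auto
  show "(\<lambda>\<omega>. mlmc T j (\<lambda>i. W t i \<omega>) (gz (\<theta> \<omega>))) \<in> borel_measurable M"
    unfolding mlmc_def by (cases "j \<le> j_max T") simp_all
qed

lemma projection_measurable: "closest_point (cball 0 G') \<in> borel_measurable borel"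
  using G'_nonneg by (intro borel_measurable_continuous_onI continuous_on_closest_point) auto

lemma x_g_measurable: "t \<le> T \<Longrightarrow> (\<forall>s\<le>t. x s \<in> borel_measurable M \<and> g s \<in> borel_measurable M)"
proof -
  have g: "g t \<in> borel_measurable M"
    if t: "t \<le> T" and x: "\<And>s. s \<le> t \<Longrightarrow> x s \<in> borel_measurable M"
      and prev: "\<And>s. s < t \<Longrightarrow> g s \<in> borel_measurable M" for t
  proof -
    have "(\<lambda>\<omega>. if t = 0 then 0 else g (t - 1) \<omega>) \<in> borel_measurable M"
      using prev[of "t - 1"] by (cases "t = 0") auto
    moreover have "(\<lambda>\<omega>. mlmc T (J t \<omega>) (\<lambda>i. W t i \<omega>) (gz (x s \<omega>))) \<in> borel_measurable M" if "s \<le> t" for s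
      using t that x x_in_X by (intro mlmc_measurable) auto
    ultimately have "(\<lambda>\<omega>. (1 - alpha \<beta> (\<lambda>i. l i \<omega>) (\<lambda>i. x i \<omega>) t) *\<^sub>R ((if t = 0 then 0 else g (t - 1) \<omega>)
          - mlmc T (J t \<omega>) (\<lambda>i. W t i \<omega>) (gz (x (t - 1) \<omega>)))
        + mlmc T (J t \<omega>) (\<lambda>i. W t i \<omega>) (gz (x t \<omega>))) \<in> borel_measurable M"
      using step_weight_measurable[OF refl t x]
      by (intro borel_measurable_add borel_measurable_scaleR borel_measurable_diff) auto
    from measurable_compose[OF this projection_measurable] show ?thesis
      by (subst measurable_cong[OF run_g[OF _ t]])
  qed
  show "t \<le> T \<Longrightarrow> (\<forall>s\<le>t. x s \<in> borel_measurable M \<and> g s \<in> borel_measurable M)"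
  proof (induction t)
    case 0
    then show ?case using x0_measurable g[of 0] by auto
  next
    case (Suc t)
    then have t: "t \<le> T" and IH: "\<And>s. s \<le> t \<Longrightarrow> x s \<in> borel_measurable M \<and> g s \<in> borel_measurable M" by auto
    have [measurable]: "x t \<in> borel_measurable M" "g t \<in> borel_measurable M" "v t \<in> borel_measurable M"
      using IH v_measurable[OF t] by auto
    have [measurable]: "l t \<in> borel_measurable M" using IH t by (intro l_measurable) auto
    have [measurable]: "(\<lambda>\<omega>. real_of_ereal (h (x t \<omega>))) \<in> borel_measurable M"
      "(\<lambda>\<omega>. real_of_ereal (h (v t \<omega>))) \<in> borel_measurable M"
      using x_in_X gap_nonneg(1)[OF run_v[OF _ t]] X_not_empty t by (auto intro!: h_compose_measurable)
    have "x (Suc t) \<in> borel_measurable M"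
      by (subst measurable_cong[OF run_x[OF _ t]]) measurable
    then have x: "x s \<in> borel_measurable M" if "s \<le> Suc t" for s
      using IH that by (cases "s = Suc t") auto
    have g': "g s \<in> borel_measurable M" if "s < Suc t" for s
      using IH[of s] that by simp
    have "g (Suc t) \<in> borel_measurable M"
      by (rule g[OF Suc.prems x g'])
    then have "g s \<in> borel_measurable M" if "s \<le> Suc t" for s
      using g'[of s] that by (cases "s = Suc t") auto
    with x show ?case by blast
  qed
qed

end

section \<open>The history of the run\<close>

lemma (in finite_measure_subalgebra) real_cond_exp_le_of_set_integrals:
  assumes f: "integrable M f" and R: "integrable M R" "R \<in> borel_measurable F"
    and le: "\<And>A. A \<in> sets F \<Longrightarrow> (LINT \<omega>|M. indicat_real A \<omega> * f \<omega>) \<le> (LINT \<omega>|M. indicat_real A \<omega> * R \<omega>)"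
  shows "AE \<omega> in M. real_cond_exp M F f \<omega> \<le> R \<omega>"
proof -
  let ?E = "real_cond_exp M F f"
  have sp: "space F = space M" using subalg by (simp add: subalgebra_def)
  define A where "A = {\<omega> \<in> space F. R \<omega> < ?E \<omega>}"
  have A: "A \<in> sets F" unfolding A_def using R(2) by measurable
  then have A_M: "A \<in> sets M" using subalg by (auto simp: subalgebra_def)
  have int_E: "integrable M ?E" by (rule real_cond_exp_int(1)[OF f])
  have int: "integrable M (\<lambda>\<omega>. indicat_real A \<omega> * ?E \<omega>)" "integrable M (\<lambda>\<omega>. indicat_real A \<omega> * R \<omega>)"
    using integrable_mult_indicator[OF A_M int_E] integrable_mult_indicator[OF A_M R(1)] by simp_all
  have nonneg: "0 \<le> indicat_real A \<omega> * ?E \<omega> - indicat_real A \<omega> * R \<omega>" for \<omega>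
    by (simp add: indicator_def A_def)
  have "(LINT \<omega>|M. indicat_real A \<omega> * ?E \<omega>) = (LINT \<omega>|M. indicat_real A \<omega> * f \<omega>)"
    using real_cond_exp_intA[OF f A] by (simp add: set_lebesgue_integral_def)
  then have "(LINT \<omega>|M. indicat_real A \<omega> * ?E \<omega> - indicat_real A \<omega> * R \<omega>) \<le> 0"
    using le[OF A] int by simp
  moreover have "0 \<le> (LINT \<omega>|M. indicat_real A \<omega> * ?E \<omega> - indicat_real A \<omega> * R \<omega>)"
    using nonneg by (intro Bochner_Integration.integral_nonneg)
  ultimately have "(LINT \<omega>|M. indicat_real A \<omega> * ?E \<omega> - indicat_real A \<omega> * R \<omega>) = 0" by linarith
  then have "AE \<omega> in M. indicat_real A \<omega> * ?E \<omega> - indicat_real A \<omega> * R \<omega> = 0"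
    using int nonneg by (subst (asm) integral_nonneg_eq_0_iff_AE) auto
  moreover have "AE \<omega> in M. \<omega> \<in> space M" by (rule AE_space)
  ultimately show ?thesis
    by eventually_elim (auto simp: A_def sp indicator_def split: if_splits)
qed

context mlmc_fw
begin

abbreviation hist :: "nat \<Rightarrow> 'w measure" where
  "hist t \<equiv> history M Z T Y J x g v t"

abbreviation burst_hist :: "nat \<Rightarrow> nat \<Rightarrow> 'w measure" where
  "burst_hist t i \<equiv> burst_history M Z T Y J x g v t i"

abbreviation hist_gen :: "nat \<Rightarrow> 'w set set" where
  "hist_gen t \<equiv> (\<Union>s\<le>t. sets (vimage_algebra (space M) (x s) borel)) \<union>
      (\<Union>s<t. sets (vimage_algebra (space M) (g s) borel)) \<union>
      (\<Union>s<t. sets (vimage_algebra (space M) (v s) borel)) \<union>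
      (\<Union>s<t. sets (vimage_algebra (space M) (J s) (count_space UNIV))) \<union>
      (\<Union>k. sets (vimage_algebra (space M) (\<lambda>\<omega>. Y (min k (start t \<omega>)) \<omega>) Z))"

abbreviation burst_gen :: "nat \<Rightarrow> nat \<Rightarrow> 'w set set" where
  "burst_gen t i \<equiv> sets (hist t) \<union>
      sets (vimage_algebra (space M) (J t) (count_space UNIV)) \<union>
      (\<Union>k\<in>{1..i}. sets (vimage_algebra (space M) (\<lambda>\<omega>. W t k \<omega>) Z))"

lemma vimage_algebra_Pow: "sets (vimage_algebra (space M) f N) \<subseteq> Pow (space M)"
  by (metis sets.space_closed space_vimage_algebra)

lemma space_hist[simp]: "space (hist t) = space M"
  by (simp add: history_def space_measure_of_conv)

lemma sets_hist: "sets (hist t) = sigma_sets (space M) (hist_gen t)"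
  unfolding history_def by (rule sets_measure_of) (intro Un_least UN_least vimage_algebra_Pow)

lemma hist_gen_subset: "hist_gen t \<subseteq> sets (hist t)"
  unfolding sets_hist by (rule sigma_sets_superset_generator)

lemma space_burst_hist[simp]: "space (burst_hist t i) = space M"
  by (simp add: burst_history_def space_measure_of_conv)

lemma burst_gen_Pow: "burst_gen t i \<subseteq> Pow (space M)"
  using sets.space_closed[of "hist t"]
  by (intro Un_least UN_least vimage_algebra_Pow) (simp only: space_hist)

lemma sets_burst_hist: "sets (burst_hist t i) = sigma_sets (space M) (burst_gen t i)"
  unfolding burst_history_def by (rule sets_measure_of[OF burst_gen_Pow])

lemma burst_gen_subset: "burst_gen t i \<subseteq> sets (burst_hist t i)"
  unfolding sets_burst_hist by (rule sigma_sets_superset_generator)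

lemma hist_subset_burst_hist: "sets (hist t) \<subseteq> sets (burst_hist t i)"
  by (rule order_trans[OF _ burst_gen_subset]) (intro le_supI1 order_refl)

lemma vimage_algebra_subset_M: "f \<in> M \<rightarrow>\<^sub>M N \<Longrightarrow> sets (vimage_algebra (space M) f N) \<subseteq> sets M"
  by (rule sets_image_in_sets) simp_all

lemma stopped_state_measurable:
  assumes "t \<le> T"
  shows "(\<lambda>\<omega>. Y (min k (start t \<omega>)) \<omega>) \<in> M \<rightarrow>\<^sub>M Z"
proof (rule measurable_compose_countable[where f="\<lambda>i. Y (min k i)" and g="start t", OF Y_measurable])
  show "start t \<in> M \<rightarrow>\<^sub>M count_space UNIV"
    using assms by (intro start_measurable J_measurable) auto
qed

lemma subalgebra_hist:
  assumes t: "t \<le> T"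
  shows "subalgebra M (hist t)"
proof -
  have "hist_gen t \<subseteq> sets M"
    using t x_g_measurable[OF t]
    by (intro Un_least UN_least vimage_algebra_subset_M stopped_state_measurable v_measurable J_measurable) auto
  then have "sets (hist t) \<subseteq> sets M"
    unfolding sets_hist by (rule sets.sigma_sets_subset)
  then show ?thesis by (simp add: subalgebra_def)
qed

lemma subalgebra_burst_hist:
  assumes t: "t \<le> T"
  shows "subalgebra M (burst_hist t i)"
proof -
  have "burst_gen t i \<subseteq> sets M"
    using subalgebra_hist[OF t] t
    by (intro Un_least UN_least vimage_algebra_subset_M W_measurable J_measurable) (auto simp: subalgebra_def)
  then have "sets (burst_hist t i) \<subseteq> sets M"
    unfolding sets_burst_hist by (rule sets.sigma_sets_subset)
  then show ?thesis by (simp add: subalgebra_def)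
qed

lemma x_hist: "s \<le> t \<Longrightarrow> x s \<in> borel_measurable (hist t)"
  and g_hist: "s < t \<Longrightarrow> g s \<in> borel_measurable (hist t)"
  and J_hist: "s < t \<Longrightarrow> J s \<in> hist t \<rightarrow>\<^sub>M count_space UNIV"
proof -
  show "x s \<in> borel_measurable (hist t)" if "s \<le> t"
    by (rule generated_measurable[OF order_trans[OF _ hist_gen_subset]]) (use that in auto)
  show "g s \<in> borel_measurable (hist t)" if "s < t"
    by (rule generated_measurable[OF order_trans[OF _ hist_gen_subset]]) (use that in auto)
  show "J s \<in> hist t \<rightarrow>\<^sub>M count_space UNIV" if "s < t"
    by (rule generated_measurable[OF order_trans[OF _ hist_gen_subset]]) (use that in auto)
qed

text \<open>The history records the path stopped at the start of the burst, and \<open>W t 0\<close> is the value of that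
  path at its stopping time.\<close>

lemma W_0_hist: "W t 0 \<in> hist t \<rightarrow>\<^sub>M Z"
proof -
  have "(\<lambda>\<omega>. Y (min (start t \<omega>) (start t \<omega>)) \<omega>) \<in> hist t \<rightarrow>\<^sub>M Z"
  proof (rule measurable_compose_countable[where f="\<lambda>k \<omega>. Y (min k (start t \<omega>)) \<omega>" and g="start t"])
    show "start t \<in> hist t \<rightarrow>\<^sub>M count_space UNIV"
      by (rule start_measurable[OF J_hist])
    show "(\<lambda>\<omega>. Y (min k (start t \<omega>)) \<omega>) \<in> hist t \<rightarrow>\<^sub>M Z" for k
    proof (rule generated_measurable[OF order_trans[OF _ hist_gen_subset]])
      show "(\<lambda>\<omega>. Y (min k (start t \<omega>)) \<omega>) \<in> space M \<rightarrow> space Z"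
        using measurable_space[OF Y_measurable] by auto
    qed auto
  qed
  then show ?thesis by simp
qed

lemma ident_burst_hist_hist: "(\<lambda>\<omega>. \<omega>) \<in> burst_hist t i \<rightarrow>\<^sub>M hist t"
  by (rule ident_subalgebra[OF hist_subset_burst_hist]) simp

lemma W_burst_hist: "W t i \<in> burst_hist t i \<rightarrow>\<^sub>M Z"
proof (cases "i = 0")
  case True
  show ?thesis
    unfolding True by (rule measurable_compose[OF ident_burst_hist_hist W_0_hist])
next
  case False
  show ?thesis
  proof (rule generated_measurable[OF order_trans[OF _ burst_gen_subset]])
    show "W t i \<in> space M \<rightarrow> space Z"
      using measurable_space[OF Y_measurable] by auto
  qed (use False in auto)
qed

lemma J_burst_hist: "J t \<in> burst_hist t i \<rightarrow>\<^sub>M count_space UNIV"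
  by (rule generated_measurable[OF order_trans[OF _ burst_gen_subset]]) auto

text \<open>Each burst of the algorithm is an instance of the abstract one.\<close>

lemma mlmc_burst_at:
  assumes t: "t \<le> T"
  shows "mlmc_burst Z P \<pi> M (burst_hist t) (W t) T (J t) (hist t)"
proof unfold_locales
  show "subalgebra M (burst_hist t i)" for i by (rule subalgebra_burst_hist[OF t])
  show "sets (burst_hist t i) \<subseteq> sets (burst_hist t (Suc i))" for i
    unfolding sets_burst_hist by (intro sigma_sets_mono') auto
  show "W t i \<in> burst_hist t i \<rightarrow>\<^sub>M Z" for i by (rule W_burst_hist)
  show "(\<lambda>\<omega>. burst_len T (J t \<omega>)) \<in> burst_hist t 0 \<rightarrow>\<^sub>M count_space UNIV"
    by (rule measurable_compose[OF J_burst_hist]) simp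
  show "AE \<omega> in M. i < burst_len T (J t \<omega>) \<longrightarrow>
      real_cond_exp M (burst_hist t i) (\<lambda>\<omega>. indicat_real B (W t (Suc i) \<omega>)) \<omega> = measure (P (W t i \<omega>)) B"
    if "B \<in> sets Z" for i B
    by (rule chain_step[OF t that])
  show "space (hist t) = space M" by simp
  show "sets (hist t) \<subseteq> sets (burst_hist t 0)" by (rule hist_subset_burst_hist)
  show "W t 0 \<in> hist t \<rightarrow>\<^sub>M Z" by (rule W_0_hist)
  show "J t \<in> burst_hist t 0 \<rightarrow>\<^sub>M count_space UNIV" by (rule J_burst_hist)
  show "prob {\<omega> \<in> space M. J t \<omega> = j} = (1 / 2) ^ j" if "1 \<le> j" for j
    by (rule J_law[OF t that])
  show "prob (A \<inter> {\<omega> \<in> space M. J t \<omega> = j}) = prob A * prob {\<omega> \<in> space M. J t \<omega> = j}"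
    if "A \<in> sets (hist t)" for A j
  proof (rule indep_setD[OF J_indep[OF t] that])
    have "J t -` {j} \<inter> space M \<in> sets (vimage_algebra (space M) (J t) (count_space UNIV))"
      by (rule in_vimage_algebra) simp
    then show "{\<omega> \<in> space M. J t \<omega> = j} \<in> sets (vimage_algebra (space M) (J t) (count_space UNIV))"
      by (simp add: vimage_def Int_def conj_commute)
  qed
qed

end

section \<open>The recursion for the gradient error\<close>

context mlmc_fw
begin

abbreviation \<alpha> :: "nat \<Rightarrow> 'w \<Rightarrow> real" where
  "\<alpha> t \<omega> \<equiv> alpha \<beta> (\<lambda>i. l i \<omega>) (\<lambda>i. x i \<omega>) t"

text \<open>The previous error $s_{t-1}$; at \<open>t = 0\<close>, where it is multiplied by \<open>1 - \<alpha> 0 = 0\<close>, the conventions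
  $g_{-1} = 0$ and $x_{-1} = x_0$ are followed.\<close>

definition prev_error :: "nat \<Rightarrow> 'w \<Rightarrow> 'a" where
  "prev_error t \<omega> = (if t = 0 then 0 else g (t - 1) \<omega>) - gf (x (t - 1) \<omega>)"

text \<open>The field whose estimate is the new error made in iteration \<open>t\<close>. It has mean zero under \<open>\<pi>\<close>.\<close>

definition noise :: "nat \<Rightarrow> 'w \<Rightarrow> 'z \<Rightarrow> 'a" where
  "noise t \<omega> z = gz (x t \<omega>) z - gf (x t \<omega>) - (1 - \<alpha> t \<omega>) *\<^sub>R (gz (x (t - 1) \<omega>) z - gf (x (t - 1) \<omega>))"

text \<open>A bound for \<open>noise\<close>, known before the burst.\<close>

definition noise_level :: "nat \<Rightarrow> 'w \<Rightarrow> real" where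
  "noise_level t \<omega> = \<alpha> t \<omega> * G\<^sub>\<sigma> + 2 * L * norm (x t \<omega> - x (t - 1) \<omega>)"

lemma \<alpha>_bounds: "0 < \<alpha> t \<omega>" "\<alpha> t \<omega> \<le> 1"
  using alpha_pos[OF params(2)] alpha_le_1 by blast+

lemma norm_noise_le:
  assumes \<omega>: "\<omega> \<in> space M" and t: "t \<le> T" and z: "z \<in> space Z"
  shows "norm (noise t \<omega> z) \<le> noise_level t \<omega>"
proof -
  have X: "x t \<omega> \<in> X" "x (t - 1) \<omega> \<in> X" using x_in_X[OF \<omega>] t by auto
  let ?d = "norm (x t \<omega> - x (t - 1) \<omega>)"
  \<comment> \<open>The first part is weighted by \<open>\<alpha>\<close>, the second one is small because the iterates move little.\<close>
  have eq: "noise t \<omega> z = \<alpha> t \<omega> *\<^sub>R (gz (x t \<omega>) z - gf (x t \<omega>))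
      + (1 - \<alpha> t \<omega>) *\<^sub>R ((gz (x t \<omega>) z - gz (x (t - 1) \<omega>) z) - (gf (x t \<omega>) - gf (x (t - 1) \<omega>)))"
    by (simp add: noise_def algebra_simps)
  have "norm (\<alpha> t \<omega> *\<^sub>R (gz (x t \<omega>) z - gf (x t \<omega>))) \<le> \<alpha> t \<omega> * G\<^sub>\<sigma>"
    using mult_left_mono[OF noise_bound[OF X(1) z], of "\<alpha> t \<omega>"] \<alpha>_bounds[of \<omega> t] by simp
  moreover have "norm ((1 - \<alpha> t \<omega>) *\<^sub>R ((gz (x t \<omega>) z - gz (x (t - 1) \<omega>) z) - (gf (x t \<omega>) - gf (x (t - 1) \<omega>))))
      \<le> 1 * (L * ?d + L * ?d)"
  proof -
    have "norm ((gz (x t \<omega>) z - gz (x (t - 1) \<omega>) z) - (gf (x t \<omega>) - gf (x (t - 1) \<omega>))) \<le> L * ?d + L * ?d"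
      by (rule order_trans[OF norm_triangle_ineq4 add_mono[OF gz_lipschitz[OF z X] gf_lipschitz[OF X]]])
    then show ?thesis
      unfolding norm_scaleR using \<alpha>_bounds[of \<omega> t] by (intro mult_mono) auto
  qed
  ultimately have "norm (noise t \<omega> z) \<le> \<alpha> t \<omega> * G\<^sub>\<sigma> + 1 * (L * ?d + L * ?d)"
    unfolding eq by (rule norm_triangle_mono)
  then show ?thesis by (simp add: noise_level_def)
qed

lemma noise_mean:
  assumes \<omega>: "\<omega> \<in> space M" and t: "t \<le> T"
  shows "(LINT z|\<pi>. noise t \<omega> z) = 0"
proof -
  interpret \<pi>: prob_space \<pi> by (rule pi_prob_space)
  have X: "x t \<omega> \<in> X" "x (t - 1) \<omega> \<in> X" using x_in_X[OF \<omega>] t by auto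
  have "(LINT z|\<pi>. gz y z - gf y) = 0" if "y \<in> X" for y
    using gradient_integrable[OF that] \<pi>.prob_space by (simp add: gradient_unbiased[OF that])
  moreover have "integrable \<pi> (\<lambda>z. gz y z - gf y)" if "y \<in> X" for y
    using gradient_integrable[OF that] by simp
  ultimately show ?thesis
    using X unfolding noise_def by (subst Bochner_Integration.integral_diff) auto
qed

lemma step_bounded: "\<exists>B. \<forall>\<omega>\<in>space M. \<forall>t\<le>T. norm (x t \<omega> - x (t - 1) \<omega>) \<le> B"
proof -
  obtain b where b: "\<And>y. y \<in> X \<Longrightarrow> norm y \<le> b"
    using compact_imp_bounded[OF X(1)] by (auto simp: bounded_iff)
  have "norm (x t \<omega> - x (t - 1) \<omega>) \<le> b + b" if "\<omega> \<in> space M" "t \<le> T" for t \<omega>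
    using norm_triangle_ineq4 b[OF x_in_X[OF that(1)]] that(2) by (smt (verit) le_SucI diff_le_self le_trans)
  then show ?thesis by blast
qed

lemma \<alpha>_hist:
  assumes t: "t \<le> T"
  shows "\<alpha> t \<in> borel_measurable (hist t)"
  by (rule step_weight_measurable[OF space_hist t x_hist])

lemma noise_level_hist: "t \<le> T \<Longrightarrow> noise_level t \<in> borel_measurable (hist t)"
  unfolding noise_level_def using \<alpha>_hist x_hist[of t t] x_hist[of "t - 1" t] by simp

lemma centred_field_noise:
  assumes t: "t \<le> T"
  shows "\<exists>K. centred_field (hist t) (noise t) (noise_level t) K"
proof -
  obtain B where B: "\<And>\<omega>. \<omega> \<in> space M \<Longrightarrow> norm (x t \<omega> - x (t - 1) \<omega>) \<le> B"
    using step_bounded t by blast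
  have "noise_level t \<omega> \<le> 1 * G\<^sub>\<sigma> + 2 * L * B" if "\<omega> \<in> space M" for \<omega>
    unfolding noise_level_def using \<alpha>_bounds[of \<omega> t] noise_nonneg L_nonneg B[OF that]
    by (intro add_mono mult_mono) auto
  moreover have "(\<lambda>p. noise t (fst p) (snd p)) \<in> borel_measurable (hist t \<Otimes>\<^sub>M Z)"
  proof -
    have pt: "(\<lambda>p. gz (x s (fst p)) (snd p)) \<in> borel_measurable (hist t \<Otimes>\<^sub>M Z)"
      "(\<lambda>p. gf (x s (fst p))) \<in> borel_measurable (hist t \<Otimes>\<^sub>M Z)" if "s \<le> t" for s
    proof -
      have xs: "(\<lambda>p. x s (fst p)) \<in> borel_measurable (hist t \<Otimes>\<^sub>M Z)"
        by (rule measurable_compose[OF measurable_fst x_hist[OF that]])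
      have inX: "x s (fst p) \<in> X" if "p \<in> space (hist t \<Otimes>\<^sub>M Z)" for p
        using that \<open>s \<le> t\<close> t by (intro x_in_X) (auto simp: space_pair_measure)
      show "(\<lambda>p. gz (x s (fst p)) (snd p)) \<in> borel_measurable (hist t \<Otimes>\<^sub>M Z)"
        by (rule gz_compose_measurable[OF xs inX measurable_snd])
      show "(\<lambda>p. gf (x s (fst p))) \<in> borel_measurable (hist t \<Otimes>\<^sub>M Z)"
        by (rule gf_compose_measurable[OF xs inX])
    qed
    have "(\<lambda>p. \<alpha> t (fst p)) \<in> borel_measurable (hist t \<Otimes>\<^sub>M Z)"
      by (rule measurable_compose[OF measurable_fst \<alpha>_hist[OF t]])
    then show ?thesis
      unfolding noise_def using pt[of t] pt[of "t - 1"] by simp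
  qed
  ultimately show ?thesis
    using noise_level_hist[OF t] norm_noise_le[OF _ t] noise_mean[OF _ t]
    unfolding centred_field_def by auto
qed

text \<open>The projection does not increase the distance to the true gradient, which lies in the ball.\<close>

lemma error_le:
  assumes \<omega>: "\<omega> \<in> space M" and t: "t \<le> T"
  shows "norm (g t \<omega> - gf (x t \<omega>))
    \<le> norm ((1 - \<alpha> t \<omega>) *\<^sub>R prev_error t \<omega> + mlmc T (J t \<omega>) (\<lambda>i. W t i \<omega>) (noise t \<omega>))"
proof -
  let ?m = "\<lambda>y. mlmc T (J t \<omega>) (\<lambda>i. W t i \<omega>) (gz y)"
  let ?pre = "(1 - \<alpha> t \<omega>) *\<^sub>R ((if t = 0 then 0 else g (t - 1) \<omega>) - ?m (x (t - 1) \<omega>)) + ?m (x t \<omega>)"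
  have "x t \<omega> \<in> X" using x_in_X[OF \<omega>] t by simp
  then have "gf (x t \<omega>) \<in> cball 0 G'"
    using gradient_bound[of "x t \<omega>"] params(3) by simp
  then have "closest_point (cball 0 G') (gf (x t \<omega>)) = gf (x t \<omega>)"
    by (rule closest_point_self)
  then have "norm (g t \<omega> - gf (x t \<omega>)) = dist (closest_point (cball 0 G') ?pre) (closest_point (cball 0 G') (gf (x t \<omega>)))"
    by (simp only: run_g[OF \<omega> t] dist_norm)
  also have "\<dots> \<le> dist ?pre (gf (x t \<omega>))"
    using G'_nonneg by (intro closest_point_lipschitz) auto
  also have "\<dots> = norm ((1 - \<alpha> t \<omega>) *\<^sub>R prev_error t \<omega>
      + (?m (x t \<omega>) - gf (x t \<omega>) - (1 - \<alpha> t \<omega>) *\<^sub>R (?m (x (t - 1) \<omega>) - gf (x (t - 1) \<omega>))))"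
    by (simp add: dist_norm prev_error_def algebra_simps)
  also have "?m (x t \<omega>) - gf (x t \<omega>) - (1 - \<alpha> t \<omega>) *\<^sub>R (?m (x (t - 1) \<omega>) - gf (x (t - 1) \<omega>))
      = mlmc T (J t \<omega>) (\<lambda>i. W t i \<omega>) (noise t \<omega>)"
    unfolding noise_def[abs_def] by (rule mlmc_affine[symmetric])
  finally show ?thesis .
qed

lemma norm_g_le:
  assumes "\<omega> \<in> space M" "t \<le> T"
  shows "norm (g t \<omega>) \<le> G'"
proof -
  have "g t \<omega> \<in> cball 0 G'"
    unfolding run_g[OF assms] using G'_nonneg by (intro closest_point_in_set) auto
  then show ?thesis by simp
qed

lemma prev_error_le:
  assumes "\<omega> \<in> space M" "t \<le> T"
  shows "norm (prev_error t \<omega>) \<le> G' + G"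
proof -
  have "norm (if t = 0 then 0 else g (t - 1) \<omega>) \<le> G'"
    using norm_g_le[OF assms(1), of "t - 1"] G'_nonneg assms(2) by auto
  moreover have "norm (gf (x (t - 1) \<omega>)) \<le> G"
    using x_in_X[OF assms(1)] assms(2) by (intro gradient_bound) auto
  ultimately show ?thesis
    unfolding prev_error_def by (intro order_trans[OF norm_triangle_ineq4] add_mono)
qed

lemma prev_error_hist: "t \<le> T \<Longrightarrow> prev_error t \<in> borel_measurable (hist t)"
proof -
  assume t: "t \<le> T"
  have "(\<lambda>\<omega>. gf (x (t - 1) \<omega>)) \<in> borel_measurable (hist t)"
    using x_in_X t by (intro gf_compose_measurable x_hist) auto
  moreover have "(\<lambda>\<omega>. if t = 0 then 0 else g (t - 1) \<omega>) \<in> borel_measurable (hist t)"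
    using g_hist[of "t - 1" t] by (cases "t = 0") auto
  ultimately show ?thesis unfolding prev_error_def by (rule borel_measurable_diff[rotated])
qed

text \<open>The bound for the conditional second moment of the error that comes from expanding
  $\|(1 - \alpha_t) s_{t-1} + \xi\|^2$, with \<open>\<xi>\<close> the estimate of the noise field: the cross term sees only
  the bias of \<open>\<xi>\<close>.\<close>

definition error_bound :: "nat \<Rightarrow> 'w \<Rightarrow> real" where
  "error_bound t \<omega> = (1 - \<alpha> t \<omega>)\<^sup>2 * (norm (prev_error t \<omega>))\<^sup>2
    + 4 * real \<tau> / 2 ^ j_max T * (2 * (1 - \<alpha> t \<omega>) * norm (prev_error t \<omega>) * noise_level t \<omega>)
    + (2 + 96 * real \<tau> * real (j_max T)) * (noise_level t \<omega>)\<^sup>2"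

lemma cond_exp_error_le:
  assumes t: "t \<le> T"
  shows "AE \<omega> in M. real_cond_exp M (hist t) (\<lambda>\<omega>. (norm (g t \<omega> - gf (x t \<omega>)))\<^sup>2) \<omega> \<le> error_bound t \<omega>"
proof -
  interpret B: mlmc_burst Z P \<pi> M "burst_hist t" "W t" T "J t" "hist t"
    by (rule mlmc_burst_at[OF t])
  interpret F: finite_measure_subalgebra M "hist t"
    by unfold_locales (rule subalgebra_hist[OF t])
  obtain K where field: "centred_field (hist t) (noise t) (noise_level t) K"
    using centred_field_noise[OF t] by blast
  let ?\<xi> = "\<lambda>\<omega>. mlmc T (J t \<omega>) (\<lambda>i. W t i \<omega>) (noise t \<omega>)"
  let ?p = "prev_error t" and ?C = "noise_level t" and ?a = "\<lambda>\<omega>. 1 - \<alpha> t \<omega>"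
  let ?b = "4 * real \<tau> / 2 ^ j_max T" and ?V = "2 + 96 * real \<tau> * real (j_max T)"
  define Kp where "Kp = G' + G"
  define K\<xi> where "K\<xi> = K + (\<Sum>j=1..j_max T. 2 ^ j * (2 * K))"
  have p_le: "norm (?p \<omega>) \<le> Kp" if "\<omega> \<in> space M" for \<omega>
    using prev_error_le[OF that t] by (simp add: Kp_def)
  have \<xi>_le: "norm (?\<xi> \<omega>) \<le> K\<xi>" if "\<omega> \<in> space M" for \<omega>
    using B.estimate_bounded[OF field that] by (simp add: K\<xi>_def)
  have C_le: "0 \<le> ?C \<omega>" "?C \<omega> \<le> K" if "\<omega> \<in> space M" for \<omega>
    using B.field_bound_nonneg[OF field that] B.field_bound_le[OF field that] .
  have Kp: "0 \<le> Kp" using G_nonneg G'_nonneg by (simp add: Kp_def)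
  have a: "0 \<le> ?a \<omega>" "?a \<omega> \<le> 1" for \<omega> using \<alpha>_bounds[of \<omega> t] by simp_all
  have [measurable]: "\<alpha> t \<in> borel_measurable (hist t)" "?p \<in> borel_measurable (hist t)"
      "?C \<in> borel_measurable (hist t)"
    using \<alpha>_hist prev_error_hist noise_level_hist t by auto
  note to_M = measurable_from_subalg[OF subalgebra_hist[OF t]]
  have [measurable]: "\<alpha> t \<in> borel_measurable M" "?p \<in> borel_measurable M" "?C \<in> borel_measurable M"
    by (rule to_M, measurable)+
  have [measurable]: "?\<xi> \<in> borel_measurable M"
    by (rule B.estimate_measurable[OF field])
  have [measurable]: "g t \<in> borel_measurable M" "(\<lambda>\<omega>. gf (x t \<omega>)) \<in> borel_measurable M"
    using x_g_measurable[OF t] x_in_X t by (auto intro!: gf_compose_measurable)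
  let ?s = "\<lambda>\<omega>. (norm (g t \<omega> - gf (x t \<omega>)))\<^sup>2"
  have int_s: "integrable M ?s"
  proof (rule B.integrable_bounded)
    show "norm (?s \<omega>) \<le> (G' + G)\<^sup>2" if "\<omega> \<in> space M" for \<omega>
    proof -
      have "norm (g t \<omega> - gf (x t \<omega>)) \<le> G' + G"
        using norm_g_le[OF that t] gradient_bound[OF x_in_X[OF that], of t] t
        by (intro order_trans[OF norm_triangle_ineq4] add_mono) auto
      then show ?thesis by (simp add: power_mono)
    qed
  qed measurable
  have int1: "integrable M (\<lambda>\<omega>. (?a \<omega>)\<^sup>2 * (norm (?p \<omega>))\<^sup>2)"
  proof (rule B.integrable_bounded)
    show "norm ((?a \<omega>)\<^sup>2 * (norm (?p \<omega>))\<^sup>2) \<le> 1 * Kp\<^sup>2" if "\<omega> \<in> space M" for \<omega>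
      using a[of \<omega>] p_le[OF that] unfolding real_norm_def abs_mult
      by (intro mult_mono) (auto simp: power_le_one intro: power_mono)
  qed measurable
  have int2: "integrable M (\<lambda>\<omega>. 2 * ?a \<omega> * norm (?p \<omega>) * ?C \<omega>)"
  proof (rule B.integrable_bounded)
    show "norm (2 * ?a \<omega> * norm (?p \<omega>) * ?C \<omega>) \<le> 2 * 1 * Kp * K" if "\<omega> \<in> space M" for \<omega>
      using a[of \<omega>] p_le[OF that] C_le[OF that] Kp unfolding real_norm_def abs_mult
      by (intro mult_mono) auto
  qed measurable
  have int3: "integrable M (\<lambda>\<omega>. (?C \<omega>)\<^sup>2)"
  proof (rule B.integrable_bounded)
    show "norm ((?C \<omega>)\<^sup>2) \<le> K\<^sup>2" if "\<omega> \<in> space M" for \<omega>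
      using C_le[OF that] by (simp add: power_mono)
  qed measurable
  show ?thesis
  proof (rule F.real_cond_exp_le_of_set_integrals[OF int_s])
    show "integrable M (error_bound t)"
      unfolding error_bound_def[abs_def] using int1 int2 int3
      by (intro Bochner_Integration.integrable_add integrable_mult_right)
    show "error_bound t \<in> borel_measurable (hist t)"
      unfolding error_bound_def[abs_def] by measurable
    fix A assume A: "A \<in> sets (hist t)"
    then have A_M: "A \<in> sets M" using subalgebra_hist[OF t] by (auto simp: subalgebra_def)
    let ?u = "indicat_real A"
    have u_F: "?u \<in> borel_measurable (hist t)" using A by simp
    have u01: "0 \<le> ?u \<omega> \<and> ?u \<omega> \<le> 1" for \<omega> by (simp add: indicator_def)
    have int_u: "integrable M (\<lambda>\<omega>. ?u \<omega> * f \<omega>)" if "integrable M f" for f :: "'w \<Rightarrow> real"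
      using integrable_mult_indicator[OF A_M that] by simp
    define w where "w \<omega> = (?u \<omega> * (2 * ?a \<omega>)) *\<^sub>R ?p \<omega>" for \<omega>
    have w_F: "w \<in> borel_measurable (hist t)" unfolding w_def using u_F by measurable
    have w_M: "w \<in> borel_measurable M" by (rule to_M[OF w_F])
    have norm_w: "norm (w \<omega>) = ?u \<omega> * (2 * ?a \<omega> * norm (?p \<omega>))" for \<omega>
      using a[of \<omega>] by (simp add: w_def abs_mult)
    have w_le: "norm (w \<omega>) \<le> 2 * Kp" if "\<omega> \<in> space M" for \<omega>
    proof -
      have "?u \<omega> * (2 * ?a \<omega> * norm (?p \<omega>)) \<le> 1 * (2 * 1 * Kp)"
        using a[of \<omega>] p_le[OF that] u01[of \<omega>] by (intro mult_mono) auto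
      then show ?thesis by (simp add: norm_w)
    qed
    have int_w\<xi>: "integrable M (\<lambda>\<omega>. w \<omega> \<bullet> ?\<xi> \<omega>)"
    proof (rule B.integrable_bounded)
      show "norm (w \<omega> \<bullet> ?\<xi> \<omega>) \<le> 2 * Kp * K\<xi>" if "\<omega> \<in> space M" for \<omega>
        unfolding real_norm_def
        by (rule order_trans[OF Cauchy_Schwarz_ineq2 mult_mono[OF w_le[OF that] \<xi>_le[OF that]]])
          (use Kp in auto)
    qed (use w_M in measurable)
    have int_\<xi>: "integrable M (\<lambda>\<omega>. (norm (?\<xi> \<omega>))\<^sup>2)"
    proof (rule B.integrable_bounded)
      show "norm ((norm (?\<xi> \<omega>))\<^sup>2) \<le> K\<xi>\<^sup>2" if "\<omega> \<in> space M" for \<omega>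
        using \<xi>_le[OF that] by (simp add: power_mono)
    qed measurable
    have expand: "?u \<omega> * ?s \<omega> \<le> ?u \<omega> * ((?a \<omega>)\<^sup>2 * (norm (?p \<omega>))\<^sup>2) + w \<omega> \<bullet> ?\<xi> \<omega>
        + ?u \<omega> * (norm (?\<xi> \<omega>))\<^sup>2" if "\<omega> \<in> space M" for \<omega>
    proof -
      have "?s \<omega> \<le> (norm (?a \<omega> *\<^sub>R ?p \<omega> + ?\<xi> \<omega>))\<^sup>2"
        using error_le[OF that t] by (intro power_mono) auto
      also have "\<dots> = (?a \<omega>)\<^sup>2 * (norm (?p \<omega>))\<^sup>2 + 2 * ?a \<omega> * (?p \<omega> \<bullet> ?\<xi> \<omega>) + (norm (?\<xi> \<omega>))\<^sup>2"
        unfolding power2_norm_eq_inner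
        by (simp add: inner_add_left inner_add_right inner_commute power2_eq_square)
      finally have "?u \<omega> * ?s \<omega> \<le> ?u \<omega> * ((?a \<omega>)\<^sup>2 * (norm (?p \<omega>))\<^sup>2 + 2 * ?a \<omega> * (?p \<omega> \<bullet> ?\<xi> \<omega>) + (norm (?\<xi> \<omega>))\<^sup>2)"
        using u01[of \<omega>] by (intro mult_left_mono) auto
      also have "\<dots> = ?u \<omega> * ((?a \<omega>)\<^sup>2 * (norm (?p \<omega>))\<^sup>2) + w \<omega> \<bullet> ?\<xi> \<omega> + ?u \<omega> * (norm (?\<xi> \<omega>))\<^sup>2"
        by (simp add: w_def distrib_left mult.assoc)
      finally show ?thesis .
    qed
    have "(LINT \<omega>|M. ?u \<omega> * ?s \<omega>)
        \<le> (LINT \<omega>|M. ?u \<omega> * ((?a \<omega>)\<^sup>2 * (norm (?p \<omega>))\<^sup>2) + w \<omega> \<bullet> ?\<xi> \<omega> + ?u \<omega> * (norm (?\<xi> \<omega>))\<^sup>2)"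
      using expand by (intro integral_mono Bochner_Integration.integrable_add int_u int_s int1 int_w\<xi> int_\<xi>)
    also have "\<dots> = (LINT \<omega>|M. ?u \<omega> * ((?a \<omega>)\<^sup>2 * (norm (?p \<omega>))\<^sup>2)) + (LINT \<omega>|M. w \<omega> \<bullet> ?\<xi> \<omega>)
        + (LINT \<omega>|M. ?u \<omega> * (norm (?\<xi> \<omega>))\<^sup>2)"
      by (simp only: Bochner_Integration.integral_add Bochner_Integration.integrable_add
          int_u[OF int1] int_w\<xi> int_u[OF int_\<xi>])
    also have "\<dots> \<le> (LINT \<omega>|M. ?u \<omega> * ((?a \<omega>)\<^sup>2 * (norm (?p \<omega>))\<^sup>2))
        + ?b * (LINT \<omega>|M. norm (w \<omega>) * ?C \<omega>) + ?V * (LINT \<omega>|M. ?u \<omega> * (?C \<omega>)\<^sup>2)"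
      using B.estimate_bias[OF field w_F w_le] B.estimate_second_moment[OF field u_F u01]
      by (intro add_mono) auto
    also have "\<dots> = (LINT \<omega>|M. ?u \<omega> * error_bound t \<omega>)"
    proof -
      have w_eq: "norm (w \<omega>) * ?C \<omega> = ?u \<omega> * (2 * ?a \<omega> * norm (?p \<omega>) * ?C \<omega>)" for \<omega>
        by (simp add: norm_w)
      have "?u \<omega> * error_bound t \<omega> = ?u \<omega> * ((?a \<omega>)\<^sup>2 * (norm (?p \<omega>))\<^sup>2)
          + ?b * (?u \<omega> * (2 * ?a \<omega> * norm (?p \<omega>) * ?C \<omega>)) + ?V * (?u \<omega> * (?C \<omega>)\<^sup>2)" for \<omega>
        unfolding error_bound_def by (simp only: distrib_left mult.left_commute)
      then show ?thesis
        using int_u[OF int1] int_u[OF int2] int_u[OF int3] unfolding w_eq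
        by (simp only: Bochner_Integration.integral_add Bochner_Integration.integrable_add
            integrable_mult_right integral_mult_right_zero)
    qed
    finally show "(LINT \<omega>|M. ?u \<omega> * ?s \<omega>) \<le> (LINT \<omega>|M. ?u \<omega> * error_bound t \<omega>)" .
  qed
qed

lemma
  assumes "1 \<le> T"
  shows two_power_j_max: "real T \<le> 2 * 2 ^ j_max T" and j_max_le_log: "real (j_max T) \<le> log 2 (real T)"
proof -
  have log: "0 \<le> log 2 (real T)" using assms by (subst zero_le_log_cancel_iff) auto
  then have j: "real (j_max T) = real_of_int \<lfloor>log 2 (real T)\<rfloor>" by (simp add: j_max_def)
  then show "real (j_max T) \<le> log 2 (real T)" by simp
  have "real T = 2 powr log 2 (real T)" using assms by simp
  also have "\<dots> \<le> 2 powr (real (j_max T) + 1)" unfolding j by (intro powr_mono) linarith+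
  also have "\<dots> = 2 * 2 ^ j_max T" by (simp add: powr_add powr_realpow)
  finally show "real T \<le> 2 * 2 ^ j_max T" .
qed

text \<open>Young's inequality for the cross term; \<open>(1 - a)\<^sup>2 + (1 - a) * a = 1 - a\<close>.\<close>

lemma cross_term_le:
  fixes a b k C S :: real
  assumes a: "0 < a" "a \<le> 1" and b: "b\<^sup>2 \<le> k * a" and k: "0 \<le> k"
  shows "(1 - a)\<^sup>2 * S\<^sup>2 + b * (2 * (1 - a) * S * C) \<le> (1 - a) * S\<^sup>2 + k * C\<^sup>2"
proof -
  have "2 * a * S * b * C \<le> (a * S)\<^sup>2 + (b * C)\<^sup>2"
    using sum_squares_bound[of "a * S" "b * C"] by (simp add: mult_ac)
  also have "(b * C)\<^sup>2 \<le> k * a * C\<^sup>2"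
    unfolding power_mult_distrib using b by (intro mult_right_mono) auto
  finally have "a * (2 * S * b * C) \<le> a * (a * S\<^sup>2 + k * C\<^sup>2)"
    by (simp add: power2_eq_square algebra_simps)
  then have "2 * S * b * C \<le> a * S\<^sup>2 + k * C\<^sup>2"
    using a(1) by simp
  then have "(1 - a) * (2 * S * b * C) \<le> (1 - a) * (a * S\<^sup>2 + k * C\<^sup>2)"
    using a(2) by (intro mult_left_mono) auto
  also have "\<dots> \<le> (1 - a) * a * S\<^sup>2 + k * C\<^sup>2"
    using mult_right_mono[of "1 - a" 1 "k * C\<^sup>2"] a k by (simp add: algebra_simps)
  finally show ?thesis by (simp add: power2_eq_square algebra_simps)
qed

text \<open>The constant of the final bounds. It dominates the variance factor of the estimator plus what the
  bias contributes.\<close>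

definition \<Lambda> :: real where
  "\<Lambda> = 306 * real \<tau> * (1 + log 2 (real T))"

context
  assumes horizon: "(128 * real \<tau>) powr (3 / 4) \<le> real T"
begin

lemma T_ge_1: "1 \<le> T"
proof -
  have "0 < (128 * real \<tau>) powr (3 / 4)" using tau_mix_ge_1 by simp
  then show ?thesis using horizon by (cases "T = 0") auto
qed

text \<open>The bias is of order \<open>\<tau> / T\<close>. Absorbing the cross term by Young's inequality costs the squared
  bias divided by \<open>\<alpha>\<close>, which is harmless because \<open>\<alpha> \<ge> T powr (- 2 / 3)\<close> and
  \<open>128 * \<tau> \<le> T powr (4 / 3)\<close>.\<close>

lemma bias_sq_le:
  assumes t: "t \<le> T"
  shows "(4 * real \<tau> / 2 ^ j_max T)\<^sup>2 \<le> real \<tau> / 2 * \<alpha> t \<omega>"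
proof -
  have T: "0 < real T" using T_ge_1 by simp
  have "128 * real \<tau> = ((128 * real \<tau>) powr (3 / 4)) powr (4 / 3)"
    using tau_mix_ge_1 by (simp add: powr_powr)
  also have "\<dots> \<le> real T powr (4 / 3)"
    using horizon by (intro powr_mono2) auto
  finally have tau_le: "128 * real \<tau> \<le> real T powr (4 / 3)" .
  have "4 * real \<tau> / 2 ^ j_max T \<le> 8 * real \<tau> / real T"
    using two_power_j_max[OF T_ge_1] T mult_left_mono[of "real T" "2 * 2 ^ j_max T" "4 * real \<tau>"]
    by (simp add: field_simps)
  then have "(4 * real \<tau> / 2 ^ j_max T)\<^sup>2 \<le> (8 * real \<tau> / real T)\<^sup>2"
    by (intro power_mono) auto
  also have "\<dots> = real \<tau> / 2 * (128 * real \<tau>) / (real T)\<^sup>2"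
    by (simp add: power2_eq_square)
  also have "\<dots> \<le> real \<tau> / 2 * real T powr (4 / 3) / (real T)\<^sup>2"
    using tau_le by (intro divide_right_mono mult_left_mono) auto
  also have "\<dots> = real \<tau> / 2 * real T powr (- 2 / 3)"
  proof -
    have "real T powr (4 / 3) = real T powr (- 2 / 3) * real T powr 2"
      using powr_add[of "real T" "- 2 / 3" 2] by simp
    then show ?thesis using T by simp
  qed
  also have "\<dots> \<le> real \<tau> / 2 * \<alpha> t \<omega>"
    using T_ge_1 by (intro mult_left_mono alpha_ge[OF params(2) t]) auto
  finally show ?thesis .
qed

lemma variance_factor_le: "2 + 96 * real \<tau> * real (j_max T) + real \<tau> / 2 \<le> \<Lambda>"
proof -
  have \<tau>: "1 \<le> real \<tau>" using tau_mix_ge_1 by simp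
  have "96 * real \<tau> * real (j_max T) \<le> 306 * real \<tau> * log 2 (real T)"
    using j_max_le_log[OF T_ge_1] by (intro mult_mono) auto
  moreover have "\<Lambda> = 306 * real \<tau> + 306 * real \<tau> * log 2 (real T)"
    by (simp add: \<Lambda>_def algebra_simps)
  ultimately show ?thesis using \<tau> by linarith
qed

text \<open>The factor \<open>1 - \<alpha>\<close> in place of \<open>(1 - \<alpha>)\<^sup>2\<close> is the price of the cross term.\<close>

lemma error_bound_le:
  assumes t: "t \<le> T"
  shows "error_bound t \<omega> \<le> (1 - \<alpha> t \<omega>) * (norm (prev_error t \<omega>))\<^sup>2 + \<Lambda> * (noise_level t \<omega>)\<^sup>2"
proof -
  let ?V = "2 + 96 * real \<tau> * real (j_max T)"
  have "error_bound t \<omega> \<le> (1 - \<alpha> t \<omega>) * (norm (prev_error t \<omega>))\<^sup>2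
      + real \<tau> / 2 * (noise_level t \<omega>)\<^sup>2 + ?V * (noise_level t \<omega>)\<^sup>2"
    unfolding error_bound_def
    by (intro add_right_mono cross_term_le \<alpha>_bounds bias_sq_le[OF t]) simp
  also have "\<dots> = (1 - \<alpha> t \<omega>) * (norm (prev_error t \<omega>))\<^sup>2 + (?V + real \<tau> / 2) * (noise_level t \<omega>)\<^sup>2"
    by (simp add: algebra_simps)
  also have "\<dots> \<le> (1 - \<alpha> t \<omega>) * (norm (prev_error t \<omega>))\<^sup>2 + \<Lambda> * (noise_level t \<omega>)\<^sup>2"
    by (intro add_left_mono mult_right_mono variance_factor_le) simp
  finally show ?thesis .
qed

lemma noise_level_sq_le:
  "(noise_level t \<omega>)\<^sup>2 \<le> 2 * (\<alpha> t \<omega>)\<^sup>2 * G\<^sub>\<sigma>\<^sup>2 + 8 * L\<^sup>2 * (norm (x t \<omega> - x (t - 1) \<omega>))\<^sup>2"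
proof -
  have "(p + q)\<^sup>2 \<le> 2 * p\<^sup>2 + 2 * q\<^sup>2" for p q :: real
    using sum_squares_bound[of p q] by (simp add: power2_sum)
  from this[of "\<alpha> t \<omega> * G\<^sub>\<sigma>" "2 * L * norm (x t \<omega> - x (t - 1) \<omega>)"]
  show ?thesis by (simp add: noise_level_def power_mult_distrib)
qed

lemma initial_error:
  "AE \<omega> in M. real_cond_exp M (hist 0) (\<lambda>\<omega>. (norm (g 0 \<omega> - gf (x 0 \<omega>)))\<^sup>2) \<omega> \<le> \<Lambda> * G\<^sub>\<sigma>\<^sup>2"
  using cond_exp_error_le[OF le0]
proof eventually_elim
  case (elim \<omega>)
  have "error_bound 0 \<omega> \<le> \<Lambda> * G\<^sub>\<sigma>\<^sup>2"
    using error_bound_le[OF le0, of \<omega>] by (simp add: alpha_0 noise_level_def)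
  with elim show ?case by (rule order_trans)
qed

lemma error_recursion:
  assumes t: "1 \<le> t" "t \<le> T"
  shows "AE \<omega> in M. real_cond_exp M (hist t) (\<lambda>\<omega>. (norm (g t \<omega> - gf (x t \<omega>)))\<^sup>2) \<omega>
    \<le> (1 - \<alpha> t \<omega>) * (norm (g (t - 1) \<omega> - gf (x (t - 1) \<omega>)))\<^sup>2 + 2 * (\<alpha> t \<omega>)\<^sup>2 * (2 * \<Lambda> * G\<^sub>\<sigma>\<^sup>2)
      + 8 * (2 * \<Lambda> * L\<^sup>2) * (norm (x t \<omega> - x (t - 1) \<omega>))\<^sup>2"
  using cond_exp_error_le[OF t(2)]
proof eventually_elim
  case (elim \<omega>)
  have \<Lambda>: "0 \<le> \<Lambda>" using order_trans[OF _ variance_factor_le] by simp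
  have "\<Lambda> * (noise_level t \<omega>)\<^sup>2
      \<le> \<Lambda> * (2 * (2 * (\<alpha> t \<omega>)\<^sup>2 * G\<^sub>\<sigma>\<^sup>2 + 8 * L\<^sup>2 * (norm (x t \<omega> - x (t - 1) \<omega>))\<^sup>2))"
  proof (rule mult_left_mono[OF _ \<Lambda>])
    have "c \<le> 2 * d" if "c \<le> d" "0 \<le> c" for c d :: real
      using that by linarith
    from this[OF noise_level_sq_le zero_le_power2]
    show "(noise_level t \<omega>)\<^sup>2
        \<le> 2 * (2 * (\<alpha> t \<omega>)\<^sup>2 * G\<^sub>\<sigma>\<^sup>2 + 8 * L\<^sup>2 * (norm (x t \<omega> - x (t - 1) \<omega>))\<^sup>2)" .
  qed
  then have "error_bound t \<omega> \<le> (1 - \<alpha> t \<omega>) * (norm (prev_error t \<omega>))\<^sup>2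
      + \<Lambda> * (2 * (2 * (\<alpha> t \<omega>)\<^sup>2 * G\<^sub>\<sigma>\<^sup>2 + 8 * L\<^sup>2 * (norm (x t \<omega> - x (t - 1) \<omega>))\<^sup>2))"
    using error_bound_le[OF t(2), of \<omega>] by linarith
  moreover have "prev_error t \<omega> = g (t - 1) \<omega> - gf (x (t - 1) \<omega>)"
    using t(1) by (simp add: prev_error_def)
  ultimately show ?case using elim by (simp add: algebra_simps)
qed

end

end

theorem theorem5p4:
  fixes Z :: "'z measure" and P :: "'z \<Rightarrow> 'z measure" and \<pi> :: "'z measure"
    and X :: "'a::euclidean_space set" and h :: "'a \<Rightarrow> ereal"
    and fz :: "'a \<Rightarrow> 'z \<Rightarrow> real" and gz :: "'a \<Rightarrow> 'z \<Rightarrow> 'a" and gf :: "'a \<Rightarrow> 'a"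
    and G L G\<^sub>\<sigma> :: real
    and M :: "'w measure"
    and T :: nat and \<rho> \<beta> G' :: real
    and Y :: "nat \<Rightarrow> 'w \<Rightarrow> 'z" and J :: "nat \<Rightarrow> 'w \<Rightarrow> nat"
    and x g v :: "nat \<Rightarrow> 'w \<Rightarrow> 'a" and l :: "nat \<Rightarrow> 'w \<Rightarrow> real"
    and \<Lambda> \<sigma>\<^sub>M_sq L\<^sub>M_sq :: real and T\<^sub>0 :: int
    and \<alpha> :: "nat \<Rightarrow> 'w \<Rightarrow> real" and s :: "nat \<Rightarrow> 'w \<Rightarrow> 'a" and \<F> :: "nat \<Rightarrow> 'w measure"
  assumes setting: "mlmc_fw Z P \<pi> X h fz gz gf G L G\<^sub>\<sigma> M T \<rho> \<beta> G' Y J x g v l"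
    and Lambda: "\<Lambda> = 306 * real (tau_mix Z P \<pi>) * (1 + log 2 (real T))"
    and sigma_M: "\<sigma>\<^sub>M_sq = 2 * \<Lambda> * G\<^sub>\<sigma>\<^sup>2"
    and L_M: "L\<^sub>M_sq = 2 * \<Lambda> * L\<^sup>2"
    and T0: "T\<^sub>0 = \<lceil>(128 * real (tau_mix Z P \<pi>)) powr (3 / 4)\<rceil>"
    and alpha: "\<alpha> = (\<lambda>t \<omega>. alpha \<beta> (\<lambda>i. l i \<omega>) (\<lambda>i. x i \<omega>) t)"
    and s: "s = (\<lambda>t \<omega>. g t \<omega> - gf (x t \<omega>))"
    and history: "\<F> = history M Z T Y J x g v"  \<comment> \<open>\<open>\<F> t\<close> is $\mathcal F_{t-1}$\<close>
    and horizon: "int T \<ge> T\<^sub>0"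
  shows "(AE \<omega> in M. real_cond_exp M (\<F> 0) (\<lambda>\<omega>. (norm (s 0 \<omega>))\<^sup>2) \<omega> \<le> \<Lambda> * G\<^sub>\<sigma>\<^sup>2) \<and>
    (\<forall>t\<in>{1..T}. AE \<omega> in M.
       real_cond_exp M (\<F> t) (\<lambda>\<omega>. (norm (s t \<omega>))\<^sup>2) \<omega>
         \<le> (1 - \<alpha> t \<omega>) * (norm (s (t - 1) \<omega>))\<^sup>2 + 2 * (\<alpha> t \<omega>)\<^sup>2 * \<sigma>\<^sub>M_sq
            + 8 * L\<^sub>M_sq * (norm (x t \<omega> - x (t - 1) \<omega>))\<^sup>2)"
proof -
  interpret mlmc_fw Z P \<pi> X h fz gz gf G L G\<^sub>\<sigma> M T \<rho> \<beta> G' Y J x g v l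
    by (rule setting)
  have T: "(128 * real (tau_mix Z P \<pi>)) powr (3 / 4) \<le> real T"
    using horizon unfolding T0 by (simp add: ceiling_le_iff)
  note \<Lambda> = \<Lambda>_def[folded Lambda]
  show ?thesis
    using initial_error[OF T] error_recursion[OF T]
    unfolding s alpha history sigma_M L_M \<Lambda> by auto
qed

end
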